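(* Let $n\ge 1$, $p>0$, $\alpha>-1$, $0<q<p+2$, and let $f$ be holomorphic on the open unit ball $\mathbb{B}_n\subset\mathbb{C}^n$. Define $$I_1(f)=\int_{\mathbb{B}_n}|f(z)|^p\,dv_\alpha(z),\qquad I_2(f)=\int_{\mathbb{B}_n}|f(z)|^{p-q}\big[(1-|z|^2)|Rf(z)|\big]^q\,dv_\alpha(z),$$ $$I_3(f)=\int_{\mathbb{B}_n}|f(z)|^{p-q}\big[(1-|z|^2)|\nabla f(z)|\big]^q\,dv_\alpha(z),\qquad I_4(f)=\int_{\mathbb{B}_n}|f(z)|^{p-q}|\widetilde\nabla f(z)|^q\,dv_\alpha(z).$$ Then the following are equivalent: (a) $I_1(f)<\infty$, i.e. $f\in A^p_\alpha$; (b) $I_2(f)<\infty$; (c) $I_3(f)<\infty$; (d) $I_4(f)<\infty$. Furthermore, the quantities $I_1(f)$, $|f(0)|^p+I_2(f)$, $|f(0)|^p+I_3(f)$, $|f(0)|^p+I_4(f)$ are comparable for $f$ holomorphic on $\mathbb{B}_n$, i.e. there is a constant $C>0$ depending only on $n,p,q,\alpha$ such that each of these quantities is at most $C$ times any other one, for all holomorphic $f$ on $\mathbb{B}_n$.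
   Context: $\mathbb{B}_n$ is the open unit ball of $\mathbb{C}^n$, $dv$ is the normalized (total mass 1) Lebesgue volume measure on $\mathbb{B}_n$, and for $\alpha>-1$, $dv_\alpha(z)=c_\alpha(1-|z|^2)^\alpha\,dv(z)$ where $c_\alpha>0$ makes $dv_\alpha$ a probability measure. The weighted Bergman space $A^p_\alpha$ is the space of holomorphic functions on $\mathbb{B}_n$ belonging to $L^p(\mathbb{B}_n,dv_\alpha)$. For holomorphic $f$: the radial derivative is $Rf(z)=\sum_{k=1}^n z_k\frac{\partial f}{\partial z_k}(z)$; the complex gradient is $|\nabla f(z)|=\big(\sum_{k=1}^n|\frac{\partial f}{\partial z_k}(z)|^2\big)^{1/2}$; the invariant gradient is $|\widetilde\nabla f(z)|=|\nabla(f\circ\varphi_z)(0)|$, where for $a\in\mathbb{B}_n$, $\varphi_a$ is the unique biholomorphic automorphism of $\mathbb{B}_n$ with $\varphi_a(0)=a$, $\varphi_a(a)=0$ and $\varphi_a\circ\varphi_a=\mathrm{id}$. *)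

theory Defs
  imports "HOL-Analysis.Analysis"
begin

text \<open>The unit ball of C^n is ball 0 1 in complex^'n (Euclidean norm).
  Holomorphy on an open set: complex Frechet differentiability at every point.\<close>

definition holo_on :: "(complex^'n \<Rightarrow> complex) \<Rightarrow> (complex^'n) set \<Rightarrow> bool" where
  "holo_on f S \<longleftrightarrow> (\<forall>z\<in>S. \<exists>L. (f has_derivative L) (at z) \<and>
       (\<forall>(c::complex) v. L (c *s v) = c * L v))"

definition pderiv_c :: "(complex^'n \<Rightarrow> complex) \<Rightarrow> 'n \<Rightarrow> complex^'n \<Rightarrow> complex" where
  "pderiv_c f k z = deriv (\<lambda>w. f (z + axis k w)) 0"

definition radial_deriv :: "(complex^'n \<Rightarrow> complex) \<Rightarrow> complex^'n \<Rightarrow> complex" where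
  "radial_deriv f z = (\<Sum>k\<in>UNIV. z $ k * pderiv_c f k z)"

definition cgrad_norm :: "(complex^'n \<Rightarrow> complex) \<Rightarrow> complex^'n \<Rightarrow> real" where
  "cgrad_norm f z = sqrt (\<Sum>k\<in>UNIV. (cmod (pderiv_c f k z))\<^sup>2)"

text \<open>Hermitian inner product and the involutive automorphism phi_a (Rudin's formula).\<close>
definition herm :: "complex^'n \<Rightarrow> complex^'n \<Rightarrow> complex" where
  "herm z a = (\<Sum>k\<in>UNIV. z $ k * cnj (a $ k))"

definition ball_aut :: "complex^'n \<Rightarrow> complex^'n \<Rightarrow> complex^'n" where
  "ball_aut a z =
     (let Pz = (herm z a / herm a a) *s a;
          Qz = z - Pz;
          s = complex_of_real (sqrt (1 - (norm a)\<^sup>2))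
      in (1 / (1 - herm z a)) *s (a - Pz - s *s Qz))"

definition inv_grad_norm :: "(complex^'n \<Rightarrow> complex) \<Rightarrow> complex^'n \<Rightarrow> real" where
  "inv_grad_norm f z = cgrad_norm (f \<circ> ball_aut z) 0"

definition dv_alpha :: "real \<Rightarrow> (complex^'n) measure" where
  "dv_alpha \<alpha> = density lborel (\<lambda>z.
      indicator (ball 0 1) z * ennreal ((1 - (norm z)\<^sup>2) powr \<alpha>) /
      (\<integral>\<^sup>+ (w::complex^'n). indicator (ball 0 1) w * ennreal ((1 - (norm w)\<^sup>2) powr \<alpha>) \<partial>lborel))"

definition I1 :: "real \<Rightarrow> real \<Rightarrow> (complex^'n \<Rightarrow> complex) \<Rightarrow> ennreal" where
  "I1 p \<alpha> f = (\<integral>\<^sup>+ z. ennreal (cmod (f z) powr p) \<partial>(dv_alpha \<alpha> :: (complex^'n) measure))"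

definition I2 :: "real \<Rightarrow> real \<Rightarrow> real \<Rightarrow> (complex^'n \<Rightarrow> complex) \<Rightarrow> ennreal" where
  "I2 p q \<alpha> f = (\<integral>\<^sup>+ z. ennreal (cmod (f z) powr (p - q) *
       ((1 - (norm z)\<^sup>2) * cmod (radial_deriv f z)) powr q) \<partial>(dv_alpha \<alpha> :: (complex^'n) measure))"

definition I3 :: "real \<Rightarrow> real \<Rightarrow> real \<Rightarrow> (complex^'n \<Rightarrow> complex) \<Rightarrow> ennreal" where
  "I3 p q \<alpha> f = (\<integral>\<^sup>+ z. ennreal (cmod (f z) powr (p - q) *
       ((1 - (norm z)\<^sup>2) * cgrad_norm f z) powr q) \<partial>(dv_alpha \<alpha> :: (complex^'n) measure))"

definition I4 :: "real \<Rightarrow> real \<Rightarrow> real \<Rightarrow> (complex^'n \<Rightarrow> complex) \<Rightarrow> ennreal" where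
  "I4 p q \<alpha> f = (\<integral>\<^sup>+ z. ennreal (cmod (f z) powr (p - q) *
       inv_grad_norm f z powr q) \<partial>(dv_alpha \<alpha> :: (complex^'n) measure))"

end

theory Submission
  imports Defs "HOL-Complex_Analysis.Complex_Analysis"
begin

text \<open>
  At the point \<open>z\<close>, the invariant gradient is the norm of the complex derivative with respect to the
  Bergman metric \<open>|v|\<^sup>2 / d + (|<v,z>| / d)\<^sup>2\<close> with \<open>d = 1 - |z|\<^sup>2\<close>. It therefore dominates \<open>d |\<nabla>f|\<close>, which dominates
  \<open>d |Rf|\<close>, so \<open>I2 \<le> I3 \<le> I4\<close> holds pointwise.

  For \<open>I4 \<le> C I1\<close>, averaging over Bergman balls reduces to a local inequality, and averaging over
  translations reduces that to one variable. There, for \<open>q \<ge> 2\<close>, write \<open>|h|\<close> to the power \<open>p-q\<close> times \<open>|h'|\<close> to the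
  power \<open>q\<close> as \<open>|h|\<close> to the power \<open>s-2\<close> times \<open>|h'|\<^sup>2\<close> (with \<open>s = p-q+2 > 0\<close>) times a bounded power of
  \<open>|h'|\<close>; the former is integrable by a Caccioppoli estimate. The case \<open>q < 2\<close> follows from \<open>q = 2\<close>.

  For \<open>I1 \<le> C (|f 0| powr p + I2)\<close>, integrating along rays gives the case \<open>q = 1\<close>, up to a term near the centre
  that involves \<open>q = p\<close>. Put \<open>x = d |Rf| / |f|\<close>. For \<open>b = 1\<close> and \<open>b = p\<close>, the power \<open>x powr b\<close> is at most
  \<open>\<epsilon> (1 + x powr (p+1)) + C (x powr q)\<close>, and by the upper estimate with \<open>q = p+1\<close> the \<open>\<epsilon>\<close>-term is absorbed into \<open>I1\<close>.
\<close>

section \<open>Linear changes of variables\<close>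

text \<open>The bound q < p + 2 is forced by simple zeros: near one in the plane the integrand
  behaves like |x| powr (p-q), which is integrable exactly when p - q > -2. Because 0 powr a = 0 for
  every a, the integrands of \<open>I2\<close>, \<open>I3\<close>, \<open>I4\<close> vanish where f
  does, even for q = p; a bound of f by its derivative must therefore show that the zeros are
  negligible on complex lines. Near z the ball is parametrised by w -> z +
  \<open>berg_map z w\<close>, where the linear map \<open>berg_map z\<close> is minus the
  derivative of \<open>ball_aut z\<close> at 0; comparability of the Bergman metrics at nearby
  points takes the place of invariance, and no determinant is ever computed. Absorbing a multiple of
  \<open>I1\<close> into itself presupposes that it is finite. For this reason the weighted
  estimates are proved for a whole class of weights, with constants that depend on the weight only
  through \<alpha> and a doubling constant: they can then be applied to weights for which finiteness
  is already known, and a limit taken.\<close>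

lemma nn_integral_lborel_translate:
  fixes F :: "'a::euclidean_space \<Rightarrow> ennreal"
  assumes [measurable]: "F \<in> borel_measurable borel"
  shows "(\<integral>\<^sup>+x. F (c + x) \<partial>lborel) = (\<integral>\<^sup>+x. F x \<partial>lborel)"
  by (subst (2) lborel_distr_plus[of c, symmetric]) (simp add: nn_integral_distr)

lemma nn_integral_lborel_scale:
  fixes F :: "'a::euclidean_space \<Rightarrow> ennreal"
  assumes [measurable]: "F \<in> borel_measurable borel" and c: "c \<noteq> 0"
  shows "(\<integral>\<^sup>+x. F x \<partial>lborel) = ennreal (\<bar>c\<bar> ^ DIM('a)) * (\<integral>\<^sup>+x. F (t + c *\<^sub>R x) \<partial>lborel)"
  by (subst lborel_affine[OF c, of t])
     (simp add: nn_integral_density nn_integral_distr nn_integral_cmult)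

lemma nn_integral_lborel_reflect:
  fixes F :: "'a::euclidean_space \<Rightarrow> ennreal"
  assumes [measurable]: "F \<in> borel_measurable borel"
  shows "(\<integral>\<^sup>+x. F (c - x) \<partial>lborel) = (\<integral>\<^sup>+x. F x \<partial>lborel)"
  using nn_integral_lborel_scale[of F "-1" c] by simp

lemma emeasure_ball_pos: "r > 0 \<Longrightarrow> emeasure lborel (ball (c::'a::euclidean_space) r) > 0"
  by (simp add: emeasure_ball)

lemma emeasure_ball_scale:
  fixes c :: "'a::euclidean_space"
  assumes "r > 0"
  shows "emeasure lborel (ball c r) = ennreal (r ^ DIM('a)) * emeasure lborel (ball (0::'a) 1)"
  using assms by (simp add: emeasure_ball mult.commute flip: ennreal_mult')

text \<open>The double integral of \<open>F (T y) G (x + T y)\<close> is evaluated in both orders; translation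
  invariance alone then identifies the Jacobian.\<close>

lemma nn_integral_linear_change:
  fixes T S :: "'a::euclidean_space \<Rightarrow> 'a"
  assumes F[measurable]: "F \<in> borel_measurable borel"
    and lT: "linear T" and lS: "linear S" and TS: "\<And>x. T (S x) = x"
  shows "(\<integral>\<^sup>+y. F (T y) \<partial>lborel) * emeasure lborel (ball (0::'a) 1) =
         emeasure lborel {y. norm (T y) < 1} * (\<integral>\<^sup>+x. F x \<partial>lborel)"
proof -
  define G :: "'a \<Rightarrow> ennreal" where "G = indicator (ball 0 1)"
  have [measurable]: "G \<in> borel_measurable borel" unfolding G_def by (intro borel_measurable_indicator) simp
  have [measurable]: "T \<in> borel_measurable borel"
    by (intro borel_measurable_continuous_onI linear_continuous_on)
       (use lT linear_linear in blast)
  have [measurable]: "{y. norm (T y) < 1} \<in> sets borel" by measurable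
  have e: "T (- S x + y) = T y - x" for x y
    by (simp add: linear_add[OF lT] linear_neg[OF lT] linear_diff[OF lT] TS)
  have "(\<integral>\<^sup>+y. F (T y) \<partial>lborel) * emeasure lborel (ball (0::'a) 1) =
        (\<integral>\<^sup>+y. F (T y) * (\<integral>\<^sup>+x. G x \<partial>lborel) \<partial>lborel)"
    by (simp add: G_def nn_integral_multc)
  also have "\<dots> = (\<integral>\<^sup>+y. (\<integral>\<^sup>+x. F (T y) * G (T y + x) \<partial>lborel) \<partial>lborel)"
    by (simp add: nn_integral_cmult nn_integral_lborel_translate)
  also have "\<dots> = (\<integral>\<^sup>+x. (\<integral>\<^sup>+y. F (T y) * G (T y + x) \<partial>lborel) \<partial>lborel)"
    by (rule lborel_pair.Fubini') measurable
  \<comment> \<open>Shifting y by - S x turns T y into T y - x, because T (S x) = x. After the next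
    exchange of the integrals, the one over x involves F alone and is evaluated by
    reflection.\<close>
  also have "\<dots> = (\<integral>\<^sup>+x. (\<integral>\<^sup>+y. F (T (- S x + y)) * G (T (- S x + y) + x) \<partial>lborel) \<partial>lborel)"
    by (intro nn_integral_cong nn_integral_lborel_translate[symmetric]) measurable
  also have "\<dots> = (\<integral>\<^sup>+x. (\<integral>\<^sup>+y. F (T y - x) * G (T y) \<partial>lborel) \<partial>lborel)"
    by (simp only: e)  (simp add: algebra_simps)
  also have "\<dots> = (\<integral>\<^sup>+y. (\<integral>\<^sup>+x. F (T y - x) * G (T y) \<partial>lborel) \<partial>lborel)"
    by (rule lborel_pair.Fubini') measurable
  also have "\<dots> = (\<integral>\<^sup>+y. (\<integral>\<^sup>+x. F x \<partial>lborel) * G (T y) \<partial>lborel)"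
    by (simp add: nn_integral_multc nn_integral_lborel_reflect)
  also have "\<dots> = (\<integral>\<^sup>+y. indicator {y. norm (T y) < 1} y \<partial>lborel) * (\<integral>\<^sup>+x. F x \<partial>lborel)"
    by (simp add: nn_integral_cmult G_def indicator_def mult.commute)
  finally show ?thesis by simp
qed

section \<open>Complex Frechet derivatives on C^n\<close>

lemma norm_vec_sq: "(norm (v::complex^'n))\<^sup>2 = (\<Sum>k\<in>UNIV. (cmod (v$k))\<^sup>2)"
  by (simp add: norm_vec_def L2_set_def sum_nonneg)

lemma norm_cscale: "norm (c *s (v::complex^'n)) = cmod c * norm v"
proof -
  have "(norm (c *s v))\<^sup>2 = (cmod c * norm v)\<^sup>2"
    by (simp add: norm_vec_sq norm_mult power_mult_distrib sum_distrib_left)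
  then show ?thesis by (simp add: power2_eq_iff_nonneg)
qed

lemma cscale_of_real: "complex_of_real r *s (v::complex^'n) = r *\<^sub>R v"
  by (simp add: vec_eq_iff scaleR_conv_of_real[where 'a=complex])

lemma bounded_linear_cscale_left: "bounded_linear (\<lambda>c. c *s (v::complex^'n))"
  by (rule bounded_linear_intro[where K="norm v"])
     (auto simp: vec_eq_iff algebra_simps norm_cscale scaleR_conv_of_real[where 'a=complex])

lemma bounded_linear_cscale_right: "bounded_linear (\<lambda>v::complex^'n. c *s v)"
  by (rule bounded_linear_intro[where K="cmod c"])
     (auto simp: vec_eq_iff algebra_simps norm_cscale scaleR_conv_of_real[where 'a=complex])

lemma continuous_on_cscale [continuous_intros]:
  "continuous_on S f \<Longrightarrow> continuous_on S g \<Longrightarrow> continuous_on S (\<lambda>x. f x *s (g x::complex^'n))"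
  unfolding vector_scalar_mult_def by (intro continuous_intros)

lemma borel_measurable_cscale [measurable]:
  assumes "f \<in> borel_measurable M" "g \<in> borel_measurable M"
  shows "(\<lambda>x. f x *s (g x::complex^'n)) \<in> borel_measurable M"
  by (rule borel_measurable_continuous_Pair[OF assms]) (intro continuous_intros)

lemma herm_add_left: "herm (v + w) z = herm v z + herm w z"
  by (simp add: herm_def sum.distrib algebra_simps)
lemma herm_diff_left: "herm (v - w) z = herm v z - herm w z"
  by (simp add: herm_def sum_subtractf algebra_simps)
lemma herm_cscale_left: "herm (c *s v) z = c * herm v z"
  by (simp add: herm_def sum_distrib_left mult.assoc)
lemma herm_scaleR_left: "herm (r *\<^sub>R v) z = of_real r * herm v z"
  by (simp flip: cscale_of_real add: herm_cscale_left)
lemma herm_diff_right: "herm v (z - w) = herm v z - herm v w"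
  by (simp add: herm_def sum_subtractf algebra_simps)
lemma herm_zero_left [simp]: "herm 0 z = 0"
  by (simp add: herm_def)
lemma herm_axis: "herm (axis k w) z = w * cnj (z$k)"
proof -
  have "herm (axis k w) z = (\<Sum>j\<in>UNIV. if j = k then w * cnj (z$k) else 0)"
    unfolding herm_def by (intro sum.cong) (auto simp: axis_def)
  then show ?thesis by simp
qed
lemma herm_self: "herm z z = of_real ((norm z)\<^sup>2)"
  by (simp add: herm_def norm_vec_sq complex_norm_square del: of_real_power)
lemma herm_sym: "herm z w = cnj (herm w z)"
  by (simp add: herm_def mult.commute)

lemma norm_sum_mult_le:
  fixes a :: "'n::finite \<Rightarrow> complex"
  shows "cmod (\<Sum>k\<in>UNIV. a k * b k) \<le> sqrt (\<Sum>k\<in>UNIV. (cmod (a k))\<^sup>2) * sqrt (\<Sum>k\<in>UNIV. (cmod (b k))\<^sup>2)"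
proof -
  have "cmod (\<Sum>k\<in>UNIV. a k * b k) \<le> (\<Sum>k\<in>UNIV. \<bar>cmod (a k)\<bar> * \<bar>cmod (b k)\<bar>)"
    by (rule order_trans[OF norm_sum]) (simp add: norm_mult)
  also have "\<dots> \<le> L2_set (\<lambda>k. cmod (a k)) UNIV * L2_set (\<lambda>k. cmod (b k)) UNIV"
    by (rule L2_set_mult_ineq)
  finally show ?thesis by (simp add: L2_set_def)
qed

lemma herm_bound: "cmod (herm v z) \<le> norm v * norm z"
  using norm_sum_mult_le[of "\<lambda>k. v$k" "\<lambda>k. cnj (z$k)"]
  by (simp add: herm_def norm_vec_def L2_set_def)

lemma norm_sq_diff_cscale:
  "(norm (v - c *s z))\<^sup>2 = (norm v)\<^sup>2 - 2 * Re (cnj c * herm v z) + (cmod c * norm z)\<^sup>2"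
proof -
  have "of_real ((norm (v - c *s z))\<^sup>2) = herm (v - c *s z) (v - c *s z)" by (simp only: herm_self)
  also have "\<dots> = herm v v - c * cnj (herm v z) - cnj c * herm v z + c * cnj c * herm z z"
    by (simp add: herm_def sum_subtractf sum.distrib sum_distrib_left sum_distrib_right algebra_simps)
  finally have "complex_of_real ((norm (v - c *s z))\<^sup>2) = \<dots>" .
  then have "Re (complex_of_real ((norm (v - c *s z))\<^sup>2)) = Re \<dots>" by simp
  then show ?thesis
    by (simp add: herm_self complex_mult_cnj cmod_power2 power_mult_distrib algebra_simps)
qed

lemma axis_cscale: "axis k (c::complex) = c *s axis k 1"
  by (simp add: vec_eq_iff axis_def)

lemma vec_expansion: "(v::complex^'n) = (\<Sum>k\<in>UNIV. v$k *s axis k 1)"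
proof -
  have "(\<Sum>k\<in>UNIV. v$k *s axis k 1) $ j = v $ j" for j
  proof -
    have "(\<Sum>k\<in>UNIV. v$k *s axis k 1) $ j = (\<Sum>k\<in>UNIV. if k = j then v$j else 0)"
      by (simp add: axis_def if_distrib cong: if_cong)
    then show ?thesis by simp
  qed
  then show ?thesis by (simp add: vec_eq_iff)
qed

text \<open>Radial derivative, partial derivatives and invariant gradient are all built from values
  of this one complex-linear form in v.\<close>

definition cdiff :: "(complex^'n \<Rightarrow> complex) \<Rightarrow> complex^'n \<Rightarrow> complex^'n \<Rightarrow> complex" where
  "cdiff f z v = (\<Sum>k\<in>UNIV. v $ k * pderiv_c f k z)"

lemma radial_deriv_cdiff: "radial_deriv f z = cdiff f z z"
  by (simp add: radial_deriv_def cdiff_def)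

lemma cdiff_add: "cdiff f z (v + w) = cdiff f z v + cdiff f z w"
  by (simp add: cdiff_def sum.distrib algebra_simps)
lemma cdiff_cscale: "cdiff f z (c *s v) = c * cdiff f z v"
  by (simp add: cdiff_def sum_distrib_left mult.assoc)
lemma cdiff_sum: "cdiff f z (\<Sum>k\<in>A. g k) = (\<Sum>k\<in>A. cdiff f z (g k))"
  by (induction A rule: infinite_finite_induct) (auto simp: cdiff_add, simp_all add: cdiff_def)
lemma cdiff_axis: "cdiff f z (axis k 1) = pderiv_c f k z"
proof -
  have "cdiff f z (axis k 1) = (\<Sum>j\<in>UNIV. if j = k then pderiv_c f k z else 0)"
    unfolding cdiff_def by (intro sum.cong) (auto simp: axis_def)
  then show ?thesis by simp
qed
lemma cdiff_bound: "cmod (cdiff f z v) \<le> norm v * cgrad_norm f z"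
  using norm_sum_mult_le[of "\<lambda>k. v$k" "\<lambda>k. pderiv_c f k z"]
  by (simp add: cdiff_def cgrad_norm_def norm_vec_def L2_set_def)

text \<open>A complex-linear L is determined by its values on the axis vectors, and restricting f to
  the complex lines in the axis directions identifies these values with the partial
  derivatives.\<close>

lemma holo_has_derivative:
  assumes "holo_on f S" "z \<in> S"
  shows "(f has_derivative cdiff f z) (at z)"
proof -
  obtain L where L: "(f has_derivative L) (at z)" and h: "\<And>c v. L (c *s v) = c * L v"
    using assms unfolding holo_on_def by blast
  have lin: "linear L" using L has_derivative_linear by blast
  have pd: "pderiv_c f k z = L (axis k 1)" for k
  proof -
    let ?e = "axis k (1::complex)"
    have "((\<lambda>w. z + w *s ?e) has_derivative (\<lambda>w. w *s ?e)) (at 0)"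
      by (auto intro!: derivative_eq_intros bounded_linear.has_derivative[OF bounded_linear_cscale_left])
    moreover have "(f has_derivative L) (at (z + (0::complex) *s ?e))"
      using L by simp
    ultimately have "((f \<circ> (\<lambda>w. z + w *s ?e)) has_derivative (L \<circ> (\<lambda>w. w *s ?e))) (at 0)"
      by (rule diff_chain_at)
    then have "((\<lambda>w. f (z + w *s ?e)) has_field_derivative L ?e) (at 0)"
      by (simp add: has_field_derivative_def o_def h mult_commute_abs)
    moreover have "(\<lambda>w. f (z + w *s ?e)) = (\<lambda>w. f (z + axis k w))"
      by (rule ext, subst (2) axis_cscale) simp
    ultimately show ?thesis unfolding pderiv_c_def by (simp add: DERIV_imp_deriv)
  qed
  have "L v = cdiff f z v" for v
  proof -
    have "L v = L (\<Sum>k\<in>UNIV. v$k *s axis k 1)" by (subst vec_expansion[of v]) simp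
    also have "\<dots> = cdiff f z v"
      by (simp add: linear_sum[OF lin] h pd cdiff_def)
    finally show ?thesis .
  qed
  then have "L = cdiff f z" by blast
  then show ?thesis using L by simp
qed

lemma holo_line_deriv:
  assumes "holo_on f S" "a + l *s v \<in> S"
  shows "((\<lambda>l. f (a + l *s v)) has_field_derivative cdiff f (a + l *s v) v) (at l)"
proof -
  have "((\<lambda>l. a + l *s v) has_derivative (\<lambda>l. l *s v)) (at l)"
    by (auto intro!: derivative_eq_intros bounded_linear.has_derivative[OF bounded_linear_cscale_left])
  from diff_chain_at[OF this holo_has_derivative[OF assms]] show ?thesis
    by (simp add: has_field_derivative_def o_def cdiff_cscale mult_commute_abs)
qed

lemma holo_on_continuous_on: "holo_on f S \<Longrightarrow> continuous_on S f"
  by (meson continuous_at_imp_continuous_on has_derivative_continuous holo_has_derivative)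

lemma holo_measurable:
  assumes "holo_on f S" "open S"
  shows "(\<lambda>z. indicator S z *\<^sub>R f z) \<in> borel_measurable borel"
  using assms by (intro borel_measurable_continuous_on_indicator holo_on_continuous_on) auto

text \<open>A pointwise limit of difference quotients with steps 1/(m+1). Cutting f off outside S
  makes the quotients globally measurable; as S is open, the cut-off is invisible in the
  limit.\<close>

lemma cdiff_measurable:
  assumes "holo_on f S" "open S"
  shows "(\<lambda>z. indicator S z *\<^sub>R cdiff f z v) \<in> borel_measurable borel"
proof (rule borel_measurable_LIMSEQ_metric)
  define F where "F z = indicator S z *\<^sub>R f z" for z
  have [measurable]: "F \<in> borel_measurable borel" unfolding F_def by (rule holo_measurable[OF assms])
  have [measurable]: "S \<in> sets borel" using assms by simp
  show "(\<lambda>z. indicator S z *\<^sub>R ((F (z + of_real (1/Suc m) *s v) - F z) / of_real (1/Suc m))) \<in> borel_measurable borel" for m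
    by measurable
  fix z
  show "(\<lambda>m. indicator S z *\<^sub>R ((F (z + of_real (1/Suc m) *s v) - F z) / of_real (1/Suc m))) \<longlonglongrightarrow> indicator S z *\<^sub>R cdiff f z v"
  proof (cases "z \<in> S")
    case True
    let ?t = "\<lambda>m. complex_of_real (1 / Suc m)"
    have t0: "?t \<longlonglongrightarrow> 0"
      using tendsto_of_real[OF LIMSEQ_inverse_real_of_nat, where 'a=complex]
      by (simp add: inverse_eq_divide)
    have "((\<lambda>l. f (z + l *s v)) has_field_derivative cdiff f z v) (at 0)"
      using holo_line_deriv[OF assms(1), of z 0 v] True by simp
    then have "((\<lambda>h. (f (z + h *s v) - f z) / h) \<longlongrightarrow> cdiff f z v) (at 0)"
      by (simp add: has_field_derivative_def DERIV_def flip: has_field_derivative_def)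
    then have L: "(\<lambda>m. (f (z + ?t m *s v) - f z) / ?t m) \<longlonglongrightarrow> cdiff f z v"
      by (rule filterlim_compose) (use t0 in \<open>auto simp: filterlim_at simp del: of_nat_Suc intro!: always_eventually\<close>)
    have "(\<lambda>m. z + ?t m *s v) \<longlonglongrightarrow> z + 0 *s v"
      by (intro tendsto_intros bounded_linear.tendsto[OF bounded_linear_cscale_left] t0)
    then have "\<forall>\<^sub>F m in sequentially. z + ?t m *s v \<in> S"
      using assms(2) True by (simp add: topological_tendstoD)
    then have "\<forall>\<^sub>F m in sequentially. (f (z + ?t m *s v) - f z) / ?t m
         = indicator S z *\<^sub>R ((F (z + ?t m *s v) - F z) / ?t m)"
      by eventually_elim (use True in \<open>simp add: F_def\<close>)
    from Lim_transform_eventually[OF L this] show ?thesis using True by simp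
  qed simp
qed

section \<open>The Bergman metric on the unit ball\<close>

definition defect :: "complex^'n \<Rightarrow> real" where
  "defect z = 1 - (norm z)\<^sup>2"

lemma defect_pos: "z \<in> ball 0 1 \<Longrightarrow> 0 < defect z"
  by (simp add: defect_def abs_square_less_1)
lemma defect_le_1: "defect z \<le> 1"
  by (simp add: defect_def)
lemma in_ball_iff_defect: "z \<in> ball 0 1 \<longleftrightarrow> 0 < defect z"
  by (simp add: defect_def abs_square_less_1)
lemma borel_measurable_defect [measurable]: "defect \<in> borel_measurable borel"
  unfolding defect_def by measurable
lemma borel_measurable_herm [measurable]:
  fixes f g :: "'a \<Rightarrow> complex^'n"
  assumes [measurable]: "f \<in> borel_measurable M" "g \<in> borel_measurable M"
  shows "(\<lambda>x. herm (f x) (g x)) \<in> borel_measurable M"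
proof (rule borel_measurable_continuous_Pair[OF assms])
  show "continuous_on UNIV (\<lambda>x::(complex^'n) \<times> (complex^'n). herm (fst x) (snd x))"
    unfolding herm_def by (intro continuous_intros)
qed

text \<open>Minus the derivative of \<open>ball_aut z\<close> at 0. With s =
  \<open>sqrt (defect z)\<close> it multiplies the direction of z by s^2 and the orthogonal
  complement by s. Dividing by 1 + s rather than by |z|^2 keeps one formula valid at z = 0.\<close>

definition berg_map :: "complex^'n \<Rightarrow> complex^'n \<Rightarrow> complex^'n" where
  "berg_map z w = sqrt (defect z) *\<^sub>R (w - (herm w z / of_real (1 + sqrt (defect z))) *s z)"

text \<open>The factors are now 1/s^2 along z and 1/s across it.\<close>

definition berg_inv :: "complex^'n \<Rightarrow> complex^'n \<Rightarrow> complex^'n" where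
  "berg_inv z v = (1 / sqrt (defect z)) *\<^sub>R
     (v + (herm v z / of_real (sqrt (defect z) * (1 + sqrt (defect z)))) *s z)"

definition berg_sq :: "complex^'n \<Rightarrow> complex^'n \<Rightarrow> real" where
  "berg_sq z v = (norm v)\<^sup>2 / defect z + (cmod (herm v z) / defect z)\<^sup>2"

lemma defect_identity:
  assumes "z \<in> ball 0 1"
  shows "(norm z)\<^sup>2 = (1 - sqrt (defect z)) * (1 + sqrt (defect z))" "(sqrt (defect z))\<^sup>2 = defect z"
    "sqrt (defect z) > 0"
  using defect_pos[OF assms] by (simp_all add: algebra_simps) (simp add: defect_def)

lemma linear_berg_map: "linear (berg_map z)"
  by (rule linearI) (auto simp: berg_map_def vec_eq_iff herm_add_left herm_scaleR_left
    scaleR_conv_of_real[where 'a=complex] algebra_simps add_divide_distrib)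

lemma linear_berg_inv: "linear (berg_inv z)"
  by (rule linearI) (auto simp: berg_inv_def vec_eq_iff herm_add_left herm_scaleR_left
    scaleR_conv_of_real[where 'a=complex] algebra_simps add_divide_distrib)

lemma berg_map_cscale: "berg_map z (c *s w) = c *s berg_map z w"
  by (simp add: berg_map_def vec_eq_iff herm_cscale_left scaleR_conv_of_real[where 'a=complex] algebra_simps)

lemma berg_map_inv:
  assumes "z \<in> ball 0 1"
  shows "berg_map z (berg_inv z v) = v"
proof -
  define s where "s = sqrt (defect z)"
  define a where "a = herm v z"
  have s: "s > 0" "complex_of_real ((norm z)\<^sup>2) = (1 - of_real s) * (1 + of_real s)"
    using defect_identity[OF assms] by (auto simp: s_def)
  have nz: "complex_of_real s \<noteq> 0" "1 + complex_of_real s \<noteq> 0"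
    using s(1) by (auto simp: complex_eq_iff)
  have h: "herm (berg_inv z v) z = a / of_real s * (1 + (1 - of_real s) / of_real s)"
  proof -
    have "1 / S * (a + a / (S * T) * ((1 - S) * T)) = a / S * (1 + (1 - S) / S)" if "S \<noteq> 0" "T \<noteq> 0" for S T :: complex
      using that by (simp add: field_simps)
    from this[OF nz] show ?thesis
      unfolding berg_inv_def herm_scaleR_left herm_add_left herm_cscale_left herm_self s(2) s_def[symmetric] a_def[symmetric]
      by simp
  qed
  have h2: "herm (berg_inv z v) z = a / (of_real s)\<^sup>2"
    unfolding h using nz by (simp add: field_simps power2_eq_square)
  have gen: "S * (1 / S * (x + a / (S * T) * y) - a / S\<^sup>2 / T * y) = x" if "S \<noteq> 0" "T \<noteq> 0" for S T x y :: complex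
    using that by (simp add: field_simps power2_eq_square)
  have "berg_map z (berg_inv z v) $ i = v $ i" for i
    unfolding berg_map_def h2 s_def[symmetric]
    unfolding berg_inv_def s_def[symmetric] a_def[symmetric]
    using gen[OF nz, of "v$i" "z$i"] by (simp add: scaleR_conv_of_real[where 'a=complex])
  then show ?thesis by (simp add: vec_eq_iff)
qed

text \<open>The scalings s^2 along z and s across it carry the Euclidean unit ball onto the unit
  ball of the Bergman metric at z. Integrals over Bergman balls thus become integrals over Euclidean
  balls by a linear substitution.\<close>

lemma berg_sq_map:
  assumes "z \<in> ball 0 1"
  shows "berg_sq z (berg_map z w) = (norm w)\<^sup>2"
proof -
  define s where "s = sqrt (defect z)"
  define a where "a = herm w z"
  note d = defect_identity[OF assms]
  have s: "s > 0" "(norm z)\<^sup>2 = (1 - s) * (1 + s)" "defect z = s\<^sup>2"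
    using d by (auto simp: s_def)
  have nz: "complex_of_real s \<noteq> 0" "1 + complex_of_real s \<noteq> 0"
    using s(1) by (auto simp: complex_eq_iff)
  have "herm (berg_map z w) z = of_real s * (a - a / (1 + of_real s) * ((1 - of_real s) * (1 + of_real s)))"
    unfolding berg_map_def herm_scaleR_left herm_diff_left herm_cscale_left herm_self s(2)
      s_def[symmetric] a_def[symmetric] by simp
  also have "\<dots> = of_real (s\<^sup>2) * a" using nz by (simp add: field_simps power2_eq_square)
  finally have h: "cmod (herm (berg_map z w) z) = s\<^sup>2 * cmod a" by (simp add: norm_mult norm_power)
  have n1: "cmod (of_real (1 + s)) = 1 + s" using s(1) by (simp only: norm_of_real)
  have c: "cnj (a / of_real (1 + s)) * a = of_real ((cmod a)\<^sup>2 / (1 + s))"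
    by (simp add: complex_norm_square mult.commute del: of_real_power)
  have "(norm (w - (a / of_real (1 + s)) *s z))\<^sup>2
      = (norm w)\<^sup>2 - 2 * ((cmod a)\<^sup>2 / (1 + s)) + (cmod a / (1 + s))\<^sup>2 * (norm z)\<^sup>2"
    unfolding norm_sq_diff_cscale a_def[symmetric] c norm_divide n1
    by (simp only: Re_complex_of_real power_mult_distrib)
  also have "\<dots> = (norm w)\<^sup>2 - (cmod a)\<^sup>2"
    unfolding s(2) using s(1) by (simp add: power2_eq_square divide_simps) (simp add: algebra_simps)
  finally have "(norm (berg_map z w))\<^sup>2 = s\<^sup>2 * ((norm w)\<^sup>2 - (cmod a)\<^sup>2)"
    using s(1) by (simp add: berg_map_def power_mult_distrib flip: s_def a_def)
  then show ?thesis
    unfolding berg_sq_def h s(3) using s(1) by (simp add: power_divide field_simps)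
qed

lemma norm_berg_inv:
  assumes "z \<in> ball 0 1"
  shows "(norm (berg_inv z v))\<^sup>2 = berg_sq z v"
  using berg_sq_map[OF assms, of "berg_inv z v"] berg_map_inv[OF assms] by simp

lemma berg_sq_minus: "berg_sq z (- v) = berg_sq z v"
proof -
  have "herm (-v) z = - herm v z" by (simp add: herm_def sum_negf)
  then show ?thesis by (simp add: berg_sq_def)
qed

text \<open>With d = \<open>defect z\<close>, Cauchy-Schwarz bounds the second term of the metric by
  |v|^2 (1 - d) / d^2; adding |v|^2 / d gives |v|^2 / d^2.\<close>

lemma norm_berg_inv_le:
  assumes "z \<in> ball 0 1"
  shows "norm (berg_inv z v) \<le> norm v / defect z"
proof -
  note p = defect_pos[OF assms]
  have "(cmod (herm v z))\<^sup>2 \<le> (norm v * norm z)\<^sup>2"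
    by (intro power_mono herm_bound) auto
  also have "\<dots> = (norm v)\<^sup>2 * (1 - defect z)" by (simp add: defect_def power_mult_distrib)
  finally have "(norm (berg_inv z v))\<^sup>2 \<le> (norm v)\<^sup>2 / defect z + (norm v)\<^sup>2 * (1 - defect z) / (defect z)\<^sup>2"
    using p by (simp add: norm_berg_inv[OF assms] berg_sq_def power_divide divide_right_mono)
  also have "\<dots> = (norm v / defect z)\<^sup>2"
    using p by (simp add: field_simps power2_eq_square)
  finally show ?thesis by (rule power2_le_imp_le) (use p in simp)
qed

text \<open>The substitute for invariance: within Bergman radius 1/4 of z both the defect and the
  metric change by bounded factors. The metric factor is the square 16 = 4^2, so that a ball of
  radius r/4 for one of the metrics lies in the ball of radius r for the other.\<close>

lemma berg_close:
  assumes z: "z \<in> ball 0 1" and r: "berg_sq z (u - z) \<le> 1/16"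
  shows "u \<in> ball 0 1" "defect u \<le> 3 * defect z" "defect z \<le> 3 * defect u"
    "berg_sq u v \<le> 16 * berg_sq z v" "berg_sq z v \<le> 16 * berg_sq u v"
proof -
  define d where "d = defect z"
  define e where "e = norm (u - z)"
  define b where "b = cmod (herm (u - z) z)"
  note d = defect_pos[OF z, folded d_def]
  have d1: "d \<le> 1" by (simp add: d_def defect_le_1)
  have r': "e\<^sup>2 / d + (b / d)\<^sup>2 \<le> 1/16" using r by (simp add: berg_sq_def d_def e_def b_def)
  have "e\<^sup>2 / d \<le> 1/16" using r' zero_le_power2[of "b/d"] by linarith
  then have e: "e\<^sup>2 \<le> d / 16" using d by (simp add: field_simps)
  have "0 \<le> e\<^sup>2 / d" using d by simp
  then have "(b / d)\<^sup>2 \<le> 1/16" using r' by linarith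
  also have "1/16 = (1/4::real)\<^sup>2" by (simp add: power2_eq_square)
  finally have "(b / d)\<^sup>2 \<le> (1/4)\<^sup>2" .
  then have "b / d \<le> 1/4" by (rule power2_le_imp_le) simp
  then have b: "b \<le> d / 4" using d by (simp add: field_simps)
  have "(norm (z - (-1) *s (u - z)))\<^sup>2 = (norm z)\<^sup>2 + 2 * Re (herm z (u - z)) + e\<^sup>2"
    unfolding norm_sq_diff_cscale by (simp add: e_def)
  moreover have "z - (-1) *s (u - z) = u" by (simp add: vec_eq_iff)
  moreover have "Re (herm z (u - z)) = Re (herm (u - z) z)" by (subst herm_sym) simp
  \<comment> \<open>Expanding |u|^2 around z shows that the defect changes by at most d/2 + d/16.
    The component of u - z along z has size at most d/4 after pairing with z, whereas u - z itself
    is only known to be of size sqrt d / 4.\<close>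
  ultimately have du: "defect u = d - 2 * Re (herm (u - z) z) - e\<^sup>2"
    by (simp add: defect_def d_def)
  have "\<bar>Re (herm (u - z) z)\<bar> \<le> b" unfolding b_def by (rule abs_Re_le_cmod)
  then have re: "Re (herm (u - z) z) \<le> b" "- Re (herm (u - z) z) \<le> b" by auto
  then have D: "defect u \<ge> 7/16 * d" "defect u \<le> 25/16 * d"
    using du b e zero_le_power2[of e] d re by linarith+
  show "u \<in> ball 0 1" unfolding in_ball_iff_defect using D d by linarith
  show "defect u \<le> 3 * defect z" "defect z \<le> 3 * defect u" using D d by (auto simp: d_def[symmetric])
  have dup: "defect u > 0" using D d by linarith
  define n where "n = (norm v)\<^sup>2"
  define x where "x = cmod (herm v z)"
  define y where "y = cmod (herm v u)"
  have n0: "n \<ge> 0" "x \<ge> 0" "y \<ge> 0" by (auto simp: n_def x_def y_def)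
  have xy: "cmod (herm v u - herm v z) \<le> norm v * e"
    unfolding herm_diff_right[symmetric] e_def by (rule herm_bound)
  have ve: "(norm v * e)\<^sup>2 \<le> n * d / 16"
    using mult_left_mono[OF e n0(1)] by (simp add: n_def power_mult_distrib)
  \<comment> \<open>Both comparisons of \<open>herm v u\<close> with \<open>herm v z\<close> use
    that their difference is \<open>herm v (u - z)\<close>, whose square is at most |v|^2 d /
    16.\<close>
  have sq2: "p\<^sup>2 \<le> 2 * q\<^sup>2 + n * d / 8" if "p \<le> q + norm v * e" "p \<ge> 0" for p q :: real
  proof -
    have "p\<^sup>2 \<le> (q + norm v * e)\<^sup>2" using that by (intro power_mono) auto
    also have "\<dots> \<le> 2 * q\<^sup>2 + 2 * (norm v * e)\<^sup>2"
      using zero_le_power2[of "q - norm v * e"] by (simp add: power2_sum power2_diff)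
    finally show ?thesis using ve by simp
  qed
  have y2: "y\<^sup>2 \<le> 2 * x\<^sup>2 + n * d / 8"
    using xy norm_triangle_ineq2[of "herm v u" "herm v z"] n0 by (intro sq2) (auto simp: x_def y_def)
  have x2: "x\<^sup>2 \<le> 2 * y\<^sup>2 + n * d / 8"
    using xy norm_triangle_ineq3[of "herm v u" "herm v z"] n0 by (intro sq2) (auto simp: x_def y_def)
  have bz: "berg_sq z v = n / d + x\<^sup>2 / d\<^sup>2" by (simp add: berg_sq_def n_def x_def d_def power_divide)
  have bu: "berg_sq u v = n / defect u + y\<^sup>2 / (defect u)\<^sup>2" by (simp add: berg_sq_def n_def y_def power_divide)
  have "n / defect u \<le> n / (7/16 * d)" using D d dup n0 by (intro divide_left_mono) auto
  moreover have "y\<^sup>2 / (defect u)\<^sup>2 \<le> (2 * x\<^sup>2 + n * d / 8) / (7/16 * d)\<^sup>2"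
    using D d n0 y2 by (intro frac_le power_mono) auto
  moreover have "n / (7/16 * d) + (2 * x\<^sup>2 + n * d / 8) / (7/16 * d)\<^sup>2
      = (16/7 + 32/49) * (n / d) + 512/49 * (x\<^sup>2 / d\<^sup>2)"
    using d by (simp add: field_simps power2_eq_square)
  moreover have "(16/7 + 32/49) * (n / d) + 512/49 * (x\<^sup>2 / d\<^sup>2) \<le> 16 * (n / d + x\<^sup>2 / d\<^sup>2)"
    unfolding distrib_left using n0 d by (intro add_mono mult_right_mono) auto
  ultimately show "berg_sq u v \<le> 16 * berg_sq z v" unfolding bz bu by linarith
  have inv: "1 / d \<le> 25/16 / defect u" using D d dup by (simp add: field_simps)
  have A: "n / d \<le> 25/16 * (n / defect u)"
    using mult_left_mono[OF inv n0(1)] by simp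
  have "x\<^sup>2 / d\<^sup>2 \<le> (2 * y\<^sup>2 + n * d / 8) / d\<^sup>2" using x2 by (intro divide_right_mono) auto
  also have "\<dots> = 2 * y\<^sup>2 * (1/d)\<^sup>2 + (n / d) / 8" using d by (simp add: field_simps power2_eq_square)
  also have "\<dots> \<le> 2 * y\<^sup>2 * (25/16 / defect u)\<^sup>2 + (n / d) / 8"
    using inv d by (intro add_mono mult_left_mono power_mono) auto
  finally have B: "x\<^sup>2 / d\<^sup>2 \<le> 625/128 * (y\<^sup>2 / (defect u)\<^sup>2) + (n / d) / 8"
    by (simp add: power_divide power2_eq_square)
  have lin: "a + x' \<le> 16 * (b' + y')"
    if "a \<le> 25/16 * b'" "x' \<le> 625/128 * y' + a / 8" "0 \<le> b'" "0 \<le> y'" for a b' x' y' :: real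
    using that by (simp add: field_simps)
  show "berg_sq z v \<le> 16 * berg_sq u v" unfolding bz bu
    by (rule lin[OF A B]) (use n0 dup in auto)
qed

section \<open>The involutive automorphism and the invariant gradient\<close>

lemma ball_aut_eq:
  assumes "z \<in> ball 0 1"
  shows "ball_aut z x = (1 / (1 - herm x z)) *s
     (z - of_real (sqrt (defect z)) *s x - (herm x z / of_real (1 + sqrt (defect z))) *s z)"
proof -
  define s where "s = sqrt (defect z)"
  have s: "s > 0" "complex_of_real ((norm z)\<^sup>2) = (1 - of_real s) * (1 + of_real s)"
    using defect_identity[OF assms] by (auto simp: s_def)
  have s': "sqrt (1 - (norm z)\<^sup>2) = s" by (simp add: s_def defect_def)
  have nz: "1 + complex_of_real s \<noteq> 0"
    using s(1) by (auto simp: complex_eq_iff)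
  \<comment> \<open>Rudin's formula divides by |z|^2 = (1 - s)(1 + s), and the projection enters
    with the factor 1 - s, so 1/(1 + s) remains. At z = 0 both sides vanish.\<close>
  have "(1 - of_real s) * (herm x z / herm z z) * z$i = herm x z / of_real (1 + s) * z$i" for i
  proof (cases "z = 0")
    case False
    then have "herm z z \<noteq> 0" by (simp add: herm_self)
    moreover have "(1 - of_real s) * of_real (1 + s) = herm z z" unfolding herm_self s(2) by simp
    ultimately have e: "1 - of_real s = herm z z / of_real (1 + s)" and "herm z z \<noteq> 0"
      using nz by (simp_all add: nonzero_eq_divide_eq)
    then show ?thesis unfolding e by simp
  qed simp
  then have eq: "herm x z / of_real (1 + s) * z$i = (1 - of_real s) * (herm x z / herm z z) * z$i" for i
    by simp
  have "(z - (herm x z / herm z z) *s z - of_real s *s (x - (herm x z / herm z z) *s z)) =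
    (z - of_real s *s x - (herm x z / of_real (1 + s)) *s z)"
    unfolding vec_eq_iff vector_minus_component vector_smult_component eq
    by (simp add: algebra_simps add_divide_distrib diff_divide_distrib)
  then show ?thesis unfolding ball_aut_def Let_def s' s_def[symmetric] by (rule arg_cong)
qed

text \<open>Chain rule at 0: \<open>ball_aut z\<close> sends 0 to z with derivative
  -\<open>berg_map z\<close>, and the sign disappears in the norm.\<close>

lemma inv_grad_norm_eq:
  assumes f: "holo_on f (ball 0 1)" and z: "z \<in> ball 0 1"
  shows "inv_grad_norm f z = sqrt (\<Sum>k\<in>UNIV. (cmod (cdiff f z (berg_map z (axis k 1))))\<^sup>2)"
proof -
  define s where "s = sqrt (defect z)"
  have s: "s > 0" using defect_identity[OF z] by (auto simp: s_def)
  have nz: "1 + complex_of_real s \<noteq> 0"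
    using s(1) by (auto simp: complex_eq_iff)
  have "pderiv_c (f \<circ> ball_aut z) k 0 = - cdiff f z (berg_map z (axis k 1))" for k
  proof -
    define c where "c = cnj (z $ k)"
    define e where "e = (axis k 1 :: complex^'a)"
    define g where "g w = (1 / (1 - w * c)) *s (z - (of_real s * w) *s e - (w * c / of_real (1 + s)) *s z)" for w
    have g: "ball_aut z (0 + axis k w) = g w" for w
      unfolding ball_aut_eq[OF z] g_def herm_axis c_def[symmetric] s_def[symmetric] add_0 e_def
      by (auto simp: vec_eq_iff axis_def)
    have g0: "g 0 = z" by (simp add: g_def)
    have "((\<lambda>w. (1 / (1 - w * c)) *s z - (of_real s * w / (1 - w * c)) *s e - (w * c / of_real (1 + s) / (1 - w * c)) *s z)
       has_derivative (\<lambda>w. (w * c) *s z - (w * of_real s) *s e - (w * c / of_real (1 + s)) *s z)) (at 0)"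
      by (intro has_derivative_diff bounded_linear.has_derivative[OF bounded_linear_cscale_left])
         (use nz in \<open>auto intro!: derivative_eq_intros simp: fun_eq_iff\<close>)
    moreover have "(1 / (1 - w * c)) *s z - (of_real s * w / (1 - w * c)) *s e - (w * c / of_real (1 + s) / (1 - w * c)) *s z = g w" for w
      by (simp add: g_def vec_eq_iff algebra_simps diff_divide_distrib)
    ultimately have gd: "(g has_derivative (\<lambda>w. (w * c) *s z - (w * of_real s) *s e - (w * c / of_real (1 + s)) *s z)) (at 0)"
      by simp
    have be: "berg_map z e = of_real s *s e - (of_real s * c / of_real (1 + s)) *s z"
      unfolding berg_map_def s_def[symmetric] e_def herm_axis c_def[symmetric]
      by (simp add: vec_eq_iff scaleR_conv_of_real[where 'a=complex] algebra_simps)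
    have "(w * c) *s z - (w * of_real s) *s e - (w * c / of_real (1 + s)) *s z = (- w) *s berg_map z e" for w
      unfolding be using nz by (simp add: vec_eq_iff field_simps)
    then have gd: "(g has_derivative (\<lambda>w. (- w) *s berg_map z e)) (at 0)" using gd by simp
    have "((f \<circ> g) has_derivative (cdiff f z \<circ> (\<lambda>w. (- w) *s berg_map z e))) (at 0)"
      using gd holo_has_derivative[OF f z] by (intro diff_chain_at) (simp_all add: g0)
    moreover have "(\<lambda>w. (- w) * cdiff f z (berg_map z e)) = (*) (- cdiff f z (berg_map z e))"
      by (simp add: fun_eq_iff)
    ultimately have "((\<lambda>w. (f \<circ> ball_aut z) (0 + axis k w)) has_field_derivative (- cdiff f z (berg_map z e))) (at 0)"
      unfolding has_field_derivative_def o_def g cdiff_cscale by metis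
    then show ?thesis unfolding pderiv_c_def e_def by (rule DERIV_imp_deriv)
  qed
  then show ?thesis by (simp add: inv_grad_norm_def cgrad_norm_def)
qed

lemma cdiff_berg_map_bound:
  assumes "holo_on f (ball 0 1)" "z \<in> ball 0 1"
  shows "cmod (cdiff f z (berg_map z w)) \<le> norm w * inv_grad_norm f z"
proof -
  have "berg_map z w = (\<Sum>k\<in>UNIV. w$k *s berg_map z (axis k 1))"
    by (subst vec_expansion[of w]) (simp add: linear_sum[OF linear_berg_map] berg_map_cscale)
  then have "cdiff f z (berg_map z w) = (\<Sum>k\<in>UNIV. w$k * cdiff f z (berg_map z (axis k 1)))"
    by (simp add: cdiff_sum cdiff_cscale)
  then show ?thesis
    using norm_sum_mult_le[of "\<lambda>k. w$k" "\<lambda>k. cdiff f z (berg_map z (axis k 1))"]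
    by (simp add: inv_grad_norm_eq[OF assms] norm_vec_def L2_set_def)
qed

lemma cgrad_norm_nonneg: "0 \<le> cgrad_norm f z"
  by (simp add: cgrad_norm_def sum_nonneg)

lemma inv_grad_norm_nonneg: "0 \<le> inv_grad_norm f z"
  by (simp add: inv_grad_norm_def cgrad_norm_nonneg)

text \<open>Duality: at the conjugate gradient v the differential takes the value |v|^2, and v is
  the image under \<open>berg_map z\<close> of a vector of norm at most |v| /
  \<open>defect z\<close>.\<close>

lemma defect_cgrad_le_inv_grad:
  assumes "holo_on f (ball 0 1)" "z \<in> ball 0 1"
  shows "defect z * cgrad_norm f z \<le> inv_grad_norm f z"
proof (cases "cgrad_norm f z = 0")
  case False
  define v :: "complex^'a" where "v = (\<chi> k. cnj (pderiv_c f k z))"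
  have nv: "norm v = cgrad_norm f z" by (simp add: v_def norm_vec_def L2_set_def cgrad_norm_def)
  have "cdiff f z v = of_real ((norm v)\<^sup>2)"
    by (simp add: cdiff_def v_def norm_vec_sq complex_norm_square mult.commute del: of_real_power)
  then have "(norm v)\<^sup>2 = cmod (cdiff f z (berg_map z (berg_inv z v)))"
    by (simp add: berg_map_inv[OF assms(2)] norm_power)
  also have "\<dots> \<le> norm (berg_inv z v) * inv_grad_norm f z"
    by (rule cdiff_berg_map_bound[OF assms])
  also have "\<dots> \<le> norm v / defect z * inv_grad_norm f z"
    by (intro mult_right_mono norm_berg_inv_le assms inv_grad_norm_nonneg)
  finally have *: "norm v * norm v \<le> norm v * (inv_grad_norm f z / defect z)" by (simp add: power2_eq_square)
  have "0 < norm v" using False nv cgrad_norm_nonneg[of f z] by linarith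
  with * have "norm v \<le> inv_grad_norm f z / defect z" by (rule mult_left_le_imp_le)
  then show ?thesis using defect_pos[OF assms(2)] nv by (simp add: field_simps)
qed (simp add: inv_grad_norm_nonneg)

lemma radial_le_cgrad:
  assumes "z \<in> ball 0 1"
  shows "cmod (radial_deriv f z) \<le> cgrad_norm f z"
proof -
  have "cmod (radial_deriv f z) \<le> norm z * cgrad_norm f z"
    unfolding radial_deriv_cdiff by (rule cdiff_bound)
  also have "\<dots> \<le> 1 * cgrad_norm f z"
    using assms by (intro mult_right_mono cgrad_norm_nonneg) auto
  finally show ?thesis by simp
qed

section \<open>One complex variable\<close>

lemma borel_measurable_ennreal_indicator:
  fixes f :: "'a::topological_space \<Rightarrow> real"
  assumes "continuous_on A f" "A \<in> sets borel"
  shows "(\<lambda>x. ennreal (f x) * indicator A x) \<in> borel_measurable borel"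
proof -
  have [measurable]: "(\<lambda>x. indicator A x *\<^sub>R f x) \<in> borel_measurable borel"
    using assms by (intro borel_measurable_continuous_on_indicator)
  have "(\<lambda>x. ennreal (f x) * indicator A x) = (\<lambda>x. ennreal (indicator A x *\<^sub>R f x))"
    by (auto simp: indicator_def)
  also have "\<dots> \<in> borel_measurable borel" by measurable
  finally show ?thesis .
qed

lemma emeasure_complex_ball: "r \<ge> 0 \<Longrightarrow> emeasure lborel (ball (c::complex) r) = ennreal (pi * r\<^sup>2)"
  by (simp add: emeasure_ball unit_ball_vol_2)

text \<open>At a point maximising \<open>(r - |x - c|) powr (2/p) * |h x|\<close>, with distance \<open>d\<close> to the circle, the
  function stays above half its value on a disc of radius proportional to \<open>d\<close>. This covers
  all \<open>p > 0\<close> without subharmonicity.\<close>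

lemma cmod_powr_le_ball_integral:
  fixes p :: real
  assumes p: "p > 0"
  obtains C where "C > 0"
    "\<And>h S c r. \<lbrakk>h holomorphic_on S; open S; cball c r \<subseteq> S; r > 0\<rbrakk> \<Longrightarrow>
       ennreal (cmod (h c) powr p * r\<^sup>2) \<le> ennreal C * (\<integral>\<^sup>+x\<in>ball c r. ennreal (cmod (h x) powr p) \<partial>lborel)"
proof -
  \<comment> \<open>On the disc of radius d/2 around the maximising point the distance to the circle
    is at least d/2, so |h| exceeds |h m| there by at most the factor 2 powr (2/p).\<close>
  define K :: real where "K = 2 powr (2/p)"
  \<comment> \<open>Cauchy's estimate on discs of radius d/4 gives |h'| <= 4 K |h m| / d, so moving
    by \<eta> d changes h by at most |h m| / 2.\<close>
  define \<eta> :: real where "\<eta> = 1 / (8 * K)"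
  define C where "C = 2 powr p / (pi * \<eta>\<^sup>2)"
  have K: "K \<ge> 1" unfolding K_def using p by (intro ge_one_powr_ge_zero) auto
  have \<eta>: "\<eta> > 0" "\<eta> \<le> 1/8" using K by (auto simp: \<eta>_def field_simps)
  have "C > 0" using \<eta> by (simp add: C_def)
  moreover have "ennreal (cmod (h c) powr p * r\<^sup>2) \<le> ennreal C * (\<integral>\<^sup>+x\<in>ball c r. ennreal (cmod (h x) powr p) \<partial>lborel)"
    if h: "h holomorphic_on S" "open S" and sub: "cball c r \<subseteq> S" and r: "r > 0" for h S c r
  proof (cases "h c = 0")
    case False
    define \<phi> where "\<phi> x = (r - cmod (x - c)) powr (2/p) * cmod (h x)" for x
    have hc: "continuous_on (cball c r) h"
      using h sub continuous_on_subset holomorphic_on_imp_continuous_on by blast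
    have "continuous_on (cball c r) \<phi>"
      unfolding \<phi>_def using p
      by (intro continuous_intros continuous_on_powr' hc) (auto simp: dist_norm norm_minus_commute)
    then obtain m where m: "m \<in> cball c r" and max: "\<And>x. x \<in> cball c r \<Longrightarrow> \<phi> x \<le> \<phi> m"
      using continuous_attains_sup[of "cball c r" \<phi>] r by auto
    define d where "d = r - cmod (m - c)"
    have "\<phi> c > 0" using False r by (simp add: \<phi>_def)
    then have "\<phi> m > 0" using max[of c] r by simp
    then have hm: "cmod (h m) > 0" and "d \<noteq> 0"
      by (auto simp: \<phi>_def d_def zero_less_mult_iff)
    then have d: "d > 0" using m by (auto simp: d_def dist_norm norm_minus_commute)
    have in_cball: "cmod (x - c) \<le> r - d/2" if "cmod (x - m) \<le> d/2" for x
    proof -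
      have "cmod (x - c) \<le> cmod (x - m) + cmod (m - c)"
        using norm_triangle_ineq[of "x - m" "m - c"] by simp
      then show ?thesis using that d_def by linarith
    qed
    have hK: "cmod (h x) \<le> K * cmod (h m)" if "cmod (x - m) \<le> d/2" for x
    proof -
      have x: "cmod (x - c) \<le> r - d/2" by (rule in_cball[OF that])
      then have "x \<in> cball c r" using d by (auto simp: dist_norm norm_minus_commute)
      then have "\<phi> x \<le> \<phi> m" by (rule max)
      moreover have "(d/2) powr (2/p) * cmod (h x) \<le> \<phi> x"
        unfolding \<phi>_def using x d p by (intro mult_right_mono powr_mono2) auto
      ultimately have "(d/2) powr (2/p) * cmod (h x) \<le> d powr (2/p) * cmod (h m)"
        by (simp add: \<phi>_def d_def)
      then show ?thesis using d by (simp add: powr_divide K_def field_simps)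
    qed
    have inS: "cball m (d/2) \<subseteq> S"
      using in_cball d sub by (force simp: dist_norm norm_minus_commute)
    have dh: "cmod (deriv h x) \<le> K * cmod (h m) / (d/4)" if "cmod (x - m) \<le> d/4" for x
    proof -
      have cb: "cmod (y - m) \<le> d/2" if "y \<in> cball x (d/4)" for y
        using norm_triangle_ineq[of "y - x" "x - m"] that \<open>cmod (x - m) \<le> d/4\<close>
        by (simp add: dist_norm norm_minus_commute)
      have sub2: "cball x (d/4) \<subseteq> S" using cb inS by (force simp: dist_norm norm_minus_commute)
      have "norm ((deriv ^^ 1) h x) \<le> fact 1 * (K * cmod (h m)) / (d/4)^1"
      proof (rule Cauchy_inequality)
        show "h holomorphic_on ball x (d/4)"
          using h sub2 by (meson ball_subset_cball holomorphic_on_subset order_trans)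
        show "continuous_on (cball x (d/4)) h"
          using h sub2 continuous_on_subset holomorphic_on_imp_continuous_on by blast
        show "cmod (h y) \<le> K * cmod (h m)" if "cmod (x - y) = d/4" for y
          by (rule hK, rule cb) (use that in \<open>simp add: dist_norm\<close>)
      qed (use d in simp)
      then show ?thesis by simp
    qed
    have low: "cmod (h m) / 2 \<le> cmod (h x)" if "x \<in> ball m (\<eta> * d)" for x
    proof -
      have xm: "cmod (x - m) < \<eta> * d" using that by (simp add: dist_norm norm_minus_commute)
      also have "\<eta> * d \<le> d/4" using \<eta> d by simp
      finally have x: "x \<in> cball m (d/4)" by (simp add: dist_norm norm_minus_commute)
      have "cmod (h x - h m) \<le> K * cmod (h m) / (d/4) * cmod (x - m)"
      proof (rule field_differentiable_bound[of "cball m (d/4)" h "deriv h"])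
        show "(h has_field_derivative deriv h z) (at z within cball m (d/4))" if "z \<in> cball m (d/4)" for z
        proof -
          have "z \<in> S" using that inS d by (force simp: dist_norm)
          then show ?thesis using h holomorphic_derivI by blast
        qed
        show "cmod (deriv h z) \<le> K * cmod (h m) / (d/4)" if "z \<in> cball m (d/4)" for z
          by (rule dh) (use that in \<open>simp add: dist_norm norm_minus_commute\<close>)
      qed (use x d in auto)
      also have "\<dots> \<le> K * cmod (h m) / (d/4) * (\<eta> * d)"
        using xm K d by (intro mult_left_mono) auto
      also have "\<dots> = cmod (h m) / 2" using K d by (simp add: \<eta>_def)
      finally show ?thesis using norm_triangle_ineq2[of "h m" "h x"] by (simp add: norm_minus_commute)
    qed
    have "\<eta> * d \<le> d/2" using \<eta> d by simp
    then have bsub: "ball m (\<eta> * d) \<subseteq> ball c r"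
    proof (intro subsetI)
      fix x assume "x \<in> ball m (\<eta> * d)"
      then have "cmod (x - m) \<le> d/2" using \<open>\<eta> * d \<le> d/2\<close> by (simp add: dist_norm norm_minus_commute)
      from in_cball[OF this] d show "x \<in> ball c r" by (simp add: dist_norm norm_minus_commute)
    qed
    \<comment> \<open>The exponent 2/p is chosen for this: the p-th power of the comparison between
      c and m carries r^2 and d^2, which scale like the areas of the discs involved.\<close>
    have "(r powr (2/p) * cmod (h c)) powr p \<le> (d powr (2/p) * cmod (h m)) powr p"
      using max[of c] r p by (intro powr_mono2) (auto simp: \<phi>_def d_def)
    then have "r\<^sup>2 * cmod (h c) powr p \<le> d\<^sup>2 * cmod (h m) powr p"
      using r d p by (simp add: powr_mult powr_powr)
    also have "\<dots> = C * ((cmod (h m) / 2) powr p * (pi * (\<eta> * d)\<^sup>2))"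
      using \<eta> by (simp add: C_def powr_divide power_mult_distrib)
    finally have "ennreal (cmod (h c) powr p * r\<^sup>2) \<le> ennreal C * (ennreal ((cmod (h m) / 2) powr p) * ennreal (pi * (\<eta> * d)\<^sup>2))"
      using \<open>C > 0\<close> by (simp add: mult.commute ennreal_leI flip: ennreal_mult)
    also have "ennreal ((cmod (h m) / 2) powr p) * ennreal (pi * (\<eta> * d)\<^sup>2)
        = (\<integral>\<^sup>+x. ennreal ((cmod (h m) / 2) powr p) * indicator (ball m (\<eta> * d)) x \<partial>lborel)"
      using \<eta> d by (simp add: nn_integral_cmult_indicator emeasure_complex_ball)
    also have "\<dots> \<le> (\<integral>\<^sup>+x\<in>ball c r. ennreal (cmod (h x) powr p) \<partial>lborel)"
      using low bsub p by (intro nn_integral_mono) (auto simp: indicator_def intro!: ennreal_leI powr_mono2)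
    finally show ?thesis by (simp add: mult_left_mono)
  qed simp
  ultimately show ?thesis using that by blast
qed

section \<open>Integrals of compactly supported derivatives and the Caccioppoli estimate\<close>

lemma integral_lborel_translate:
  fixes G :: "'a::euclidean_space \<Rightarrow> 'b::{banach, second_countable_topology}"
  assumes "integrable lborel G"
  shows "integrable lborel (\<lambda>x. G (c + x))" "(LINT x|lborel. G (c + x)) = (LINT x|lborel. G x)"
proof -
  have i: "integrable (distr lborel borel ((+) c)) G" using assms by (simp add: lborel_distr_plus)
  have G: "G \<in> borel_measurable borel" using assms by auto
  show "integrable lborel (\<lambda>x. G (c + x))" using i by (subst (asm) integrable_distr_eq) (use G in auto)
  have "(LINT x|lborel. G x) = (LINT x|distr lborel borel ((+) c). G x)" by (simp add: lborel_distr_plus)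
  also have "\<dots> = (LINT x|lborel. G (c + x))" by (subst integral_distr) (use G in auto)
  finally show "(LINT x|lborel. G (c + x)) = (LINT x|lborel. G x)" by simp
qed

text \<open>Difference quotients of G have integral 0 by translation invariance. They are uniformly
  bounded and live in one compact ball, so dominated convergence passes this on to the
  derivative.\<close>

lemma integral_directional_derivative_eq_0:
  fixes G :: "'a::euclidean_space \<Rightarrow> 'b::euclidean_space"
  assumes der: "\<And>x. (G has_derivative G' x) (at x)"
    and cont: "continuous_on UNIV (\<lambda>x. G' x v)"
    and supp: "\<And>x. norm x > 1 \<Longrightarrow> G x = 0"
  shows "integrable lborel (\<lambda>x. G' x v)" "(LINT x|lborel. G' x v) = 0"
proof -
  have z: "G' x v = 0" if "norm x > 1" for x
  proof -
    have o: "open {x::'a. norm x > 1}" by (intro open_Collect_less continuous_intros)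
    have "((\<lambda>_. 0::'b) has_derivative (\<lambda>_. 0)) (at x)" by simp
    from this o have "(G has_derivative (\<lambda>_. 0)) (at x)"
      by (rule has_derivative_transform_within_open) (use that supp in auto)
    then have "G' x = (\<lambda>_. 0)" by (rule has_derivative_unique[OF der])
    then show ?thesis by simp
  qed
  have cG: "continuous_on UNIV G"
    by (intro continuous_at_imp_continuous_on ballI has_derivative_continuous[OF der])
  have "integrable lborel (\<lambda>x. indicator (cball 0 1) x *\<^sub>R G x)"
    by (intro borel_integrable_compact continuous_on_subset[OF cG]) auto
  moreover have "(\<lambda>x. indicator (cball 0 1) x *\<^sub>R G x) = G"
    using supp by (force simp: indicator_def)
  ultimately have iG: "integrable lborel G" by simp
  have "compact ((\<lambda>x. G' x v) ` cball 0 1)"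
    by (intro compact_continuous_image continuous_on_subset[OF cont]) auto
  then have "bounded ((\<lambda>x. G' x v) ` cball 0 1)" by (rule compact_imp_bounded)
  then obtain M where "\<forall>x\<in>cball 0 1. norm (G' x v) \<le> M"
    unfolding bounded_iff by auto
  then have M0: "\<And>x. x \<in> cball 0 1 \<Longrightarrow> norm (G' x v) \<le> M" by blast
  then have M: "norm (G' x v) \<le> max M 0" for x
    using z[of x] M0[of x] by (cases "norm x > 1") (simp_all add: le_max_iff_disj)
  define t :: "nat \<Rightarrow> real" where "t k = inverse (Suc k)" for k
  have t: "t k > 0" "t k \<le> 1" for k by (auto simp: t_def field_simps)
  have tn: "t k \<noteq> 0" for k using t(1)[of k] by simp
  have t0: "t \<longlonglongrightarrow> 0" unfolding t_def by (rule LIMSEQ_inverse_real_of_nat)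
  define D where "D k x = (1 / t k) *\<^sub>R (G (t k *\<^sub>R v + x) - G x)" for k x
  have lim: "(\<lambda>k. D k x) \<longlonglongrightarrow> G' x v" for x
  proof -
    have "((\<lambda>s. s *\<^sub>R v + x) has_derivative (\<lambda>s. s *\<^sub>R v)) (at 0)"
      by (auto intro!: derivative_eq_intros)
    moreover have "(G has_derivative G' x) (at (0 *\<^sub>R v + x))" using der by simp
    ultimately have "((G \<circ> (\<lambda>s. s *\<^sub>R v + x)) has_derivative (G' x \<circ> (\<lambda>s. s *\<^sub>R v))) (at 0)"
      by (rule diff_chain_at)
    moreover have "(G' x \<circ> (\<lambda>s. s *\<^sub>R v)) = (\<lambda>s. s *\<^sub>R G' x v)"
      using linear_scale[OF has_derivative_linear[OF der[of x]]] by (simp add: fun_eq_iff)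
    ultimately have "((\<lambda>s. G (s *\<^sub>R v + x)) has_derivative (\<lambda>s. s *\<^sub>R G' x v)) (at 0)"
      by (simp add: o_def)
    then have f1: "(\<lambda>h. norm (G (h *\<^sub>R v + x) - G x - h *\<^sub>R G' x v) / norm h) \<midarrow>0\<rightarrow> 0"
      by (simp add: has_derivative_at)
    have eq: "norm (G (h *\<^sub>R v + x) - G x - h *\<^sub>R G' x v) / norm h
        = norm ((G (h *\<^sub>R v + x) - G x) /\<^sub>R h - G' x v)" if "h \<noteq> 0" for h
    proof -
      have "(G (h *\<^sub>R v + x) - G x) /\<^sub>R h - G' x v = (G (h *\<^sub>R v + x) - G x - h *\<^sub>R G' x v) /\<^sub>R h"
        using that by (simp add: scaleR_diff_right)
      then show ?thesis by (simp add: divide_inverse mult.commute)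
    qed
    have f2: "(\<lambda>h. norm ((G (h *\<^sub>R v + x) - G x) /\<^sub>R h - G' x v)) \<midarrow>0\<rightarrow> 0"
      by (intro iffD1[OF LIM_equal f1] allI impI eq)
    have "((\<lambda>s. (G (s *\<^sub>R v + x) - G x) /\<^sub>R s) \<longlongrightarrow> G' x v) (at 0)"
      by (rule LIM_zero_cancel[OF tendsto_norm_zero_cancel[OF f2]])
    then have "(\<lambda>k. (G (t k *\<^sub>R v + x) - G x) /\<^sub>R t k) \<longlonglongrightarrow> G' x v"
      by (rule filterlim_compose) (use t0 tn in \<open>simp add: filterlim_at\<close>)
    then show ?thesis by (simp add: D_def divide_inverse)
  qed
  \<comment> \<open>All steps are at most 1, so the quotients vanish outside the ball of radius 1 +
    norm v; inside it the mean value inequality bounds them by the bound on the derivative.\<close>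
  have bound: "norm (D k x) \<le> max M 0 * indicator (cball 0 (1 + norm v)) x" for k x
  proof (cases "norm x \<le> 1 + norm v")
    case True
    have "norm (G (1 *\<^sub>R (t k *\<^sub>R v) + x) - G (0 *\<^sub>R (t k *\<^sub>R v) + x)) \<le> (max M 0 * t k) * norm (1 - 0 :: real)"
    proof (rule differentiable_bound[of "UNIV::real set" "\<lambda>s. G (s *\<^sub>R (t k *\<^sub>R v) + x)" "\<lambda>s. \<lambda>r. r *\<^sub>R (t k *\<^sub>R G' (s *\<^sub>R (t k *\<^sub>R v) + x) v)"])
      fix s :: real
      let ?y = "s *\<^sub>R (t k *\<^sub>R v) + x"
      have "((\<lambda>s. s *\<^sub>R (t k *\<^sub>R v) + x) has_derivative (\<lambda>r. r *\<^sub>R (t k *\<^sub>R v))) (at s)"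
        by (auto intro!: derivative_eq_intros)
      from diff_chain_at[OF this der[of ?y]]
      have d: "((\<lambda>s. G (s *\<^sub>R (t k *\<^sub>R v) + x)) has_derivative (\<lambda>r. G' ?y (r *\<^sub>R (t k *\<^sub>R v)))) (at s)"
        by (simp add: o_def)
      have e: "(\<lambda>r. G' ?y (r *\<^sub>R (t k *\<^sub>R v))) = (\<lambda>r. r *\<^sub>R (t k *\<^sub>R G' ?y v))"
        by (rule ext) (simp only: linear_scale[OF has_derivative_linear[OF der[of ?y]]])
      show "((\<lambda>s. G (s *\<^sub>R (t k *\<^sub>R v) + x)) has_derivative (\<lambda>r. r *\<^sub>R (t k *\<^sub>R G' ?y v))) (at s within UNIV)"
        using d unfolding e .
      show "onorm (\<lambda>r. r *\<^sub>R (t k *\<^sub>R G' ?y v)) \<le> max M 0 * t k"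
      proof (rule onorm_bound)
        fix r :: real
        have "t k * norm (G' ?y v) \<le> max M 0 * t k" using mult_right_mono[OF M[of ?y], of "t k"] t(1)[of k]
          by (simp only: mult.commute less_imp_le)
        then have "\<bar>r\<bar> * (t k * norm (G' ?y v)) \<le> \<bar>r\<bar> * (max M 0 * t k)" by (rule mult_left_mono) simp
        then show "norm (r *\<^sub>R (t k *\<^sub>R G' ?y v)) \<le> max M 0 * t k * norm r"
          using t(1)[of k] by (simp add: mult_ac abs_mult)
      qed (use t(1)[of k] in simp)
    qed auto
    then have "norm (G (t k *\<^sub>R v + x) - G x) \<le> max M 0 * t k" by simp
    moreover have "norm (D k x) = norm (G (t k *\<^sub>R v + x) - G x) / t k"
      unfolding D_def norm_scaleR using t(1)[of k] by (simp add: abs_of_pos)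
    ultimately have "norm (D k x) \<le> max M 0" using t(1)[of k] by (simp only: pos_divide_le_eq)
    then show ?thesis using True by simp
  next
    case False
    have "norm (t k *\<^sub>R v) \<le> norm v" using t[of k] by (simp add: mult_left_le_one_le)
    then have "norm (t k *\<^sub>R v + x) > 1" using False norm_diff_ineq[of x "t k *\<^sub>R v"] by (simp add: add.commute)
    moreover have "norm x > 1" using False norm_ge_zero[of v] by linarith
    ultimately show ?thesis using supp by (simp add: D_def False)
  qed
  have intD: "integrable lborel (D k)" "(LINT x|lborel. D k x) = 0" for k
    unfolding D_def using integral_lborel_translate[OF iG, of "t k *\<^sub>R v"] iG by auto
  have w: "integrable lborel (\<lambda>x::'a. max M 0 * indicator (cball 0 (1 + norm v)) x)"
    by (intro integrable_mult_right integrable_real_indicator)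
       (auto intro!: emeasure_bounded_finite[unfolded infinity_ennreal_def])
  have meas: "(\<lambda>x. G' x v) \<in> borel_measurable lborel"
    using cont by (simp add: borel_measurable_continuous_onI)
  have mD: "D k \<in> borel_measurable lborel" for k using intD(1) by auto
  have L: "AE x in lborel. (\<lambda>k. D k x) \<longlonglongrightarrow> G' x v" using lim by (intro AE_I2)
  have B: "AE x in lborel. norm (D k x) \<le> max M 0 * indicator (cball 0 (1 + norm v)) x" for k
    using bound by (intro AE_I2)
  show "integrable lborel (\<lambda>x. G' x v)"
    by (rule integrable_dominated_convergence[OF meas mD w L B])
  have "(\<lambda>k. LINT x|lborel. D k x) \<longlonglongrightarrow> (LINT x|lborel. G' x v)"
    by (rule integral_dominated_convergence[OF meas mD w L B])
  then show "(LINT x|lborel. G' x v) = 0" unfolding intD(2) by (simp add: LIMSEQ_const_iff)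
qed

text \<open>Squaring makes the positive part differentiable at 0; this is why the cutoff enters the
  Caccioppoli test function as a square.\<close>

lemma has_real_derivative_max0_sq:
  "((\<lambda>t::real. (max 0 t)\<^sup>2) has_real_derivative 2 * max 0 t) (at t)"
proof -
  consider "t > 0" | "t < 0" | "t = 0" by linarith
  then show ?thesis
  proof cases
    case 1
    have "((\<lambda>t::real. t\<^sup>2) has_real_derivative 2 * max 0 t) (at t)"
      using 1 by (auto intro!: derivative_eq_intros)
    then show ?thesis
      by (rule has_field_derivative_transform_within_open[where S="{0<..}"]) (use 1 in auto)
  next
    case 2
    have "((\<lambda>t::real. 0) has_real_derivative 2 * max 0 t) (at t)"
      using 2 by auto
    then show ?thesis
      by (rule has_field_derivative_transform_within_open[where S="{..<0}"]) (use 2 in auto)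
  next
    case 3
    have "(\<lambda>h::real. (max 0 h)\<^sup>2 / h) \<midarrow>0\<rightarrow> 0"
    proof (rule Lim_null_comparison)
      show "\<forall>\<^sub>F h in at 0. norm ((max 0 h)\<^sup>2 / h) \<le> norm (h::real)"
        by (intro always_eventually allI) (auto simp: max_def power2_eq_square)
      show "((\<lambda>h::real. norm h) \<longlongrightarrow> 0) (at 0)" by (rule tendsto_norm_zero) (rule tendsto_ident_at)
    qed
    then show ?thesis using 3 by (simp add: DERIV_def)
  qed
qed

text \<open>The directional derivative along 1 plus \<i> times the one along \<i> is twice the
  antiholomorphic derivative. This identity evaluates that combination when the derivative is given
  by a real inner product.\<close>

lemma inner_mult_complex_basis:
  fixes w u :: complex
  shows "of_real (w \<bullet> (u * 1)) + \<i> * of_real (w \<bullet> (u * \<i>)) = w * cnj u"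
  by (simp add: complex_eq_iff inner_complex_def algebra_simps)

text \<open>A Caccioppoli estimate: \<open>\<psi>\<^sup>2 (|h|\<^sup>2 + e) powr (s/2 - 1) * cnj h * h'\<close>, with \<open>\<psi> = max 0 (1 - |x|\<^sup>2)\<close>,
  has compact support, so the integral of its antiholomorphic derivative vanishes.\<close>

lemma caccioppoli_regularized:
  fixes h :: "complex \<Rightarrow> complex"
  assumes h: "h holomorphic_on ball 0 R" and R: "R > 1" and s: "s > 0" and e: "e > 0"
  defines "\<kappa> \<equiv> min 1 (s/2)"
  shows "(\<integral>\<^sup>+x\<in>ball 0 (1/2). ennreal ((cmod (deriv h x))\<^sup>2 * ((cmod (h x))\<^sup>2 + e) powr (s/2 - 1)) \<partial>lborel)
    \<le> ennreal (8 / \<kappa>\<^sup>2) * (\<integral>\<^sup>+x\<in>cball 0 1. ennreal (((cmod (h x))\<^sup>2 + e) powr (s/2)) \<partial>lborel)"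
proof -
  define E where "E x = (cmod (h x))\<^sup>2 + e" for x
  define a where "a = s/2 - 1"
  define \<psi> :: "complex \<Rightarrow> real" where "\<psi> x = max 0 (1 - (norm x)\<^sup>2)" for x
  define T where "T x = (cmod (deriv h x))\<^sup>2 * E x powr a" for x
  have \<kappa>: "\<kappa> > 0" "\<kappa> \<le> 1" "\<kappa> \<le> s/2" using s by (auto simp: \<kappa>_def)
  have E: "E x > 0" for x using e by (simp add: E_def add_nonneg_pos)
  define P where "P x = (\<psi> x)\<^sup>2 * E x powr a" for x
  define P' where "P' x v = (-4 * \<psi> x * (x \<bullet> v)) * E x powr a
      + (\<psi> x)\<^sup>2 * (2 * (h x \<bullet> (deriv h x * v)) * (a * E x powr (a - 1)))" for x v
  define G where "G x = of_real (P x) * (cnj (h x) * deriv h x)" for x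
  \<comment> \<open>Nothing is known about h outside the disc of radius R, but G vanishes for |x| >=
    1, so its derivative is taken to be 0 there; the two descriptions agree for 1 < |x| < R.\<close>
  define G' where "G' x v = (if norm x < R then of_real (P' x v) * (cnj (h x) * deriv h x)
     + of_real (P x) * (cnj (deriv h x * v) * deriv h x + cnj (h x) * (deriv (deriv h) x * v)) else 0)" for x v
  have h': "deriv h holomorphic_on ball 0 R" and h'': "deriv (deriv h) holomorphic_on ball 0 R"
    using h by (auto intro!: holomorphic_deriv)
  have \<psi>0: "\<psi> x = 0" if "norm x \<ge> 1" for x using that by (simp add: \<psi>_def)
  have sq: "((\<lambda>x. (\<psi> x)\<^sup>2) has_derivative (\<lambda>v. -4 * \<psi> x * (x \<bullet> v))) (at x)" for x
  proof -
    have "((\<lambda>x::complex. 1 - (norm x)\<^sup>2) has_derivative (\<lambda>v. - 2 * (x \<bullet> v))) (at x)"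
      unfolding power2_norm_eq_inner
      by (auto intro!: derivative_eq_intros simp: inner_commute fun_eq_iff)
    from DERIV_compose_FDERIV[OF has_real_derivative_max0_sq this] show ?thesis
      unfolding \<psi>_def by (rule has_derivative_eq_rhs) (simp add: fun_eq_iff)
  qed
  have dG: "(G has_derivative G' x) (at x)" for x
  proof (cases "norm x < R")
    case True
    then have xb: "x \<in> ball 0 R" by simp
    have dh: "(h has_derivative (\<lambda>v. deriv h x * v)) (at x)"
      and dh': "(deriv h has_derivative (\<lambda>v. deriv (deriv h) x * v)) (at x)"
      using holomorphic_derivI[OF h _ xb] holomorphic_derivI[OF h' _ xb] by (simp_all add: has_field_derivative_def)
    have "(E has_derivative (\<lambda>v. 2 * (h x \<bullet> (deriv h x * v)))) (at x)"
      unfolding E_def[abs_def] power2_norm_eq_inner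
      by (rule derivative_eq_intros dh refl | simp add: inner_commute fun_eq_iff)+
    from DERIV_compose_FDERIV[OF has_real_derivative_powr[OF E] this]
    have "((\<lambda>x. E x powr a) has_derivative (\<lambda>v. 2 * (h x \<bullet> (deriv h x * v)) * (a * E x powr (a - 1)))) (at x)" .
    from has_derivative_mult[OF sq this]
    have "(P has_derivative P' x) (at x)" unfolding P_def[abs_def]
      by (rule has_derivative_eq_rhs) (simp add: fun_eq_iff P'_def algebra_simps)
    then have dP: "((\<lambda>x. complex_of_real (P x)) has_derivative (\<lambda>v. of_real (P' x v))) (at x)"
      by (rule has_derivative_of_real)
    have "((\<lambda>x. cnj (h x)) has_derivative (\<lambda>v. cnj (deriv h x * v))) (at x)"
      by (rule bounded_linear.has_derivative[OF bounded_linear_cnj dh])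
    from has_derivative_mult[OF dP has_derivative_mult[OF this dh']]
    have "(G has_derivative (\<lambda>v. of_real (P x) * (cnj (h x) * (deriv (deriv h) x * v) + cnj (deriv h x * v) * deriv h x)
       + of_real (P' x v) * (cnj (h x) * deriv h x))) (at x)"
      by (simp add: G_def[abs_def])
    then show ?thesis by (rule has_derivative_eq_rhs) (use True in \<open>simp add: fun_eq_iff G'_def algebra_simps\<close>)
  next
    case False
    have o: "open {x::complex. norm x > 1}" by (intro open_Collect_less continuous_intros)
    have "((\<lambda>_. 0::complex) has_derivative (\<lambda>_. 0)) (at x)" by simp
    from this o have "(G has_derivative (\<lambda>_. 0)) (at x)"
      by (rule has_derivative_transform_within_open) (use False R \<psi>0 in \<open>auto simp: G_def P_def\<close>)
    then show ?thesis using False by (simp add: G'_def[abs_def])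
  qed
  have cts: "continuous_on (ball 0 R) h" "continuous_on (ball 0 R) (deriv h)" "continuous_on (ball 0 R) (deriv (deriv h))"
    using h h' h'' holomorphic_on_imp_continuous_on by auto
  have cE: "continuous_on (ball 0 R) (\<lambda>x. E x powr b)" for b
    unfolding E_def using e by (intro continuous_intros cts) (auto simp: add_nonneg_eq_0_iff)
  have c\<psi>: "continuous_on S \<psi>" for S unfolding \<psi>_def by (intro continuous_intros)
  have cG: "continuous_on UNIV (\<lambda>x. G' x v)" for v
  proof -
    have cP: "continuous_on (ball 0 R) P"
      unfolding P_def[abs_def] by (intro continuous_on_mult continuous_on_power cE c\<psi>)
    have cP': "continuous_on (ball 0 R) (\<lambda>x. P' x v)"
      unfolding P'_def by (intro continuous_on_add continuous_on_mult continuous_on_power continuous_on_inner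
          continuous_on_const continuous_on_id cts cE c\<psi>)
    have c1: "continuous_on (ball 0 R) (\<lambda>x. G' x v)"
    proof (rule continuous_on_eq)
      show "continuous_on (ball 0 R) (\<lambda>x. of_real (P' x v) * (cnj (h x) * deriv h x)
     + of_real (P x) * (cnj (deriv h x * v) * deriv h x + cnj (h x) * (deriv (deriv h) x * v)))"
        by (intro continuous_on_add continuous_on_mult continuous_on_of_real continuous_on_cnj
            continuous_on_const cts cP cP')
    qed (simp add: G'_def)
    have G'0: "G' x v = 0" if "norm x > 1" for x
    proof -
      have "\<psi> x = 0" using that by (intro \<psi>0) simp
      then show ?thesis by (simp add: G'_def P'_def P_def)
    qed
    have c2: "continuous_on {x. norm x > 1} (\<lambda>x. G' x v)"
      by (rule continuous_on_eq[OF continuous_on_const[of _ 0]]) (simp add: G'0)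
    have o: "open {x::complex. norm x > 1}" by (intro open_Collect_less continuous_intros)
    have "continuous_on (ball 0 R \<union> {x. norm x > 1}) (\<lambda>x. G' x v)"
      by (rule continuous_on_open_Un[OF open_ball o c1 c2])
    moreover have "x \<in> ball 0 R \<union> {x::complex. norm x > 1}" for x
      using R by (cases "norm x > 1") simp_all
    then have "ball 0 R \<union> {x::complex. norm x > 1} = UNIV" by blast
    ultimately show ?thesis by simp
  qed
  have G0: "G x = 0" if "norm x > 1" for x using that by (simp add: G_def P_def \<psi>0)
  have I1: "integrable lborel (\<lambda>x. G' x v)" "(LINT x|lborel. G' x v) = 0" for v
    by (rule integral_directional_derivative_eq_0[OF dG cG], erule G0)+
  \<comment> \<open>The real part of twice the antiholomorphic derivative of G. The holomorphic
    factor h' is annihilated, so derivatives fall only on the cutoff, on the power and on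
    \<open>cnj h\<close>, and h'' drops out.\<close>
  define N where "N x = Re (G' x 1 + \<i> * G' x \<i>)" for x
  have iN: "integrable lborel N" and N0: "(LINT x|lborel. N x) = 0"
  proof -
    have i: "integrable lborel (\<lambda>x. G' x 1 + \<i> * G' x \<i>)"
      by (intro Bochner_Integration.integrable_add integrable_mult_right I1(1))
    then show "integrable lborel N" unfolding N_def[abs_def] by (rule integrable_bounded_linear[OF bounded_linear_Re])
    have "(LINT x|lborel. N x) = Re (LINT x|lborel. (G' x 1 + \<i> * G' x \<i>))"
      unfolding N_def[abs_def] by (rule integral_bounded_linear[OF bounded_linear_Re i])
    also have "(LINT x|lborel. (G' x 1 + \<i> * G' x \<i>)) = 0"
    proof -
      have "(LINT x|lborel. (G' x 1 + \<i> * G' x \<i>)) = (LINT x|lborel. G' x 1) + (LINT x|lborel. \<i> * G' x \<i>)"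
        by (intro Bochner_Integration.integral_add integrable_mult_right I1(1))
      also have "(LINT x|lborel. \<i> * G' x \<i>) = \<i> * (LINT x|lborel. G' x \<i>)"
        by (rule integral_mult_right_zero)
      finally show ?thesis unfolding I1(2) by simp
    qed
    finally show "(LINT x|lborel. N x) = 0" by simp
  qed
  have Nge: "\<kappa> * (\<psi> x)\<^sup>2 * T x - (4/\<kappa>) * E x powr (s/2) \<le> N x" if x: "norm x \<le> 1" for x
  proof -
    define k where "k = deriv h x"
    have xR: "norm x < R" using x R by simp
    have "G' x 1 + \<i> * G' x \<i> =
       (of_real (P' x 1) + \<i> * of_real (P' x \<i>)) * (cnj (h x) * k) + of_real (P x) * (2 * cnj k * k)"
      using xR by (simp add: G'_def k_def algebra_simps)
    also have "of_real (P' x 1) + \<i> * of_real (P' x \<i>) =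
       of_real (- 4 * \<psi> x * E x powr a) * (of_real (x \<bullet> (1 * 1)) + \<i> * of_real (x \<bullet> (1 * \<i>)))
       + of_real (2 * (\<psi> x)\<^sup>2 * a * E x powr (a - 1)) * (of_real (h x \<bullet> (k * 1)) + \<i> * of_real (h x \<bullet> (k * \<i>)))"
      by (simp add: P'_def k_def algebra_simps)
    also have "\<dots> = of_real (- 4 * \<psi> x * E x powr a) * x + of_real (2 * (\<psi> x)\<^sup>2 * a * E x powr (a - 1)) * (h x * cnj k)"
      unfolding inner_mult_complex_basis by simp
    finally have eq: "G' x 1 + \<i> * G' x \<i> = of_real (- 4 * \<psi> x * E x powr a) * (x * cnj (h x) * k)
        + of_real (2 * (\<psi> x)\<^sup>2 * a * E x powr (a - 1)) * ((h x * cnj (h x)) * (k * cnj k)) + of_real (2 * P x) * (k * cnj k)"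
      by (simp add: algebra_simps)
    have re: "Re (of_real r * z) = r * Re z" for r z by simp
    have Nx: "N x = - 4 * \<psi> x * E x powr a * Re (x * cnj (h x) * k)
        + 2 * (\<psi> x)\<^sup>2 * a * E x powr (a - 1) * ((cmod (h x))\<^sup>2 * (cmod k)\<^sup>2) + 2 * P x * (cmod k)\<^sup>2"
      unfolding N_def eq complex_norm_square[symmetric] of_real_mult[symmetric] plus_complex.sel Re_complex_of_real re ..
    have Ea: "E x powr a = E x powr (a - 1) * E x" using E[of x] by (simp add: powr_diff)
    \<comment> \<open>Coercivity. As |h|^2 <= E, the left side is at least the smaller of 1 and 1 +
      a = s/2 times E, which is how \<kappa> is chosen; its positivity is the hypothesis s >
      0.\<close>
    have "a * (cmod (h x))\<^sup>2 + E x \<ge> \<kappa> * E x"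
    proof (cases "a \<ge> 0")
      case True
      have "\<kappa> * E x \<le> 1 * E x" using \<kappa> E[of x] by (intro mult_right_mono) auto
      then show ?thesis using True by (simp add: add_increasing)
    next
      case False
      have "(cmod (h x))\<^sup>2 \<le> E x" using e by (simp add: E_def)
      then have "a * (cmod (h x))\<^sup>2 \<ge> a * E x" using False by (intro mult_left_mono_neg) auto
      moreover have "(1 + a) * E x \<ge> \<kappa> * E x" using \<kappa> E[of x] by (intro mult_right_mono) (auto simp: a_def)
      ultimately show ?thesis by (simp add: algebra_simps)
    qed
    then have "2 * (\<psi> x)\<^sup>2 * (cmod k)\<^sup>2 * E x powr (a - 1) * (\<kappa> * E x) \<le> 2 * (\<psi> x)\<^sup>2 * (cmod k)\<^sup>2 * E x powr (a - 1) * (a * (cmod (h x))\<^sup>2 + E x)"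
      by (intro mult_left_mono) auto
    then have main: "2 * \<kappa> * (\<psi> x)\<^sup>2 * T x \<le> 2 * (\<psi> x)\<^sup>2 * a * E x powr (a - 1) * ((cmod (h x))\<^sup>2 * (cmod k)\<^sup>2) + 2 * P x * (cmod k)\<^sup>2"
      by (simp add: T_def P_def Ea k_def[symmetric] algebra_simps)
    define u where "u = \<psi> x * cmod k"
    define r where "r = sqrt (E x)"
    have r2: "r\<^sup>2 = E x" using E[of x] by (simp add: r_def)
    have "Re (x * cnj (h x) * k) \<le> cmod x * cmod (h x) * cmod k"
      using complex_Re_le_cmod[of "x * cnj (h x) * k"] by (simp add: norm_mult)
    also have "\<dots> \<le> 1 * r * cmod k"
    proof (intro mult_right_mono mult_mono)
      show "cmod (h x) \<le> r" unfolding r_def by (rule real_le_rsqrt) (use e in \<open>simp add: E_def\<close>)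
    qed (use x E[of x] in \<open>auto simp: r_def\<close>)
    finally have "4 * \<psi> x * E x powr a * Re (x * cnj (h x) * k) \<le> 4 * \<psi> x * E x powr a * (r * cmod k)"
      by (intro mult_left_mono) (auto simp: \<psi>_def)
    also have "\<dots> = E x powr a * (4 * u * r)" by (simp add: u_def algebra_simps)
    \<comment> \<open>Young's inequality weighted by \<kappa>: the first summand uses up half of the
      main term 2 \<kappa> \<psi>^2 T, the second becomes the right-hand side of the
      estimate.\<close>
    also have "\<dots> \<le> E x powr a * (\<kappa> * u\<^sup>2 + (4/\<kappa>) * r\<^sup>2)"
    proof (intro mult_left_mono)
      have "0 \<le> \<kappa> * (u - 2 * r / \<kappa>)\<^sup>2" using \<kappa> by simp
      also have "\<dots> = \<kappa> * u\<^sup>2 + (4/\<kappa>) * r\<^sup>2 - 4 * u * r"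
        using \<kappa> by (simp add: power2_eq_square field_simps)
      finally show "4 * u * r \<le> \<kappa> * u\<^sup>2 + (4/\<kappa>) * r\<^sup>2" by simp
    qed auto
    also have "\<dots> = \<kappa> * (\<psi> x)\<^sup>2 * T x + (4/\<kappa>) * (E x powr a * E x)"
      by (simp add: T_def u_def r2 k_def[symmetric] algebra_simps)
    also have "E x powr a * E x = E x powr (s/2)"
      using E[of x] by (simp add: a_def powr_diff)
    finally show ?thesis using main Nx by linarith
  qed
  have Nz: "N x = 0" if "norm x > 1" for x
    using that by (simp add: N_def G'_def P'_def P_def \<psi>0)
  have sub: "cball 0 1 \<subseteq> ball (0::complex) R" using R by auto
  have i1: "integrable lborel (\<lambda>x. indicator (cball 0 1) x *\<^sub>R (\<kappa> * (\<psi> x)\<^sup>2 * T x))"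
    unfolding T_def
    by (intro borel_integrable_compact continuous_intros c\<psi> continuous_on_subset[OF cE sub] continuous_on_subset[OF cts(2) sub]) auto
  have i2: "integrable lborel (\<lambda>x. indicator (cball 0 1) x *\<^sub>R ((4/\<kappa>) * E x powr (s/2)))"
    by (intro borel_integrable_compact continuous_intros continuous_on_subset[OF cE sub]) auto
  have "(LINT x|lborel. indicator (cball 0 1) x *\<^sub>R (\<kappa> * (\<psi> x)\<^sup>2 * T x) - indicator (cball 0 1) x *\<^sub>R ((4/\<kappa>) * E x powr (s/2)))
      \<le> (LINT x|lborel. N x)"
  proof (rule integral_mono[OF Bochner_Integration.integrable_diff[OF i1 i2] iN])
    fix x show "indicator (cball 0 1) x *\<^sub>R (\<kappa> * (\<psi> x)\<^sup>2 * T x) - indicator (cball 0 1) x *\<^sub>R ((4/\<kappa>) * E x powr (s/2)) \<le> N x"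
      using Nge[of x] Nz[of x] by (cases "norm x \<le> 1") auto
  qed
  then have le: "(LINT x|lborel. indicator (cball 0 1) x *\<^sub>R (\<kappa> * (\<psi> x)\<^sup>2 * T x)) \<le> (LINT x|lborel. indicator (cball 0 1) x *\<^sub>R ((4/\<kappa>) * E x powr (s/2)))"
    unfolding N0 using Bochner_Integration.integral_diff[OF i1 i2] by simp
  have T0: "T x \<ge> 0" for x by (simp add: T_def)
  \<comment> \<open>On the half disc \<psi> >= 3/4, so 2 \<psi>^2 >= 1. The factor 2/\<kappa>
    removes cutoff and \<kappa>; together with 4/\<kappa> it produces 8/\<kappa>^2.\<close>
  have "(\<integral>\<^sup>+x\<in>ball 0 (1/2). ennreal (T x) \<partial>lborel)
      \<le> (\<integral>\<^sup>+x. ennreal (2/\<kappa>) * ennreal (indicator (cball 0 1) x *\<^sub>R (\<kappa> * (\<psi> x)\<^sup>2 * T x)) \<partial>lborel)"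
  proof (intro nn_integral_mono)
    fix x :: complex
    show "ennreal (T x) * indicator (ball 0 (1/2)) x \<le> ennreal (2/\<kappa>) * ennreal (indicator (cball 0 1) x *\<^sub>R (\<kappa> * (\<psi> x)\<^sup>2 * T x))"
    proof (cases "x \<in> ball 0 (1/2)")
      case True
      then have "(norm x)\<^sup>2 \<le> (1/2)\<^sup>2" by (intro power_mono) auto
      then have "3/4 \<le> \<psi> x" by (simp add: \<psi>_def power2_eq_square)
      then have "(3/4)\<^sup>2 \<le> (\<psi> x)\<^sup>2" by (intro power_mono) auto
      then have "1 \<le> 2 * (\<psi> x)\<^sup>2" by (simp add: power2_eq_square)
      then have "1 * T x \<le> 2 * (\<psi> x)\<^sup>2 * T x" using T0[of x] by (intro mult_right_mono) auto
      also have "\<dots> = (2/\<kappa>) * (\<kappa> * (\<psi> x)\<^sup>2 * T x)" using \<kappa> by simp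
      finally show ?thesis using True \<kappa> T0[of x] by (simp flip: ennreal_mult)
    qed simp
  qed
  also have "\<dots> = ennreal (2/\<kappa>) * (\<integral>\<^sup>+x. ennreal (indicator (cball 0 1) x *\<^sub>R (\<kappa> * (\<psi> x)\<^sup>2 * T x)) \<partial>lborel)"
    using i1 by (intro nn_integral_cmult) auto
  also have "(\<integral>\<^sup>+x. ennreal (indicator (cball 0 1) x *\<^sub>R (\<kappa> * (\<psi> x)\<^sup>2 * T x)) \<partial>lborel)
      = ennreal (LINT x|lborel. indicator (cball 0 1) x *\<^sub>R (\<kappa> * (\<psi> x)\<^sup>2 * T x))"
    using \<kappa> T0 by (intro nn_integral_eq_integral i1) auto
  also have "\<dots> \<le> ennreal (LINT x|lborel. indicator (cball 0 1) x *\<^sub>R ((4/\<kappa>) * E x powr (s/2)))"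
    by (rule ennreal_leI[OF le])
  also have "\<dots> = (\<integral>\<^sup>+x. ennreal (indicator (cball 0 1) x *\<^sub>R ((4/\<kappa>) * E x powr (s/2))) \<partial>lborel)"
    using \<kappa> by (intro nn_integral_eq_integral[symmetric] i2) auto
  also have "\<dots> = (\<integral>\<^sup>+x. ennreal (4/\<kappa>) * (ennreal (E x powr (s/2)) * indicator (cball 0 1) x) \<partial>lborel)"
    using \<kappa> by (intro nn_integral_cong) (auto simp: indicator_def simp flip: ennreal_mult)
  also have "\<dots> = ennreal (4/\<kappa>) * (\<integral>\<^sup>+x\<in>cball 0 1. ennreal (E x powr (s/2)) \<partial>lborel)"
    using borel_measurable_ennreal_indicator[OF continuous_on_subset[OF cE sub]]
    by (intro nn_integral_cmult) simp
  finally have "(\<integral>\<^sup>+x\<in>ball 0 (1/2). ennreal (T x) \<partial>lborel) \<le> ennreal (2/\<kappa>) * (ennreal (4/\<kappa>) * (\<integral>\<^sup>+x\<in>cball 0 1. ennreal (E x powr (s/2)) \<partial>lborel))"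
    by (simp add: mult_left_mono)
  also have "\<dots> = ennreal (8/\<kappa>\<^sup>2) * (\<integral>\<^sup>+x\<in>cball 0 1. ennreal (E x powr (s/2)) \<partial>lborel)"
    using \<kappa> by (simp add: power2_eq_square flip: mult.assoc ennreal_mult)
  finally show ?thesis by (simp add: T_def E_def a_def)
qed

lemma square_powr:
  fixes x :: real
  assumes "0 \<le> x"
  shows "(x\<^sup>2) powr b = x powr (2 * b)"
proof -
  have "(x\<^sup>2) powr b = (x powr 2) powr b" using assms by simp
  then show ?thesis by (simp only: powr_powr)
qed

text \<open>Fatou's lemma removes the regularisation e, which was there because |h| powr (s-2) is
  singular at zeros of h when s < 2. At these zeros the left integrand is 0 by the convention 0 powr
  a = 0.\<close>

lemma caccioppoli_powr:
  fixes s :: real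
  assumes s: "s > 0"
  obtains C where "C > 0"
    "\<And>h R M. \<lbrakk>h holomorphic_on ball 0 R; R > 1; \<And>x. cmod x \<le> 1 \<Longrightarrow> cmod (h x) \<le> M\<rbrakk> \<Longrightarrow>
       (\<integral>\<^sup>+x\<in>ball 0 (1/2). ennreal (cmod (h x) powr (s - 2) * (cmod (deriv h x))\<^sup>2) \<partial>lborel) \<le> ennreal (C * M powr s)"
proof -
  define \<kappa> where "\<kappa> = min 1 (s/2)"
  define C where "C = 8 / \<kappa>\<^sup>2 * pi"
  have "\<kappa> > 0" using s by (simp add: \<kappa>_def)
  then have "C > 0" by (simp add: C_def)
  moreover have "(\<integral>\<^sup>+x\<in>ball 0 (1/2). ennreal (cmod (h x) powr (s - 2) * (cmod (deriv h x))\<^sup>2) \<partial>lborel) \<le> ennreal (C * M powr s)"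
    if h: "h holomorphic_on ball 0 R" and R: "R > 1" and M: "\<And>x. cmod x \<le> 1 \<Longrightarrow> cmod (h x) \<le> M" for h R M
  proof -
    define e :: "nat \<Rightarrow> real" where "e k = inverse (Suc k)" for k
    have e: "e k > 0" for k by (auto simp: e_def)
    have e0: "e \<longlonglongrightarrow> 0" unfolding e_def by (rule LIMSEQ_inverse_real_of_nat)
    have M0: "M \<ge> 0" using order_trans[OF norm_ge_zero M[of 0]] by simp
    define T where "T k x = (cmod (deriv h x))\<^sup>2 * ((cmod (h x))\<^sup>2 + e k) powr (s/2 - 1)" for k x
    define B :: "complex set" where "B = ball 0 (1/2)"
    have sub: "B \<subseteq> ball 0 R" using R by (auto simp: B_def)
    have h': "deriv h holomorphic_on ball 0 R"
      using h by (auto intro!: holomorphic_deriv)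
    have cts: "continuous_on B h" "continuous_on B (deriv h)"
      using h h' sub holomorphic_on_imp_continuous_on continuous_on_subset by blast+
    have meas: "(\<lambda>x. ennreal (T k x) * indicator B x) \<in> borel_measurable lborel" for k
      unfolding measurable_lborel2 T_def
      using e[of k] by (intro borel_measurable_ennreal_indicator continuous_intros cts) (auto simp: add_nonneg_eq_0_iff B_def)
    have bound: "(\<integral>\<^sup>+x\<in>B. ennreal (T k x) \<partial>lborel) \<le> ennreal (C * (M\<^sup>2 + e k) powr (s/2))" for k
    proof -
      have "(\<integral>\<^sup>+x\<in>B. ennreal (T k x) \<partial>lborel)
        \<le> ennreal (8 / \<kappa>\<^sup>2) * (\<integral>\<^sup>+x\<in>cball 0 1. ennreal (((cmod (h x))\<^sup>2 + e k) powr (s/2)) \<partial>lborel)"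
        unfolding T_def B_def \<kappa>_def by (rule caccioppoli_regularized[OF h R s e])
      also have "\<dots> \<le> ennreal (8 / \<kappa>\<^sup>2) * (\<integral>\<^sup>+x. ennreal ((M\<^sup>2 + e k) powr (s/2)) * indicator (cball (0::complex) 1) x \<partial>lborel)"
      proof (intro mult_left_mono nn_integral_mono)
        fix x :: complex
        show "ennreal (((cmod (h x))\<^sup>2 + e k) powr (s/2)) * indicator (cball 0 1) x
            \<le> ennreal ((M\<^sup>2 + e k) powr (s/2)) * indicator (cball (0::complex) 1) x"
        proof (cases "x \<in> cball 0 1")
          case True
          then have "(cmod (h x))\<^sup>2 \<le> M\<^sup>2" using M[of x] by (intro power_mono) auto
          then have "((cmod (h x))\<^sup>2 + e k) powr (s/2) \<le> (M\<^sup>2 + e k) powr (s/2)"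
            using s e[of k] by (intro powr_mono2) auto
          then show ?thesis using True by (simp add: ennreal_leI)
        qed simp
      qed auto
      also have "\<dots> = ennreal (8 / \<kappa>\<^sup>2) * (ennreal ((M\<^sup>2 + e k) powr (s/2)) * ennreal pi)"
        by (simp add: nn_integral_cmult_indicator emeasure_cball unit_ball_vol_2)
      also have "\<dots> = ennreal (C * (M\<^sup>2 + e k) powr (s/2))"
        by (simp add: C_def mult_ac flip: ennreal_mult)
      finally show ?thesis .
    qed
    have "(\<integral>\<^sup>+x\<in>B. ennreal (cmod (h x) powr (s - 2) * (cmod (deriv h x))\<^sup>2) \<partial>lborel)
        \<le> (\<integral>\<^sup>+x. liminf (\<lambda>k. ennreal (T k x) * indicator B x) \<partial>lborel)"
    proof (intro nn_integral_mono)
      fix x :: complex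
      show "ennreal (cmod (h x) powr (s - 2) * (cmod (deriv h x))\<^sup>2) * indicator B x \<le> liminf (\<lambda>k. ennreal (T k x) * indicator B x)"
      proof (cases "h x = 0 \<or> x \<notin> B")
        case False
        have "(\<lambda>k. T k x) \<longlonglongrightarrow> (cmod (deriv h x))\<^sup>2 * ((cmod (h x))\<^sup>2 + 0) powr (s/2 - 1)"
          unfolding T_def using False by (intro tendsto_intros e0) auto
        moreover have "((cmod (h x))\<^sup>2 + 0) powr (s/2 - 1) = cmod (h x) powr (s - 2)"
          using square_powr[of "cmod (h x)" "s/2 - 1"] by (simp add: algebra_simps)
        ultimately have "(\<lambda>k. ennreal (T k x)) \<longlonglongrightarrow> ennreal (cmod (h x) powr (s - 2) * (cmod (deriv h x))\<^sup>2)"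
          by (intro tendsto_ennrealI) (simp add: mult.commute)
        then have "liminf (\<lambda>k. ennreal (T k x)) = ennreal (cmod (h x) powr (s - 2) * (cmod (deriv h x))\<^sup>2)"
          by (intro lim_imp_Liminf) auto
        then show ?thesis using False by simp
      qed auto
    qed
    also have "\<dots> \<le> liminf (\<lambda>k. \<integral>\<^sup>+x\<in>B. ennreal (T k x) \<partial>lborel)"
      by (rule nn_integral_liminf[OF meas])
    also have "\<dots> \<le> liminf (\<lambda>k. ennreal (C * (M\<^sup>2 + e k) powr (s/2)))"
      by (intro Liminf_mono always_eventually allI bound)
    also have "\<dots> = ennreal (C * (M\<^sup>2 + 0) powr (s/2))"
    proof (intro lim_imp_Liminf tendsto_ennrealI tendsto_mult tendsto_const)
      show "(\<lambda>k. (M\<^sup>2 + e k) powr (s/2)) \<longlonglongrightarrow> (M\<^sup>2 + 0) powr (s/2)"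
        using s e by (intro tendsto_powr' tendsto_intros e0) (auto intro!: always_eventually add_nonneg_nonneg less_imp_le)
    qed auto
    also have "(M\<^sup>2 + 0) powr (s/2) = M powr s"
      using square_powr[OF M0, of "s/2"] by simp
    finally show ?thesis by (simp add: B_def)
  qed
  ultimately show ?thesis using that by blast
qed

text \<open>The maximum M of |h| on the closed unit disc mediates: Caccioppoli bounds the left side
  by a multiple of M powr p, and the mean value inequality on the unit disc around the maximum point
  bounds M powr p by the right side. This dictates the radii 1/2, 1, 2 and 3.\<close>

lemma local_derivative_estimate:
  fixes p q :: real
  assumes p: "p > 0" and q: "0 < q" "q < p + 2"
  obtains C where "C > 0"
    "\<And>h. h holomorphic_on ball 0 3 \<Longrightarrow>
       (\<integral>\<^sup>+x\<in>ball 0 (1/2). ennreal (cmod (h x) powr (p - q) * cmod (deriv h x) powr q) \<partial>lborel)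
       \<le> ennreal C * (\<integral>\<^sup>+x\<in>ball 0 2. ennreal (cmod (h x) powr p) \<partial>lborel)"
proof -
  obtain C1 where C1: "C1 > 0" and mean: "\<And>h S c r. \<lbrakk>h holomorphic_on S; open S; cball c r \<subseteq> S; r > 0\<rbrakk> \<Longrightarrow>
       ennreal (cmod (h c) powr p * r\<^sup>2) \<le> ennreal C1 * (\<integral>\<^sup>+x\<in>ball c r. ennreal (cmod (h x) powr p) \<partial>lborel)"
    by (rule cmod_powr_le_ball_integral[OF p], rule that)
  have sp: "p - q + 2 > 0" using q by simp
  \<comment> \<open>The exponent for the Caccioppoli estimate. For q >= 2 it is positive precisely
    because q < p + 2.\<close>
  define s where "s = (if q \<ge> 2 then p - q + 2 else p)"
  have s: "s > 0" using p q by (simp add: s_def)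
  obtain C2 where C2: "C2 > 0" and cacc: "\<And>h R M. \<lbrakk>h holomorphic_on ball 0 R; R > 1; \<And>x. cmod x \<le> 1 \<Longrightarrow> cmod (h x) \<le> M\<rbrakk> \<Longrightarrow>
       (\<integral>\<^sup>+x\<in>ball 0 (1/2). ennreal (cmod (h x) powr (s - 2) * (cmod (deriv h x))\<^sup>2) \<partial>lborel) \<le> ennreal (C2 * M powr s)"
    by (rule caccioppoli_powr[OF s], rule that, assumption) blast
  \<comment> \<open>2 powr (q - 2) stems from Cauchy's estimate |h'| <= 2 M on the half disc; pi
    bounds the area of that disc.\<close>
  define C3 where "C3 = (if q \<ge> 2 then 2 powr (q - 2) * C2 else pi + C2)"
  have C3: "C3 > 0" using C2 by (auto simp: C3_def add_pos_pos)
  have main: "(\<integral>\<^sup>+x\<in>ball 0 (1/2). ennreal (cmod (h x) powr (p - q) * cmod (deriv h x) powr q) \<partial>lborel)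
       \<le> ennreal (C3 * C1) * (\<integral>\<^sup>+x\<in>ball 0 2. ennreal (cmod (h x) powr p) \<partial>lborel)"
    if h: "h holomorphic_on ball 0 3" for h
  proof -
    have ch: "continuous_on (cball 0 1) h"
      using holomorphic_on_imp_continuous_on[OF h] by (rule continuous_on_subset) auto
    obtain m where m: "m \<in> cball 0 1" and mx: "\<And>x. x \<in> cball 0 1 \<Longrightarrow> cmod (h x) \<le> cmod (h m)"
      using continuous_attains_sup[of "cball 0 1" "\<lambda>x. cmod (h x)"] continuous_on_norm[OF ch] by auto
    define M where "M = cmod (h m)"
    have M: "cmod (h x) \<le> M" if "cmod x \<le> 1" for x using mx that by (simp add: M_def)
    have "M \<ge> 0" by (simp add: M_def)
    have bsub: "ball m 1 \<subseteq> ball 0 2"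
    proof
      fix x assume "x \<in> ball m 1"
      then show "x \<in> ball 0 2" using m norm_triangle_ineq[of "x - m" m] by (simp add: dist_norm norm_minus_commute)
    qed
    have "cball m 1 \<subseteq> ball 0 3"
    proof
      fix x assume "x \<in> cball m 1"
      then show "x \<in> ball 0 3" using m norm_triangle_ineq[of "x - m" m] by (simp add: dist_norm norm_minus_commute)
    qed
    from mean[OF h open_ball this]
    have "ennreal (M powr p) \<le> ennreal C1 * (\<integral>\<^sup>+x\<in>ball m 1. ennreal (cmod (h x) powr p) \<partial>lborel)"
      by (simp add: M_def)
    also have "\<dots> \<le> ennreal C1 * (\<integral>\<^sup>+x\<in>ball 0 2. ennreal (cmod (h x) powr p) \<partial>lborel)"
      using bsub by (intro mult_left_mono nn_integral_mono) (auto simp: indicator_def)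
    finally have Mp: "ennreal (M powr p) \<le> ennreal C1 * (\<integral>\<^sup>+x\<in>ball 0 2. ennreal (cmod (h x) powr p) \<partial>lborel)" .
    have dh: "cmod (deriv h x) \<le> 2 * M" if x: "x \<in> ball 0 (1/2)" for x
    proof -
      have cb: "cmod y \<le> 1" if "y \<in> cball x (1/2)" for y
        using that x norm_triangle_ineq[of "y - x" x] by (simp add: dist_norm norm_minus_commute)
      have sub2: "cball x (1/2) \<subseteq> ball 0 3" using cb by force
      have "norm ((deriv ^^ 1) h x) \<le> fact 1 * M / (1/2)^1"
      proof (rule Cauchy_inequality)
        show "h holomorphic_on ball x (1/2)"
          using h sub2 ball_subset_cball by (meson holomorphic_on_subset order_trans)
        show "continuous_on (cball x (1/2)) h"
          using holomorphic_on_imp_continuous_on[OF h] sub2 by (rule continuous_on_subset)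
        show "cmod (h y) \<le> M" if "cmod (x - y) = 1/2" for y
          by (rule M, rule cb) (use that in \<open>simp add: dist_norm\<close>)
      qed simp
      then show ?thesis by simp
    qed
    have C: "(\<integral>\<^sup>+x\<in>ball 0 (1/2). ennreal (cmod (h x) powr (s - 2) * (cmod (deriv h x))\<^sup>2) \<partial>lborel) \<le> ennreal (C2 * M powr s)"
      using cacc[OF h _ M] by simp
    have h': "deriv h holomorphic_on ball 0 3" using h by (auto intro!: holomorphic_deriv)
    have "(\<integral>\<^sup>+x\<in>ball 0 (1/2). ennreal (cmod (h x) powr (p - q) * cmod (deriv h x) powr q) \<partial>lborel) \<le> ennreal (C3 * M powr p)"
    proof (cases "M = 0")
      case True
      have "(\<integral>\<^sup>+x\<in>ball 0 (1/2). ennreal (cmod (h x) powr (p - q) * cmod (deriv h x) powr q) \<partial>lborel) = (\<integral>\<^sup>+x. 0 \<partial>(lborel::complex measure))"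
        using M True by (intro nn_integral_cong) (auto simp: indicator_def)
      then show ?thesis by simp
    next
      case False
      then have Mpos: "M > 0" using \<open>M \<ge> 0\<close> by simp
      define F where "F x = ennreal (cmod (h x) powr (s - 2) * (cmod (deriv h x))\<^sup>2) * indicator (ball 0 (1/2)) x" for x
      have cF: "F \<in> borel_measurable borel"
      proof -
        have hol: "continuous_on (ball 0 (1/2)) h" "continuous_on (ball 0 (1/2)) (deriv h)"
          using holomorphic_on_imp_continuous_on[OF h] holomorphic_on_imp_continuous_on[OF h']
          by (auto elim!: continuous_on_subset)
        have [measurable]: "(\<lambda>x. indicator (ball 0 (1/2)) x *\<^sub>R h x) \<in> borel_measurable borel"
            "(\<lambda>x. indicator (ball 0 (1/2)) x *\<^sub>R deriv h x) \<in> borel_measurable borel"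
          by (intro borel_measurable_continuous_on_indicator hol; simp)+
        have "F = (\<lambda>x. ennreal (cmod (indicator (ball 0 (1/2)) x *\<^sub>R h x) powr (s - 2) * (cmod (indicator (ball 0 (1/2)) x *\<^sub>R deriv h x))\<^sup>2))"
          by (auto simp: F_def indicator_def fun_eq_iff)
        also have "\<dots> \<in> borel_measurable borel" by measurable
        finally show ?thesis .
      qed
      show ?thesis
      proof (cases "q \<ge> 2")
        case q2: True
        have ss: "s - 2 = p - q" using q2 by (simp add: s_def)
        have "(\<integral>\<^sup>+x\<in>ball 0 (1/2). ennreal (cmod (h x) powr (p - q) * cmod (deriv h x) powr q) \<partial>lborel)
            \<le> (\<integral>\<^sup>+x. ennreal ((2 * M) powr (q - 2)) * F x \<partial>lborel)"
        proof (intro nn_integral_mono)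
          fix x :: complex
          show "ennreal (cmod (h x) powr (p - q) * cmod (deriv h x) powr q) * indicator (ball 0 (1/2)) x
              \<le> ennreal ((2 * M) powr (q - 2)) * F x"
          proof (cases "x \<in> ball 0 (1/2)")
            case True
            have "cmod (deriv h x) powr q = (cmod (deriv h x))\<^sup>2 * cmod (deriv h x) powr (q - 2)"
              by (cases "deriv h x = 0") (simp_all add: powr_diff)
            also have "\<dots> \<le> (cmod (deriv h x))\<^sup>2 * (2 * M) powr (q - 2)"
              using dh[OF True] q2 by (intro mult_left_mono powr_mono2) auto
            finally have "cmod (h x) powr (p - q) * cmod (deriv h x) powr q
              \<le> cmod (h x) powr (p - q) * ((cmod (deriv h x))\<^sup>2 * (2 * M) powr (q - 2))"
              by (intro mult_left_mono) auto
            then show ?thesis using True by (simp add: F_def ss mult_ac ennreal_leI flip: ennreal_mult)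
          qed simp
        qed
        also have "\<dots> = ennreal ((2 * M) powr (q - 2)) * (\<integral>\<^sup>+x. F x \<partial>lborel)"
          using cF by (intro nn_integral_cmult) simp
        also have "\<dots> \<le> ennreal ((2 * M) powr (q - 2)) * ennreal (C2 * M powr s)"
          using C unfolding F_def by (rule mult_left_mono) simp
        also have "\<dots> = ennreal (2 powr (q - 2) * C2 * (M powr (q - 2) * M powr s))"
          using C2 Mpos by (simp add: powr_mult mult_ac flip: ennreal_mult)
        also have "M powr (q - 2) * M powr s = M powr p" using q2 by (simp add: s_def flip: powr_add)
        finally show ?thesis using q2 by (simp add: C3_def)
      next
        case q2: False
        have ss: "s = p" using q2 by (simp add: s_def)
        have "(\<integral>\<^sup>+x\<in>ball 0 (1/2). ennreal (cmod (h x) powr (p - q) * cmod (deriv h x) powr q) \<partial>lborel)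
            \<le> (\<integral>\<^sup>+x. ennreal (M powr p) * indicator (ball 0 (1/2)) x + F x \<partial>lborel)"
        proof (intro nn_integral_mono)
          fix x :: complex
          show "ennreal (cmod (h x) powr (p - q) * cmod (deriv h x) powr q) * indicator (ball 0 (1/2)) x
              \<le> ennreal (M powr p) * indicator (ball 0 (1/2)) x + F x"
          proof (cases "x \<in> ball 0 (1/2) \<and> h x \<noteq> 0")
            case True
            define y where "y = cmod (deriv h x) / cmod (h x)"
            have dy: "cmod (deriv h x) = cmod (h x) * y" using True by (simp add: y_def)
            have y0: "y \<ge> 0" by (simp add: y_def)
            \<comment> \<open>In terms of y = |h'| / |h| the integrand is |h| powr p times y powr q.
              The summand 1 costs at most M powr p, and y^2 is the Caccioppoli integrand.\<close>
            have yq: "y powr q \<le> 1 + y\<^sup>2"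
            proof (cases "y \<le> 1")
              case True
              then have "y powr q \<le> 1" using y0 q by (intro powr_le1) auto
              then show ?thesis by (simp add: add_increasing2)
            next
              case False
              then have "y powr q \<le> y powr 2" using q2 by (intro powr_mono) auto
              then show ?thesis using False by simp
            qed
            have "cmod (h x) powr (p - q) * cmod (deriv h x) powr q = cmod (h x) powr p * y powr q"
              using True y0 by (simp add: dy powr_mult powr_diff)
            also have "\<dots> \<le> cmod (h x) powr p * (1 + y\<^sup>2)" using yq by (intro mult_left_mono) auto
            also have "\<dots> = cmod (h x) powr p + cmod (h x) powr (s - 2) * (cmod (deriv h x))\<^sup>2"
            proof -
              have "cmod (h x) powr p = cmod (h x) powr (p - 2) * (cmod (h x))\<^sup>2"
                using True by (simp add: powr_diff)
              then show ?thesis by (simp add: ss dy power_mult_distrib distrib_left mult.assoc)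
            qed
            also have "\<dots> \<le> M powr p + cmod (h x) powr (s - 2) * (cmod (deriv h x))\<^sup>2"
              using M[of x] True p by (intro add_right_mono powr_mono2) auto
            finally have "ennreal (cmod (h x) powr (p - q) * cmod (deriv h x) powr q)
              \<le> ennreal (M powr p + cmod (h x) powr (s - 2) * (cmod (deriv h x))\<^sup>2)" by (rule ennreal_leI)
            also have "\<dots> = ennreal (M powr p) + ennreal (cmod (h x) powr (s - 2) * (cmod (deriv h x))\<^sup>2)"
              by (rule ennreal_plus) simp_all
            finally show ?thesis using True by (simp add: F_def)
          next
            case False
            then have eq: "ennreal (cmod (h x) powr (p - q) * cmod (deriv h x) powr q) * indicator (ball 0 (1/2)) x = 0"
              by (auto simp: indicator_def)
            show ?thesis unfolding eq by (rule zero_le)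
          qed
        qed
        also have "\<dots> = (\<integral>\<^sup>+x. ennreal (M powr p) * indicator (ball (0::complex) (1/2)) x \<partial>lborel) + (\<integral>\<^sup>+x. F x \<partial>lborel)"
        proof (rule nn_integral_add)
          show "(\<lambda>x. ennreal (M powr p) * indicator (ball (0::complex) (1/2)) x) \<in> borel_measurable lborel"
            unfolding measurable_lborel2
            by (intro borel_measurable_times_ennreal borel_measurable_const borel_measurable_indicator) simp
          show "F \<in> borel_measurable lborel" unfolding measurable_lborel2 by (rule cF)
        qed
        also have "\<dots> \<le> ennreal (M powr p) * ennreal pi + ennreal (C2 * M powr p)"
        proof (intro add_mono)
          show "(\<integral>\<^sup>+x. ennreal (M powr p) * indicator (ball (0::complex) (1/2)) x \<partial>lborel) \<le> ennreal (M powr p) * ennreal pi"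
          proof -
            have "emeasure lborel (ball (0::complex) (1/2)) = ennreal (pi * (1/2)\<^sup>2)"
              by (rule emeasure_complex_ball) simp
            also have "\<dots> \<le> ennreal pi" by (intro ennreal_leI) (simp add: power2_eq_square)
            finally have "ennreal (M powr p) * emeasure lborel (ball (0::complex) (1/2)) \<le> ennreal (M powr p) * ennreal pi"
              by (rule mult_left_mono) simp
            moreover have "ball (0::complex) (1/2) \<in> sets lborel" by simp
            ultimately show ?thesis by (simp only: nn_integral_cmult_indicator)
          qed
          show "(\<integral>\<^sup>+x. F x \<partial>lborel) \<le> ennreal (C2 * M powr p)" using C unfolding F_def ss .
        qed
        also have "\<dots> = ennreal (C3 * M powr p)"
        proof -
          have "ennreal (M powr p) * ennreal pi = ennreal (M powr p * pi)"
            by (rule ennreal_mult[symmetric]) simp_all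
          moreover have "ennreal (M powr p * pi) + ennreal (C2 * M powr p) = ennreal (M powr p * pi + C2 * M powr p)"
            by (rule ennreal_plus[symmetric]) (use C2 in simp_all)
          moreover have "M powr p * pi + C2 * M powr p = C3 * M powr p"
            using q2 by (simp add: C3_def algebra_simps)
          ultimately show ?thesis by (simp only:)
        qed
        finally show ?thesis .
      qed
    qed
    also have "\<dots> = ennreal C3 * ennreal (M powr p)" using C3 by (simp add: ennreal_mult)
    also have "\<dots> \<le> ennreal C3 * (ennreal C1 * (\<integral>\<^sup>+x\<in>ball 0 2. ennreal (cmod (h x) powr p) \<partial>lborel))"
      by (rule mult_left_mono[OF Mp]) simp
    finally show ?thesis using C1 C3 by (simp add: ennreal_mult mult.assoc)
  qed
  show ?thesis
  proof (rule that)
    show "C3 * C1 > 0" using C1 C3 by simp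
  qed (rule main)
qed

section \<open>Averages over Bergman balls\<close>

text \<open>Admissible weights are functions of the defect. Doubling with constant \<Lambda> is
  required exactly for the ratio 3 that \<open>berg_close\<close> provides; the last condition says
  that \<omega> s / s powr \<alpha> is nondecreasing on (0,1], which is what integration along rays
  needs. Truncations of s powr \<alpha> near the sphere satisfy this with one \<Lambda>.\<close>

definition weight_ok :: "real \<Rightarrow> real \<Rightarrow> (real \<Rightarrow> real) \<Rightarrow> bool" where
  "weight_ok \<alpha> \<Lambda> \<omega> \<longleftrightarrow> \<omega> \<in> borel_measurable borel \<and> \<omega> 1 = 1 \<and> (\<forall>s. 0 \<le> \<omega> s) \<and>
     (\<forall>s t. 0 < s \<and> s \<le> 1 \<and> 0 < t \<and> t \<le> 1 \<and> s \<le> 3 * t \<and> t \<le> 3 * s \<longrightarrow> \<omega> s \<le> \<Lambda> * \<omega> t) \<and>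
     (\<forall>s t. 0 < s \<and> s \<le> t \<and> t \<le> 1 \<longrightarrow> \<omega> s * t powr \<alpha> \<le> s powr \<alpha> * \<omega> t)"

lemma weight_okD:
  assumes "weight_ok \<alpha> \<Lambda> \<omega>"
  shows weight_ok_measurable: "\<omega> \<in> borel_measurable borel"
    and weight_ok_1: "\<omega> 1 = 1"
    and weight_ok_nonneg_all: "\<forall>s. 0 \<le> \<omega> s"
    and weight_ok_doubling_all: "\<forall>s t. 0 < s \<and> s \<le> 1 \<and> 0 < t \<and> t \<le> 1 \<and> s \<le> 3 * t \<and> t \<le> 3 * s \<longrightarrow> \<omega> s \<le> \<Lambda> * \<omega> t"
    and weight_ok_increasing_all: "\<forall>s t. 0 < s \<and> s \<le> t \<and> t \<le> 1 \<longrightarrow> \<omega> s * t powr \<alpha> \<le> s powr \<alpha> * \<omega> t"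
  using assms unfolding weight_ok_def by - (elim conjE, assumption)+

lemma weight_ok_nonneg: "weight_ok \<alpha> \<Lambda> \<omega> \<Longrightarrow> 0 \<le> \<omega> s"
  by (rule spec[OF weight_ok_nonneg_all])

lemma weight_ok_doubling:
  assumes "weight_ok \<alpha> \<Lambda> \<omega>" "z \<in> ball 0 1" "u \<in> ball 0 1" "defect u \<le> 3 * defect z" "defect z \<le> 3 * defect u"
  shows "\<omega> (defect u) \<le> \<Lambda> * \<omega> (defect z)"
  by (rule weight_ok_doubling_all[OF assms(1), rule_format])
     (intro conjI assms defect_pos defect_le_1)

lemma weight_ok_Lambda_pos:
  assumes "weight_ok \<alpha> \<Lambda> \<omega>"
  shows "1 \<le> \<Lambda>"
proof -
  have "\<omega> 1 \<le> \<Lambda> * \<omega> 1" by (rule weight_ok_doubling_all[OF assms, rule_format]) simp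
  then show ?thesis by (simp add: weight_ok_1[OF assms])
qed

definition wint :: "(real \<Rightarrow> real) \<Rightarrow> (complex^'n \<Rightarrow> ennreal) \<Rightarrow> ennreal" where
  "wint \<omega> F = (\<integral>\<^sup>+z\<in>ball 0 1. ennreal (\<omega> (defect z)) * F z \<partial>lborel)"

text \<open>The volume of the unit ball divided by the absolute determinant of
  \<open>berg_map z\<close>, expressed without determinants.\<close>

definition jac :: "complex^'n \<Rightarrow> ennreal" where
  "jac z = emeasure lborel {y. norm (berg_map z y) < 1}"

abbreviation uvol :: "'a::euclidean_space itself \<Rightarrow> ennreal" where
  "uvol _ \<equiv> emeasure lborel (ball (0::'a) 1)"

lemma berg_map_measurable [measurable]:
  assumes [measurable]: "f \<in> borel_measurable M" "g \<in> borel_measurable M"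
  shows "(\<lambda>x. berg_map (f x) (g x)) \<in> borel_measurable M"
  unfolding berg_map_def by measurable

lemma berg_sq_measurable [measurable]:
  assumes [measurable]: "f \<in> borel_measurable M" "g \<in> borel_measurable M"
  shows "(\<lambda>x. berg_sq (f x) (g x)) \<in> borel_measurable M"
  unfolding berg_sq_def by measurable

lemma jac_measurable [measurable]: "jac \<in> borel_measurable borel"
proof -
  have "jac z = (\<integral>\<^sup>+y. (if norm (berg_map z y) < 1 then 1 else 0) \<partial>lborel)" for z :: "complex^'a"
  proof -
    have "jac z = (\<integral>\<^sup>+y. indicator {y. norm (berg_map z y) < 1} y \<partial>lborel)"
      unfolding jac_def by (rule nn_integral_indicator[symmetric]) measurable
    then show ?thesis by (simp add: indicator_def of_bool_def)
  qed
  then have "jac = (\<lambda>z::complex^'a. (\<integral>\<^sup>+y. (if norm (berg_map z y) < 1 then 1 else 0) \<partial>lborel))" by auto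
  also have "\<dots> \<in> borel_measurable borel" by measurable
  finally show ?thesis .
qed

lemma berg_change:
  fixes z :: "complex^'n"
  assumes z: "z \<in> ball 0 1" and [measurable]: "F \<in> borel_measurable borel"
  shows "(\<integral>\<^sup>+y. F (z + berg_map z y) \<partial>lborel) * uvol TYPE(complex^'n) = jac z * (\<integral>\<^sup>+u. F u \<partial>lborel)"
  using nn_integral_linear_change[of "\<lambda>x. F (z + x)", OF _ linear_berg_map linear_berg_inv berg_map_inv[OF z]]
  by (simp add: jac_def nn_integral_lborel_translate)

lemma berg_change_ball:
  fixes z :: "complex^'n"
  assumes z: "z \<in> ball 0 1" and F[measurable]: "F \<in> borel_measurable borel" and r: "r > 0"
  shows "(\<integral>\<^sup>+y\<in>ball 0 r. F (z + berg_map z y) \<partial>lborel) * uvol TYPE(complex^'n)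
     = jac z * (\<integral>\<^sup>+u. F u * indicator {u. berg_sq z (u - z) < r\<^sup>2} u \<partial>lborel)"
proof -
  have eq: "indicator (ball 0 r) y = (indicator {u. berg_sq z (u - z) < r\<^sup>2} (z + berg_map z y) :: ennreal)" for y
  proof -
    have "norm y < r \<longleftrightarrow> (norm y)\<^sup>2 < r\<^sup>2"
      using r by (auto intro: power_strict_mono dest: power_less_imp_less_base)
    then show ?thesis by (simp add: indicator_def berg_sq_map[OF z])
  qed
  show ?thesis
    unfolding eq by (rule berg_change[OF z]) measurable
qed

text \<open>Hence \<open>jac z\<close> is inversely proportional to the volume of the Bergman ball
  of any fixed radius around z.\<close>

lemma jac_vol:
  fixes z :: "complex^'n"
  assumes z: "z \<in> ball 0 1" and r: "r > 0"
  shows "emeasure lborel (ball (0::complex^'n) r) * uvol TYPE(complex^'n)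
    = jac z * emeasure lborel {u. berg_sq z (u - z) < r\<^sup>2}"
proof -
  have "{u. berg_sq z (u - z) < r\<^sup>2} \<in> sets borel" by measurable
  then show ?thesis using berg_change_ball[OF z _ r, of "\<lambda>_. 1"] by simp
qed

lemma uvol_bounds: "uvol TYPE('a::euclidean_space) \<noteq> 0" "uvol TYPE('a) \<noteq> top" "uvol TYPE('a) < top"
  using emeasure_ball_pos[of 1 "0::'a"] emeasure_lborel_ball_finite[of "0::'a" 1] by auto

text \<open>Cancelling this volume in an inequality of \<open>ennreal\<close> requires it to be
  neither 0 nor infinite.\<close>

lemma berg_ball_vol_bounds:
  fixes z :: "complex^'n"
  assumes z: "z \<in> ball 0 1"
  shows "emeasure lborel {u. berg_sq z (u - z) < 1} \<noteq> 0" "emeasure lborel {u. berg_sq z (u - z) < 1} \<noteq> top"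
proof -
  let ?e = "emeasure lborel {u. berg_sq z (u - z) < 1}"
  have eq: "uvol TYPE(complex^'n) * uvol TYPE(complex^'n) = jac z * ?e"
    using jac_vol[OF z, of 1] by simp
  then show "?e \<noteq> 0" using uvol_bounds by auto
  show "?e \<noteq> top"
  proof
    assume "?e = top"
    then have "jac z * top = uvol TYPE(complex^'n) * uvol TYPE(complex^'n)" using eq by simp
    moreover have "uvol TYPE(complex^'n) * uvol TYPE(complex^'n) \<noteq> top" "uvol TYPE(complex^'n) * uvol TYPE(complex^'n) \<noteq> 0"
      using uvol_bounds by (auto simp: ennreal_mult_eq_top_iff)
    ultimately show False by (auto simp: ennreal_mult_top split: if_splits)
  qed
qed

text \<open>The unit ball of the metric at u lies in the ball of radius 4 of the metric at z;
  translation invariance allows both to be centred at u, and volumes of balls of radius 4 and 1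
  differ by 4 powr the real dimension.\<close>

lemma jac_compare:
  fixes z u :: "complex^'n"
  assumes z: "z \<in> ball 0 1" and u: "u \<in> ball 0 1" and le: "\<And>v. berg_sq z v \<le> 16 * berg_sq u v"
  shows "jac z \<le> ennreal (4 ^ DIM(complex^'n)) * jac u"
proof -
  let ?a = "emeasure lborel {x. berg_sq u (x - u) < 1}"
  have m: "{x. berg_sq z (x - z) < c} \<in> sets borel" for z :: "complex^'n" and c by measurable
  have shift: "emeasure lborel {x. berg_sq z (x - u) < c} = emeasure lborel {x. berg_sq z (x - z) < c}" for c
  proof -
    have "(\<integral>\<^sup>+x. indicator {x. berg_sq z (x - z) < c} ((z - u) + x) \<partial>lborel) = emeasure lborel {x. berg_sq z (x - z) < c}"
      using m by (subst nn_integral_lborel_translate) auto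
    moreover have "(\<lambda>x. indicator {x. berg_sq z (x - z) < c} ((z - u) + x)) = (indicator {x. berg_sq z (x - u) < c} :: _ \<Rightarrow> ennreal)"
      by (simp add: indicator_def fun_eq_iff algebra_simps)
    moreover have "{x. berg_sq z (x - u) < c} \<in> sets borel" by measurable
    ultimately show ?thesis by simp
  qed
  have "?a \<le> emeasure lborel {x. berg_sq z (x - u) < 4\<^sup>2}"
  proof (intro emeasure_mono subsetI)
    fix x assume "x \<in> {x. berg_sq u (x - u) < 1}"
    then show "x \<in> {x. berg_sq z (x - u) < 4\<^sup>2}" using le[of "x - u"] by simp
  qed measurable
  then have "?a * jac z \<le> emeasure lborel {x. berg_sq z (x - z) < 4\<^sup>2} * jac z"
    unfolding shift by (rule mult_right_mono) simp
  also have "\<dots> = emeasure lborel (ball (0::complex^'n) 4) * uvol TYPE(complex^'n)"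
    using jac_vol[OF z, of 4] by (simp add: mult.commute)
  also have "\<dots> = ennreal (4 ^ DIM(complex^'n)) * (jac u * ?a)"
    using jac_vol[OF u, of 1] by (simp add: emeasure_ball_scale[of 4] mult.assoc)
  also have "\<dots> = ?a * (ennreal (4 ^ DIM(complex^'n)) * jac u)" by (simp add: mult_ac)
  finally show ?thesis
    using berg_ball_vol_bounds[OF u] by (simp add: ennreal_mult_le_mult_iff)
qed

text \<open>The substitution u = z + \<open>berg_map z y\<close> gives a double integral over pairs
  of close points. After exchanging the integrals, the volume of the z-region around u cancels
  \<open>jac u\<close>.\<close>

lemma average_upper:
  fixes F :: "complex^'n \<Rightarrow> ennreal"
  assumes w: "weight_ok \<alpha> \<Lambda> \<omega>" and F[measurable]: "F \<in> borel_measurable borel"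
  shows "wint \<omega> (\<lambda>z. \<integral>\<^sup>+y\<in>ball 0 (1/4). F (z + berg_map z y) \<partial>lborel)
    \<le> ennreal (\<Lambda> * 4 ^ DIM(complex^'n)) * uvol TYPE(complex^'n) * wint \<omega> F"
proof -
  let ?B = "ball 0 1 :: (complex^'n) set"
  let ?V = "uvol TYPE(complex^'n)"
  let ?K = "ennreal (\<Lambda> * 4 ^ DIM(complex^'n))"
  have [measurable]: "\<omega> \<in> borel_measurable borel" using w by (rule weight_ok_measurable)
  have [measurable]: "?B \<in> sets borel" "ball (0::complex^'n) (1/4) \<in> sets borel" by simp_all
  have L: "\<Lambda> \<ge> 0" using weight_ok_Lambda_pos[OF w] by simp
  define I where "I z = (\<integral>\<^sup>+y\<in>ball 0 (1/4). F (z + berg_map z y) \<partial>lborel)" for z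
  define c where "c z = ennreal (\<omega> (defect z)) * indicator ?B z" for z
  have [measurable]: "c \<in> borel_measurable borel" unfolding c_def by measurable
  have "wint \<omega> I * ?V = (\<integral>\<^sup>+z. c z * (I z * ?V) \<partial>lborel)"
  proof -
    have [measurable]: "I \<in> borel_measurable borel" unfolding I_def by measurable
    show ?thesis unfolding wint_def c_def
      by (subst nn_integral_multc[symmetric]) (simp, simp add: mult_ac)
  qed
  also have "\<dots> = (\<integral>\<^sup>+z. (\<integral>\<^sup>+u. c z * jac z * F u * indicator {u. berg_sq z (u - z) < (1/4)\<^sup>2} u \<partial>lborel) \<partial>lborel)"
  proof (intro nn_integral_cong)
    fix z :: "complex^'n"
    show "c z * (I z * ?V) = (\<integral>\<^sup>+u. c z * jac z * F u * indicator {u. berg_sq z (u - z) < (1/4)\<^sup>2} u \<partial>lborel)"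
    proof (cases "z \<in> ?B")
      case True
      then show ?thesis unfolding I_def berg_change_ball[OF True F, of "1/4", simplified]
        by (simp add: mult.assoc flip: nn_integral_cmult)
    qed (simp add: c_def)
  qed
  also have "\<dots> = (\<integral>\<^sup>+u. (\<integral>\<^sup>+z. c z * jac z * F u * indicator {u. berg_sq z (u - z) < (1/4)\<^sup>2} u \<partial>lborel) \<partial>lborel)"
    by (rule lborel_pair.Fubini') (simp add: indicator_def)
  \<comment> \<open>Closeness is not symmetric in z and u: \<open>berg_close\<close> replaces the
    condition measured at z by one measured at u, and moves weight and Jacobian from z to u.\<close>
  also have "\<dots> \<le> (\<integral>\<^sup>+u. (\<integral>\<^sup>+z. c u * F u * ?K * jac u * indicator {z. berg_sq u (z - u) < 1} z \<partial>lborel) \<partial>lborel)"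
  proof (intro nn_integral_mono)
    fix u z :: "complex^'n"
    show "c z * jac z * F u * indicator {u. berg_sq z (u - z) < (1/4)\<^sup>2} u \<le> c u * F u * ?K * jac u * indicator {z. berg_sq u (z - u) < 1} z"
    proof (cases "z \<in> ?B \<and> berg_sq z (u - z) < (1/4)\<^sup>2")
      case True
      then have z: "z \<in> ?B" and r: "berg_sq z (u - z) \<le> 1/16" by (auto simp: power2_eq_square)
      note cl = berg_close[OF z r]
      have "berg_sq u (z - u) = berg_sq u (u - z)" using berg_sq_minus[of u "u - z"] by simp
      also have "\<dots> \<le> 16 * berg_sq z (u - z)" by (rule cl)
      also have "\<dots> < 1" using True by (simp add: power2_eq_square)
      finally have 1: "berg_sq u (z - u) < 1" .
      have 2: "jac z \<le> ennreal (4 ^ DIM(complex^'n)) * jac u" by (rule jac_compare[OF z cl(1) cl(5)])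
      have 3: "c z \<le> ennreal \<Lambda> * c u"
        using weight_ok_doubling[OF w cl(1) z cl(3) cl(2)] z cl(1) L weight_ok_nonneg[OF w]
        by (simp add: c_def ennreal_leI flip: ennreal_mult)
      have "c z * jac z * F u \<le> (ennreal \<Lambda> * c u) * (ennreal (4 ^ DIM(complex^'n)) * jac u) * F u"
        by (intro mult_right_mono mult_mono 2 3) auto
      also have "\<dots> = c u * F u * ?K * jac u" using L by (simp add: ennreal_mult mult_ac)
      finally show ?thesis using 1 by (simp add: indicator_def)
    qed (auto simp: c_def)
  qed
  also have "\<dots> = (\<integral>\<^sup>+u. c u * F u * ?K * (?V * ?V) \<partial>lborel)"
  proof (intro nn_integral_cong)
    fix u :: "complex^'n"
    have [measurable]: "{z. berg_sq u (z - u) < 1} \<in> sets borel" by measurable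
    have "(\<integral>\<^sup>+z. c u * F u * ?K * jac u * indicator {z. berg_sq u (z - u) < 1} z \<partial>lborel)
        = c u * F u * ?K * (jac u * emeasure lborel {z. berg_sq u (z - u) < 1})"
      by (subst nn_integral_cmult_indicator) (simp_all add: mult.assoc)
    also have "\<dots> = c u * F u * ?K * (?V * ?V)"
      using jac_vol[of u 1] by (cases "u \<in> ?B") (simp_all add: c_def)
    finally show "(\<integral>\<^sup>+z. c u * F u * ?K * jac u * indicator {z. berg_sq u (z - u) < 1} z \<partial>lborel)
      = c u * F u * ?K * (?V * ?V)" .
  qed
  also have "\<dots> = (\<integral>\<^sup>+u. c u * F u \<partial>lborel) * (?K * (?V * ?V))"
    by (subst nn_integral_multc[symmetric]) (simp_all add: mult.assoc)
  also have "(\<integral>\<^sup>+u. c u * F u \<partial>lborel) = wint \<omega> F"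
    unfolding wint_def c_def by (intro nn_integral_cong) (simp add: mult_ac)
  finally have "?V * wint \<omega> I \<le> ?V * (?K * ?V * wint \<omega> F)" by (simp add: mult_ac)
  then show ?thesis unfolding I_def using uvol_bounds[where 'a="complex^'n"] by (simp add: ennreal_mult_le_mult_iff)
qed

text \<open>The argument of \<open>average_upper\<close> run backwards: each u is first surrounded
  by the points within r/4 in its own metric, since these see u within r in theirs.\<close>

lemma average_lower:
  fixes F :: "complex^'n \<Rightarrow> ennreal"
  assumes w: "weight_ok \<alpha> \<Lambda> \<omega>" and F[measurable]: "F \<in> borel_measurable borel" and r: "0 < r" "r \<le> 1/4"
  shows "ennreal ((r/4) ^ DIM(complex^'n)) * uvol TYPE(complex^'n) * wint \<omega> F
    \<le> ennreal (\<Lambda> * 4 ^ DIM(complex^'n)) * wint \<omega> (\<lambda>z. \<integral>\<^sup>+y\<in>ball 0 r. F (z + berg_map z y) \<partial>lborel)"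
proof -
  let ?B = "ball 0 1 :: (complex^'n) set"
  let ?V = "uvol TYPE(complex^'n)"
  let ?K = "ennreal (\<Lambda> * 4 ^ DIM(complex^'n))"
  let ?r = "ennreal ((r/4) ^ DIM(complex^'n))"
  have [measurable]: "\<omega> \<in> borel_measurable borel" using w by (rule weight_ok_measurable)
  have [measurable]: "?B \<in> sets borel" "ball (0::complex^'n) r \<in> sets borel" by simp_all
  have L: "\<Lambda> \<ge> 0" using weight_ok_Lambda_pos[OF w] by simp
  define I where "I z = (\<integral>\<^sup>+y\<in>ball 0 r. F (z + berg_map z y) \<partial>lborel)" for z
  have [measurable]: "I \<in> borel_measurable borel" unfolding I_def by measurable
  define c where "c z = ennreal (\<omega> (defect z)) * indicator ?B z" for z
  have [measurable]: "c \<in> borel_measurable borel" unfolding c_def by measurable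
  have "wint \<omega> F * (?r * ?V * ?V) = (\<integral>\<^sup>+u. c u * F u * (?r * ?V * ?V) \<partial>lborel)"
    unfolding wint_def c_def by (subst nn_integral_multc[symmetric]) (simp, simp add: mult_ac)
  also have "\<dots> = (\<integral>\<^sup>+u. (\<integral>\<^sup>+z. c u * F u * jac u * indicator {z. berg_sq u (z - u) < (r/4)\<^sup>2} z \<partial>lborel) \<partial>lborel)"
  proof (intro nn_integral_cong)
    fix u :: "complex^'n"
    have [measurable]: "{z. berg_sq u (z - u) < (r/4)\<^sup>2} \<in> sets borel" by measurable
    have "(\<integral>\<^sup>+z. c u * F u * jac u * indicator {z. berg_sq u (z - u) < (r/4)\<^sup>2} z \<partial>lborel)
        = c u * F u * (jac u * emeasure lborel {z. berg_sq u (z - u) < (r/4)\<^sup>2})"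
      by (subst nn_integral_cmult_indicator) (simp_all add: mult.assoc)
    also have "\<dots> = c u * F u * (?r * ?V * ?V)"
      using jac_vol[of u "r/4"] r by (cases "u \<in> ?B") (simp_all add: c_def emeasure_ball_scale[of "r/4"])
    finally show "c u * F u * (?r * ?V * ?V)
      = (\<integral>\<^sup>+z. c u * F u * jac u * indicator {z. berg_sq u (z - u) < (r/4)\<^sup>2} z \<partial>lborel)" by simp
  qed
  also have "\<dots> \<le> (\<integral>\<^sup>+u. (\<integral>\<^sup>+z. ?K * (c z * jac z * F u * indicator {u. berg_sq z (u - z) < r\<^sup>2} u) \<partial>lborel) \<partial>lborel)"
  proof (intro nn_integral_mono)
    fix u z :: "complex^'n"
    show "c u * F u * jac u * indicator {z. berg_sq u (z - u) < (r/4)\<^sup>2} z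
       \<le> ?K * (c z * jac z * F u * indicator {u. berg_sq z (u - z) < r\<^sup>2} u)"
    proof (cases "u \<in> ?B \<and> berg_sq u (z - u) < (r/4)\<^sup>2")
      case True
      have "(r/4)\<^sup>2 \<le> (1/4)\<^sup>2" using r by (intro power_mono) auto
      also have "(1/4)\<^sup>2 = (1/16 :: real)" by (simp add: power2_eq_square)
      finally have "(r/4)\<^sup>2 \<le> 1/16" .
      then have u: "u \<in> ?B" and rr: "berg_sq u (z - u) \<le> 1/16" using True by auto
      note cl = berg_close[OF u rr]
      have "berg_sq z (u - z) = berg_sq z (z - u)" using berg_sq_minus[of z "z - u"] by simp
      also have "\<dots> \<le> 16 * berg_sq u (z - u)" by (rule cl)
      also have "\<dots> < r\<^sup>2" using True by (simp add: power_divide)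
      finally have 1: "berg_sq z (u - z) < r\<^sup>2" .
      have 2: "jac u \<le> ennreal (4 ^ DIM(complex^'n)) * jac z" by (rule jac_compare[OF u cl(1) cl(5)])
      have 3: "c u \<le> ennreal \<Lambda> * c z"
        using weight_ok_doubling[OF w cl(1) u cl(3) cl(2)] u cl(1) L weight_ok_nonneg[OF w]
        by (simp add: c_def ennreal_leI flip: ennreal_mult)
      have "c u * F u * jac u \<le> (ennreal \<Lambda> * c z) * F u * (ennreal (4 ^ DIM(complex^'n)) * jac z)"
        by (intro mult_mono mult_right_mono 2 3) auto
      also have "\<dots> = ?K * (c z * jac z * F u)" using L by (simp add: ennreal_mult mult_ac)
      finally show ?thesis using 1 by (simp add: indicator_def)
    qed (auto simp: c_def)
  qed
  also have "\<dots> = (\<integral>\<^sup>+z. (\<integral>\<^sup>+u. ?K * (c z * jac z * F u * indicator {u. berg_sq z (u - z) < r\<^sup>2} u) \<partial>lborel) \<partial>lborel)"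
    by (rule lborel_pair.Fubini') (simp add: indicator_def)
  also have "\<dots> = (\<integral>\<^sup>+z. ?K * ?V * (c z * I z) \<partial>lborel)"
  proof (intro nn_integral_cong)
    fix z :: "complex^'n"
    show "(\<integral>\<^sup>+u. ?K * (c z * jac z * F u * indicator {u. berg_sq z (u - z) < r\<^sup>2} u) \<partial>lborel) = ?K * ?V * (c z * I z)"
    proof (cases "z \<in> ?B")
      case True
      have [measurable]: "{u. berg_sq z (u - z) < r\<^sup>2} \<in> sets borel" by measurable
      have "(\<integral>\<^sup>+u. ?K * (c z * jac z * F u * indicator {u. berg_sq z (u - z) < r\<^sup>2} u) \<partial>lborel)
         = ?K * c z * (jac z * (\<integral>\<^sup>+u. F u * indicator {u. berg_sq z (u - z) < r\<^sup>2} u \<partial>lborel))"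
        by (simp add: mult.assoc nn_integral_cmult)
      also have "\<dots> = ?K * c z * (I z * ?V)" unfolding I_def berg_change_ball[OF True F r(1)] ..
      finally show ?thesis by (simp add: mult_ac)
    qed (simp add: c_def)
  qed
  also have "\<dots> = ?K * ?V * (\<integral>\<^sup>+z. c z * I z \<partial>lborel)"
    by (rule nn_integral_cmult) measurable
  also have "(\<integral>\<^sup>+z. c z * I z \<partial>lborel) = wint \<omega> I"
    unfolding wint_def c_def by (intro nn_integral_cong) (simp add: mult_ac)
  finally have "?V * (?r * ?V * wint \<omega> F) \<le> ?V * (?K * wint \<omega> I)" by (simp add: mult_ac)
  then show ?thesis unfolding I_def using uvol_bounds[where 'a="complex^'n"] by (simp add: ennreal_mult_le_mult_iff)
qed

section \<open>Calculus of weighted integrals and the local estimate on Bergman balls\<close>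

lemma wint_mono:
  assumes "\<And>z. z \<in> ball 0 1 \<Longrightarrow> F z \<le> G z"
  shows "wint \<omega> F \<le> wint \<omega> G"
  unfolding wint_def using assms by (intro nn_integral_mono) (auto simp: indicator_def intro: mult_left_mono)

lemma wint_cong:
  assumes "\<And>z. z \<in> ball 0 1 \<Longrightarrow> F z = G z"
  shows "wint \<omega> F = wint \<omega> G"
  by (intro antisym wint_mono) (simp_all add: assms)

lemma wint_cmult:
  assumes "weight_ok \<alpha> \<Lambda> \<omega>" and [measurable]: "(\<lambda>z. F z * indicator (ball 0 1) z) \<in> borel_measurable borel"
  shows "wint \<omega> (\<lambda>z. c * F z) = c * wint \<omega> F"
proof -
  have [measurable]: "\<omega> \<in> borel_measurable borel" using assms(1) by (rule weight_ok_measurable)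
  have "wint \<omega> (\<lambda>z. c * F z) = (\<integral>\<^sup>+z. c * (ennreal (\<omega> (defect z)) * (F z * indicator (ball 0 1) z)) \<partial>lborel)"
    unfolding wint_def by (intro nn_integral_cong) (simp add: mult_ac)
  also have "\<dots> = c * (\<integral>\<^sup>+z. ennreal (\<omega> (defect z)) * (F z * indicator (ball 0 1) z) \<partial>lborel)"
    by (rule nn_integral_cmult) measurable
  finally show ?thesis by (simp add: wint_def mult.assoc)
qed

lemma wint_add:
  assumes "weight_ok \<alpha> \<Lambda> \<omega>" and [measurable]: "(\<lambda>z. F z * indicator (ball 0 1) z) \<in> borel_measurable borel"
    "(\<lambda>z. G z * indicator (ball 0 1) z) \<in> borel_measurable borel"
  shows "wint \<omega> (\<lambda>z. F z + G z) = wint \<omega> F + wint \<omega> G"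
proof -
  have [measurable]: "\<omega> \<in> borel_measurable borel" using assms(1) by (rule weight_ok_measurable)
  have "wint \<omega> (\<lambda>z. F z + G z) = (\<integral>\<^sup>+z. ennreal (\<omega> (defect z)) * (F z * indicator (ball 0 1) z)
      + ennreal (\<omega> (defect z)) * (G z * indicator (ball 0 1) z) \<partial>lborel)"
    unfolding wint_def by (intro nn_integral_cong) (simp add: distrib_left distrib_right mult_ac)
  also have "\<dots> = (\<integral>\<^sup>+z. ennreal (\<omega> (defect z)) * (F z * indicator (ball 0 1) z) \<partial>lborel)
      + (\<integral>\<^sup>+z. ennreal (\<omega> (defect z)) * (G z * indicator (ball 0 1) z) \<partial>lborel)"
    by (rule nn_integral_add) measurable
  finally show ?thesis by (simp add: wint_def mult.assoc)
qed

lemma berg_map_in_ball: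
  assumes "z \<in> ball 0 1" "norm y \<le> 1/4"
  shows "z + berg_map z y \<in> ball 0 1"
proof (rule berg_close(1)[OF assms(1)])
  have "(norm y)\<^sup>2 \<le> (1/4)\<^sup>2" using assms by (intro power_mono) auto
  then show "berg_sq z (z + berg_map z y - z) \<le> 1/16"
    by (simp add: berg_sq_map[OF assms(1)] power2_eq_square)
qed

text \<open>Averaging over translations by \<open>\<lambda> e\<close> reduces the estimate to the one-variable one on each complex line.\<close>

lemma berg_local_estimate:
  fixes p q :: real
  assumes p: "p > 0" and q: "0 < q" "q < p + 2"
  obtains C where "C > 0"
    "\<And>(f :: complex^'n \<Rightarrow> complex) z k. \<lbrakk>holo_on f (ball 0 1); z \<in> ball 0 1\<rbrakk> \<Longrightarrow>
      (\<integral>\<^sup>+y\<in>ball 0 (1/16). ennreal (cmod (f (z + berg_map z y)) powr (p - q) *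
           cmod (cdiff f (z + berg_map z y) (berg_map z (axis k 1))) powr q) \<partial>lborel)
      \<le> ennreal C * (\<integral>\<^sup>+y\<in>ball 0 (1/4). ennreal (cmod (f (z + berg_map z y)) powr p) \<partial>lborel)"
proof -
  obtain C1 where C1: "C1 > 0" and loc: "\<And>h. h holomorphic_on ball 0 3 \<Longrightarrow>
       (\<integral>\<^sup>+x\<in>ball 0 (1/2). ennreal (cmod (h x) powr (p - q) * cmod (deriv h x) powr q) \<partial>lborel)
       \<le> ennreal C1 * (\<integral>\<^sup>+x\<in>ball 0 2. ennreal (cmod (h x) powr p) \<partial>lborel)"
    by (rule local_derivative_estimate[OF p q], rule that)
  \<comment> \<open>32 powr q undoes the scale 1/32 of the line parameter in the derivative; 16 is
    the ratio of the areas of the discs of radius 2 and 1/2.\<close>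
  define C where "C = 16 * 32 powr q * C1"
  have main: "(\<integral>\<^sup>+y\<in>ball 0 (1/16). ennreal (cmod (f (z + berg_map z y)) powr (p - q) *
           cmod (cdiff f (z + berg_map z y) (berg_map z (axis k 1))) powr q) \<partial>lborel)
      \<le> ennreal C * (\<integral>\<^sup>+y\<in>ball 0 (1/4). ennreal (cmod (f (z + berg_map z y)) powr p) \<partial>lborel)"
    if f: "holo_on f (ball 0 1)" and z: "z \<in> ball 0 1" for f :: "complex^'n \<Rightarrow> complex" and z k
  proof -
    define e where "e = (axis k 1 :: complex^'n)"
    have ne: "norm e = 1" by (simp add: e_def)
    define v where "v = berg_map z e"
    define fB where "fB u = indicator (ball 0 1) u *\<^sub>R f u" for u
    define dB where "dB u = indicator (ball 0 1) u *\<^sub>R cdiff f u v" for u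
    have [measurable]: "fB \<in> borel_measurable borel" unfolding fB_def by (rule holo_measurable[OF f]) simp
    have [measurable]: "dB \<in> borel_measurable borel" unfolding dB_def by (rule cdiff_measurable[OF f]) simp
    have [measurable]: "ball (0::complex^'n) r \<in> sets borel" "ball (0::complex) r \<in> sets borel" for r by simp_all
    define \<Phi> where "\<Phi> y = ennreal (cmod (fB (z + berg_map z y)) powr (p - q) * cmod (dB (z + berg_map z y)) powr q)" for y
    define \<Psi> where "\<Psi> y = ennreal (cmod (fB (z + berg_map z y)) powr p) * indicator (ball 0 (1/4)) y" for y
    have [measurable]: "\<Phi> \<in> borel_measurable borel" "\<Psi> \<in> borel_measurable borel"
      unfolding \<Phi>_def \<Psi>_def by measurable
    define s where "s l y = (of_real (1/32) * l) *s e + y" for l :: complex and y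
    have [measurable]: "(\<lambda>x. s (a x) (b x)) \<in> borel_measurable M"
      if [measurable]: "a \<in> borel_measurable M" "b \<in> borel_measurable M" for a b and M :: "'z measure"
      unfolding s_def by measurable
    have ns: "norm (s l y) \<le> cmod l / 32 + norm y" for l y
      unfolding s_def by (rule order_trans[OF norm_triangle_ineq]) (simp add: norm_cscale ne norm_mult)
    have ns': "norm y \<le> norm (s l y) + cmod l / 32" for l y
    proof -
      have "norm y = norm (s l y - (of_real (1/32) * l) *s e)" by (simp add: s_def)
      also have "\<dots> \<le> norm (s l y) + norm ((of_real (1/32) * l) *s e)" by (rule norm_triangle_ineq4)
      finally show ?thesis by (simp add: norm_cscale ne norm_mult)
    qed
    \<comment> \<open>5/64 = 1/16 + (1/2)/32: outside this radius no translate with |l| < 1/2 meets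
      the ball of radius 1/16. As 5/64 + 3/32 < 1/4, the whole disc of radius 3 in l stays in the
      region where f is holomorphic.\<close>
    have line: "(\<integral>\<^sup>+l. \<Phi> (s l y) * indicator (ball 0 (1/2)) l \<partial>lborel)
        \<le> ennreal (32 powr q * C1) * (\<integral>\<^sup>+l. \<Psi> (s l y) * indicator (ball 0 2) l \<partial>lborel)" if y: "norm y < 5/64" for y
    proof -
      define a where "a = z + berg_map z y"
      have zs: "z + berg_map z (s l y) = a + l *s (of_real (1/32) *s v)" for l
        unfolding s_def a_def v_def linear_add[OF linear_berg_map] berg_map_cscale
        by (simp add: vec_eq_iff algebra_simps)
      define h where "h l = f (a + l *s (of_real (1/32) *s v))" for l
      have inb: "a + l *s (of_real (1/32) *s v) \<in> ball 0 1" if "cmod l < 3" for l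
        unfolding zs[symmetric] using ns[of l y] that y by (intro berg_map_in_ball z) simp
      have dh: "(h has_field_derivative of_real (1/32) * cdiff f (a + l *s (of_real (1/32) *s v)) v) (at l)" if "cmod l < 3" for l
        using holo_line_deriv[OF f inb[OF that]] unfolding h_def[abs_def] cdiff_cscale .
      have hol: "h holomorphic_on ball 0 3"
        by (rule holomorphic_onI) (use dh in \<open>auto simp: field_differentiable_def intro: has_field_derivative_at_within\<close>)
      have d: "deriv h l = of_real (1/32) * cdiff f (a + l *s (of_real (1/32) *s v)) v" if "cmod l < 3" for l
        using dh[OF that] by (rule DERIV_imp_deriv)
      have "(\<integral>\<^sup>+l. \<Phi> (s l y) * indicator (ball 0 (1/2)) l \<partial>lborel) =
         (\<integral>\<^sup>+l. ennreal (32 powr q) * (ennreal (cmod (h l) powr (p - q) * cmod (deriv h l) powr q) * indicator (ball 0 (1/2)) l) \<partial>lborel)"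
      proof (intro nn_integral_cong)
        fix l :: complex
        show "\<Phi> (s l y) * indicator (ball 0 (1/2)) l = ennreal (32 powr q) * (ennreal (cmod (h l) powr (p - q) * cmod (deriv h l) powr q) * indicator (ball 0 (1/2)) l)"
        proof (cases "l \<in> ball 0 (1/2)")
          case True
          then have l: "cmod l < 3" by simp
          have "cmod (dB (z + berg_map z (s l y))) = 32 * cmod (deriv h l)"
            using inb[OF l] by (simp add: dB_def zs d[OF l] norm_mult)
          moreover have "cmod (fB (z + berg_map z (s l y))) = cmod (h l)"
            using inb[OF l] by (simp add: fB_def zs h_def)
          ultimately have "\<Phi> (s l y) = ennreal (32 powr q * (cmod (h l) powr (p - q) * cmod (deriv h l) powr q))"
            by (simp add: \<Phi>_def powr_mult mult_ac)
          also have "\<dots> = ennreal (32 powr q) * ennreal (cmod (h l) powr (p - q) * cmod (deriv h l) powr q)"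
            by (rule ennreal_mult) simp_all
          finally show ?thesis by (simp add: mult.assoc)
        qed simp
      qed
      also have "\<dots> \<le> ennreal (32 powr q) * (\<integral>\<^sup>+l. ennreal (cmod (h l) powr (p - q) * cmod (deriv h l) powr q) * indicator (ball 0 (1/2)) l \<partial>lborel)"
      proof -
        have sub: "ball 0 (1/2) \<subseteq> ball (0::complex) 3" by auto
        have "deriv h holomorphic_on ball 0 3" using hol by (intro holomorphic_deriv) auto
        then have [measurable]: "(\<lambda>l. indicator (ball 0 (1/2)) l *\<^sub>R deriv h l) \<in> borel_measurable borel"
          using sub by (intro borel_measurable_continuous_on_indicator continuous_on_subset[OF holomorphic_on_imp_continuous_on]) auto
        have [measurable]: "(\<lambda>l. indicator (ball 0 (1/2)) l *\<^sub>R h l) \<in> borel_measurable borel"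
          using sub hol by (intro borel_measurable_continuous_on_indicator continuous_on_subset[OF holomorphic_on_imp_continuous_on]) auto
        have "(\<lambda>l. ennreal (cmod (h l) powr (p - q) * cmod (deriv h l) powr q) * indicator (ball 0 (1/2)) l) =
           (\<lambda>l. ennreal (cmod (indicator (ball 0 (1/2)) l *\<^sub>R h l) powr (p - q) * cmod (indicator (ball 0 (1/2)) l *\<^sub>R deriv h l) powr q))"
          by (rule ext) (auto simp: indicator_def)
        also have "\<dots> \<in> borel_measurable borel" by measurable
        finally show ?thesis by (simp add: nn_integral_cmult)
      qed
      also have "\<dots> \<le> ennreal (32 powr q) * (ennreal C1 * (\<integral>\<^sup>+l\<in>ball 0 2. ennreal (cmod (h l) powr p) \<partial>lborel))"
        by (intro mult_left_mono loc[OF hol]) simp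
      also have "(\<integral>\<^sup>+l\<in>ball 0 2. ennreal (cmod (h l) powr p) \<partial>lborel) = (\<integral>\<^sup>+l. \<Psi> (s l y) * indicator (ball 0 2) l \<partial>lborel)"
      proof (intro nn_integral_cong)
        fix l :: complex
        show "ennreal (cmod (h l) powr p) * indicator (ball 0 2) l = \<Psi> (s l y) * indicator (ball 0 2) l"
        proof (cases "l \<in> ball 0 2")
          case True
          then have l: "cmod l < 3" by simp
          have "norm (s l y) < 1/4" using ns[of l y] y True by simp
          moreover have "fB (z + berg_map z (s l y)) = h l"
            using inb[OF l] by (simp add: fB_def zs h_def)
          ultimately show ?thesis by (simp add: \<Psi>_def)
        qed simp
      qed
      also have "ennreal (32 powr q) * (ennreal C1 * (\<integral>\<^sup>+l. \<Psi> (s l y) * indicator (ball 0 2) l \<partial>lborel))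
          = ennreal (32 powr q * C1) * (\<integral>\<^sup>+l. \<Psi> (s l y) * indicator (ball 0 2) l \<partial>lborel)"
        using C1 by (simp add: ennreal_mult mult.assoc)
      finally show ?thesis .
    qed
    define A where "A = (\<integral>\<^sup>+y. \<Phi> y * indicator (ball 0 (1/16)) y \<partial>lborel)"
    define B where "B = (\<integral>\<^sup>+y. \<Psi> y \<partial>lborel)"
    define D where "D r = emeasure lborel (ball (0::complex) r)" for r
    have shift: "(\<integral>\<^sup>+y. G (s l y) \<partial>lborel) = (\<integral>\<^sup>+y. G y \<partial>lborel)" if "G \<in> borel_measurable borel" for G l
      unfolding s_def by (rule nn_integral_lborel_translate[OF that])
    \<comment> \<open>By translation invariance A may be computed after moving y by any multiple of
      e. Integrating over l and exchanging the integrals makes l the inner variable, to which the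
      one-variable estimate applies.\<close>
    have "A * D (1/2) = (\<integral>\<^sup>+l. A * indicator (ball (0::complex) (1/2)) l \<partial>lborel)"
      by (simp add: nn_integral_cmult_indicator D_def)
    also have "\<dots> = (\<integral>\<^sup>+l. (\<integral>\<^sup>+y. \<Phi> (s l y) * indicator (ball 0 (1/16)) (s l y) * indicator (ball (0::complex) (1/2)) l \<partial>lborel) \<partial>lborel)"
    proof (intro nn_integral_cong)
      fix l :: complex
      have "A = (\<integral>\<^sup>+y. \<Phi> (s l y) * indicator (ball 0 (1/16)) (s l y) \<partial>lborel)"
        unfolding A_def by (rule shift[symmetric]) measurable
      then show "A * indicator (ball 0 (1/2)) l = (\<integral>\<^sup>+y. \<Phi> (s l y) * indicator (ball 0 (1/16)) (s l y) * indicator (ball (0::complex) (1/2)) l \<partial>lborel)"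
        by (simp add: nn_integral_multc)
    qed
    also have "\<dots> = (\<integral>\<^sup>+y. (\<integral>\<^sup>+l. \<Phi> (s l y) * indicator (ball 0 (1/16)) (s l y) * indicator (ball (0::complex) (1/2)) l \<partial>lborel) \<partial>lborel)"
      by (rule lborel_pair.Fubini') measurable
    also have "\<dots> \<le> (\<integral>\<^sup>+y. ennreal (32 powr q * C1) * (\<integral>\<^sup>+l. \<Psi> (s l y) * indicator (ball 0 2) l \<partial>lborel) \<partial>lborel)"
    proof (intro nn_integral_mono)
      fix y :: "complex^'n"
      show "(\<integral>\<^sup>+l. \<Phi> (s l y) * indicator (ball 0 (1/16)) (s l y) * indicator (ball (0::complex) (1/2)) l \<partial>lborel)
         \<le> ennreal (32 powr q * C1) * (\<integral>\<^sup>+l. \<Psi> (s l y) * indicator (ball 0 2) l \<partial>lborel)"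
      proof (cases "norm y < 5/64")
        case True
        have "(\<integral>\<^sup>+l. \<Phi> (s l y) * indicator (ball 0 (1/16)) (s l y) * indicator (ball (0::complex) (1/2)) l \<partial>lborel)
          \<le> (\<integral>\<^sup>+l. \<Phi> (s l y) * indicator (ball 0 (1/2)) l \<partial>lborel)"
          by (intro nn_integral_mono) (simp add: indicator_def)
        also note line[OF True]
        finally show ?thesis .
      next
        case False
        have "\<Phi> (s l y) * indicator (ball 0 (1/16)) (s l y) * indicator (ball (0::complex) (1/2)) l = 0" for l
          using ns'[of y l] False by (auto simp: indicator_def)
        then show ?thesis by (simp only: nn_integral_const mult_zero_left zero_le)
      qed
    qed
    also have "\<dots> = ennreal (32 powr q * C1) * (\<integral>\<^sup>+y. (\<integral>\<^sup>+l. \<Psi> (s l y) * indicator (ball 0 2) l \<partial>lborel) \<partial>lborel)"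
      by (rule nn_integral_cmult) measurable
    also have "(\<integral>\<^sup>+y. (\<integral>\<^sup>+l. \<Psi> (s l y) * indicator (ball 0 2) l \<partial>lborel) \<partial>lborel) = (\<integral>\<^sup>+l. (\<integral>\<^sup>+y. \<Psi> (s l y) * indicator (ball 0 2) l \<partial>lborel) \<partial>lborel)"
      by (rule lborel_pair.Fubini') measurable
    also have "\<dots> = (\<integral>\<^sup>+l. B * indicator (ball (0::complex) 2) l \<partial>lborel)"
      by (intro nn_integral_cong) (simp add: nn_integral_multc shift B_def)
    also have "\<dots> = B * D 2" by (simp add: nn_integral_cmult_indicator D_def)
    finally have AB: "A * D (1/2) \<le> ennreal (32 powr q * C1) * (B * D 2)" .
    have D2: "D 2 = ennreal 16 * D (1/2)"
    proof -
      have "ennreal 16 * ennreal (pi * (1/2)\<^sup>2) = ennreal (16 * (pi * (1/2)\<^sup>2))"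
        by (rule ennreal_mult[symmetric]) simp_all
      moreover have "16 * (pi * (1/2)\<^sup>2) = pi * 2\<^sup>2" by (simp add: power2_eq_square)
      moreover have "emeasure lborel (ball (0::complex) (1/2)) = ennreal (pi * (1/2)\<^sup>2)"
        "emeasure lborel (ball (0::complex) 2) = ennreal (pi * 2\<^sup>2)" by (rule emeasure_complex_ball, simp)+
      ultimately show ?thesis unfolding D_def by (simp only:)
    qed
    have Dn: "D (1/2) \<noteq> 0" "D (1/2) \<noteq> top"
      by (simp_all add: D_def emeasure_complex_ball)
    have "D (1/2) * A \<le> D (1/2) * (ennreal C * B)"
      using AB C1 unfolding D2 C_def by (simp add: ennreal_mult mult_ac)
    then have "A \<le> ennreal C * B" using Dn by (simp add: ennreal_mult_le_mult_iff)
    moreover have "A = (\<integral>\<^sup>+y\<in>ball 0 (1/16). ennreal (cmod (f (z + berg_map z y)) powr (p - q) *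
           cmod (cdiff f (z + berg_map z y) (berg_map z (axis k 1))) powr q) \<partial>lborel)"
      unfolding A_def \<Phi>_def
    proof (intro nn_integral_cong, goal_cases)
      case (1 y)
      show ?case
      proof (cases "y \<in> ball 0 (1/16)")
        case True
        then have "z + berg_map z y \<in> ball 0 1" by (intro berg_map_in_ball z) simp
        then show ?thesis by (simp add: fB_def dB_def v_def e_def)
      qed simp
    qed
    moreover have "B = (\<integral>\<^sup>+y\<in>ball 0 (1/4). ennreal (cmod (f (z + berg_map z y)) powr p) \<partial>lborel)"
      unfolding B_def \<Psi>_def
    proof (intro nn_integral_cong, goal_cases)
      case (1 y)
      show ?case
      proof (cases "y \<in> ball 0 (1/4)")
        case True
        then have "z + berg_map z y \<in> ball 0 1" by (intro berg_map_in_ball z) simp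
        then show ?thesis by (simp add: fB_def)
      qed simp
    qed
    ultimately show ?thesis by simp
  qed
  show ?thesis
  proof (rule that)
    show "C > 0" using C1 by (simp add: C_def)
  qed (rule main)
qed

text \<open>Through the largest summand, which covers q < 1 and q >= 1 alike.\<close>

lemma sum_powr_le:
  fixes a :: "'n::finite \<Rightarrow> real"
  assumes "\<And>k. 0 \<le> a k" "0 < q"
  shows "(\<Sum>k\<in>UNIV. a k) powr q \<le> real CARD('n) powr q * (\<Sum>k\<in>UNIV. a k powr q)"
proof -
  define m where "m = Max (range a)"
  have "m \<in> range a" unfolding m_def by (intro Max_in) auto
  then obtain j where j: "m = a j" by blast
  have "a k \<le> m" for k unfolding m_def by (intro Max_ge) auto
  then have "(\<Sum>k\<in>UNIV. a k) \<le> (\<Sum>k\<in>(UNIV::'n set). m)" by (intro sum_mono)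
  then have "(\<Sum>k\<in>UNIV. a k) powr q \<le> (real CARD('n) * m) powr q"
    using assms by (intro powr_mono2 sum_nonneg) auto
  also have "\<dots> = real CARD('n) powr q * a j powr q" using assms j by (simp add: powr_mult)
  also have "a j powr q \<le> (\<Sum>k\<in>UNIV. a k powr q)" by (rule member_le_sum) auto
  finally show ?thesis by (simp add: mult_left_mono)
qed

text \<open>The local estimate differentiates in a direction that stays fixed as the point moves,
  but the invariant gradient at u uses the frame at u. The frame at z can replace it: vectors of the
  frame at u have coordinates of norm at most 4 in the frame at z, by comparability of the
  metrics.\<close>

lemma inv_grad_norm_frame_bound:
  fixes f :: "complex^'n \<Rightarrow> complex"
  assumes f: "holo_on f (ball 0 1)" and z: "z \<in> ball 0 1" and y: "norm y \<le> 1/4"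
  shows "inv_grad_norm f (z + berg_map z y) \<le> 4 * real CARD('n) * (\<Sum>k\<in>UNIV. cmod (cdiff f (z + berg_map z y) (berg_map z (axis k 1))))"
proof -
  define u where "u = z + berg_map z y"
  have u: "u \<in> ball 0 1" unfolding u_def by (rule berg_map_in_ball[OF z y])
  have "(norm y)\<^sup>2 \<le> (1/4)\<^sup>2" using y by (intro power_mono) auto
  then have close: "berg_sq z (u - z) \<le> 1/16"
    by (simp add: u_def berg_sq_map[OF z] power2_eq_square)
  define S where "S = (\<Sum>k\<in>UNIV. cmod (cdiff f u (berg_map z (axis k 1))))"
  have one: "cmod (cdiff f u (berg_map u (axis j 1))) \<le> 4 * S" for j
  proof -
    define w where "w = berg_inv z (berg_map u (axis j 1))"
    have "(norm w)\<^sup>2 = berg_sq z (berg_map u (axis j 1))" unfolding w_def by (rule norm_berg_inv[OF z])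
    also have "\<dots> \<le> 16 * berg_sq u (berg_map u (axis j 1))" by (rule berg_close(5)[OF z close])
    also have "\<dots> = 4\<^sup>2" by (simp add: berg_sq_map[OF u])
    finally have w4: "norm w \<le> 4" by (rule power2_le_imp_le) simp
    have wk: "cmod (w $ k) \<le> 4" for k using Finite_Cartesian_Product.norm_nth_le[of w k] w4 by linarith
    have "berg_map u (axis j 1) = berg_map z w" unfolding w_def by (simp add: berg_map_inv[OF z])
    also have "\<dots> = (\<Sum>k\<in>UNIV. w$k *s berg_map z (axis k 1))"
      by (subst vec_expansion[of w]) (simp add: linear_sum[OF linear_berg_map] berg_map_cscale)
    finally have "cdiff f u (berg_map u (axis j 1)) = (\<Sum>k\<in>UNIV. w$k * cdiff f u (berg_map z (axis k 1)))"
      by (simp add: cdiff_sum cdiff_cscale)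
    also have "cmod \<dots> \<le> (\<Sum>k\<in>UNIV. cmod (w$k) * cmod (cdiff f u (berg_map z (axis k 1))))"
      by (rule order_trans[OF norm_sum]) (simp add: norm_mult)
    also have "\<dots> \<le> (\<Sum>k\<in>UNIV. 4 * cmod (cdiff f u (berg_map z (axis k 1))))"
      by (intro sum_mono mult_right_mono wk) simp
    finally show ?thesis by (simp add: S_def sum_distrib_left)
  qed
  have "inv_grad_norm f u = L2_set (\<lambda>j. cmod (cdiff f u (berg_map u (axis j 1)))) UNIV"
    by (simp add: inv_grad_norm_eq[OF f u] L2_set_def)
  also have "\<dots> \<le> (\<Sum>j\<in>UNIV. cmod (cdiff f u (berg_map u (axis j 1))))"
    by (rule L2_set_le_sum) simp
  also have "\<dots> \<le> (\<Sum>j\<in>(UNIV::'n set). 4 * S)" by (intro sum_mono one)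
  finally show ?thesis by (simp add: S_def u_def mult_ac)
qed

lemma inv_grad_norm_measurable:
  fixes f :: "complex^'n \<Rightarrow> complex"
  assumes f: "holo_on f (ball 0 1)"
  shows "(\<lambda>z. indicator (ball 0 1) z * inv_grad_norm f z) \<in> borel_measurable borel"
proof -
  have [measurable]: "ball (0::complex^'n) r \<in> sets borel" for r by simp
  have [measurable]: "(\<lambda>z. indicator (ball 0 1) z *\<^sub>R pderiv_c f k z) \<in> borel_measurable borel" for k
    using cdiff_measurable[OF f open_ball, of "axis k 1"] by (simp add: cdiff_axis)
  have [measurable]: "(\<lambda>x. (x::complex^'n) $ k) \<in> borel_measurable borel" for k
    by (intro borel_measurable_continuous_onI continuous_intros)
  have "(\<lambda>z. indicator (ball 0 1) z * inv_grad_norm f z) =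
    (\<lambda>z. indicator (ball 0 1) z * sqrt (\<Sum>k\<in>UNIV. (cmod (\<Sum>j\<in>UNIV. berg_map z (axis k 1) $ j * (indicator (ball 0 1) z *\<^sub>R pderiv_c f j z)))\<^sup>2))"
    by (rule ext) (simp add: indicator_def inv_grad_norm_eq[OF f] cdiff_def)
  also have "\<dots> \<in> borel_measurable borel" by measurable
  finally show ?thesis .
qed

text \<open>The local estimate is sandwiched between \<open>average_lower\<close> with radius 1/16
  and \<open>average_upper\<close>; the former loses (1/64)^d, which is where 64^d comes from. The
  constant is uniform over all admissible weights with the same \<Lambda>, as the truncated weights
  will require.\<close>

lemma wint_inv_grad_le:
  fixes p q \<alpha> \<Lambda> :: real
  assumes p: "p > 0" and q: "0 < q" "q < p + 2"
  obtains C where "C > 0"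
    "\<And>(f :: complex^'n \<Rightarrow> complex) \<omega>. \<lbrakk>holo_on f (ball 0 1); weight_ok \<alpha> \<Lambda> \<omega>\<rbrakk> \<Longrightarrow>
      wint \<omega> (\<lambda>z. ennreal (cmod (f z) powr (p - q) * inv_grad_norm f z powr q))
      \<le> ennreal C * wint \<omega> (\<lambda>z. ennreal (cmod (f z) powr p))"
proof -
  obtain C1 where C1: "C1 > 0" and loc: "\<And>(f :: complex^'n \<Rightarrow> complex) z k. \<lbrakk>holo_on f (ball 0 1); z \<in> ball 0 1\<rbrakk> \<Longrightarrow>
      (\<integral>\<^sup>+y\<in>ball 0 (1/16). ennreal (cmod (f (z + berg_map z y)) powr (p - q) *
           cmod (cdiff f (z + berg_map z y) (berg_map z (axis k 1))) powr q) \<partial>lborel)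
      \<le> ennreal C1 * (\<integral>\<^sup>+y\<in>ball 0 (1/4). ennreal (cmod (f (z + berg_map z y)) powr p) \<partial>lborel)"
    by (rule berg_local_estimate[OF p q], rule that, assumption) blast
  define N where "N = real CARD('n)"
  define d where "d = DIM(complex^'n)"
  \<comment> \<open>(4 N) powr q comes from changing the frame, N powr q from taking the q-th power
    of a sum of N terms.\<close>
  define K where "K = (4 * N) powr q * N powr q"
  \<comment> \<open>The constant is fixed before any weight is given, when the sign of \<Lambda> is
    still unknown; for an actual weight \<Lambda> >= 1.\<close>
  define c where "c = \<bar>\<Lambda>\<bar> * 4 ^ d"
  define C where "C = 64 ^ d * (c * (K * (N * C1) * c)) + 1"
  have c0: "c \<ge> 0" by (simp add: c_def)
  have K0: "K \<ge> 0" by (simp add: K_def)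
  have main: "wint \<omega> (\<lambda>z. ennreal (cmod (f z) powr (p - q) * inv_grad_norm f z powr q))
      \<le> ennreal C * wint \<omega> (\<lambda>z. ennreal (cmod (f z) powr p))"
    if f: "holo_on f (ball 0 1)" and w: "weight_ok \<alpha> \<Lambda> \<omega>" for f :: "complex^'n \<Rightarrow> complex" and \<omega>
  proof -
    let ?V = "uvol TYPE(complex^'n)"
    have cc: "\<Lambda> * 4 ^ DIM(complex^'n) = c" using weight_ok_Lambda_pos[OF w] by (simp add: c_def d_def)
    have [measurable]: "ball (0::complex^'n) r \<in> sets borel" for r by simp
    define fB where "fB u = indicator (ball 0 1) u *\<^sub>R f u" for u
    have [measurable]: "fB \<in> borel_measurable borel" unfolding fB_def by (rule holo_measurable[OF f]) simp
    define gB where "gB u = indicator (ball 0 1) u * inv_grad_norm f u" for u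
    have [measurable]: "gB \<in> borel_measurable borel" unfolding gB_def by (rule inv_grad_norm_measurable[OF f])
    define F where "F u = ennreal (cmod (fB u) powr (p - q) * gB u powr q)" for u
    define P where "P u = ennreal (cmod (fB u) powr p)" for u
    have mF[measurable]: "F \<in> borel_measurable borel" and mP[measurable]: "P \<in> borel_measurable borel"
      unfolding F_def P_def by measurable
    have inner: "(\<integral>\<^sup>+y\<in>ball 0 (1/16). F (z + berg_map z y) \<partial>lborel)
      \<le> ennreal (K * (N * C1)) * (\<integral>\<^sup>+y\<in>ball 0 (1/4). P (z + berg_map z y) \<partial>lborel)" if z: "z \<in> ball 0 1" for z
    proof -
      define T where "T k y = ennreal (cmod (f (z + berg_map z y)) powr (p - q) *
           cmod (cdiff f (z + berg_map z y) (berg_map z (axis k 1))) powr q) * indicator (ball 0 (1/16)) y" for k y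
      have mT: "T k \<in> borel_measurable borel" for k
      proof -
        define dB where "dB u = indicator (ball 0 1) u *\<^sub>R cdiff f u (berg_map z (axis k 1))" for u
        have [measurable]: "dB \<in> borel_measurable borel" unfolding dB_def by (rule cdiff_measurable[OF f]) simp
        have "T k = (\<lambda>y. ennreal (cmod (fB (z + berg_map z y)) powr (p - q) * cmod (dB (z + berg_map z y)) powr q) * indicator (ball 0 (1/16)) y)"
        proof (rule ext)
          fix y
          show "T k y = ennreal (cmod (fB (z + berg_map z y)) powr (p - q) * cmod (dB (z + berg_map z y)) powr q) * indicator (ball 0 (1/16)) y"
            using berg_map_in_ball[OF z, of y] by (cases "y \<in> ball 0 (1/16)") (simp_all add: T_def fB_def dB_def)
        qed
        also have "\<dots> \<in> borel_measurable borel" by measurable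
        finally show ?thesis .
      qed
      have "(\<integral>\<^sup>+y\<in>ball 0 (1/16). F (z + berg_map z y) \<partial>lborel) \<le> (\<integral>\<^sup>+y. ennreal K * (\<Sum>k\<in>UNIV. T k y) \<partial>lborel)"
      proof (intro nn_integral_mono)
        fix y :: "complex^'n"
        show "F (z + berg_map z y) * indicator (ball 0 (1/16)) y \<le> ennreal K * (\<Sum>k\<in>UNIV. T k y)"
        proof (cases "y \<in> ball 0 (1/16)")
          case True
          then have y: "norm y \<le> 1/4" by simp
          define u where "u = z + berg_map z y"
          have u: "u \<in> ball 0 1" unfolding u_def by (rule berg_map_in_ball[OF z y])
          let ?a = "\<lambda>k. cmod (cdiff f u (berg_map z (axis k 1)))"
          have "inv_grad_norm f u powr q \<le> (4 * N * (\<Sum>k\<in>UNIV. ?a k)) powr q"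
            unfolding N_def u_def using q by (intro powr_mono2 inv_grad_norm_frame_bound[OF f z y] inv_grad_norm_nonneg) auto
          also have "\<dots> = (4 * N) powr q * (\<Sum>k\<in>UNIV. ?a k) powr q" by (simp add: powr_mult N_def sum_nonneg)
          also have "\<dots> \<le> (4 * N) powr q * (N powr q * (\<Sum>k\<in>UNIV. ?a k powr q))"
            unfolding N_def by (intro mult_left_mono sum_powr_le) (use q in auto)
          also have "\<dots> = K * (\<Sum>k\<in>UNIV. ?a k powr q)" by (simp add: K_def)
          finally have "cmod (f u) powr (p - q) * inv_grad_norm f u powr q \<le> cmod (f u) powr (p - q) * (K * (\<Sum>k\<in>UNIV. ?a k powr q))"
            by (rule mult_left_mono) simp
          also have "\<dots> = K * (\<Sum>k\<in>UNIV. cmod (f u) powr (p - q) * ?a k powr q)"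
            by (simp add: sum_distrib_left mult_ac)
          finally have "ennreal (cmod (f u) powr (p - q) * inv_grad_norm f u powr q)
             \<le> ennreal (K * (\<Sum>k\<in>UNIV. cmod (f u) powr (p - q) * ?a k powr q))" by (rule ennreal_leI)
          also have "\<dots> = ennreal K * (\<Sum>k\<in>UNIV. ennreal (cmod (f u) powr (p - q) * ?a k powr q))"
          proof -
            have "ennreal (K * (\<Sum>k\<in>UNIV. cmod (f u) powr (p - q) * ?a k powr q))
              = ennreal K * ennreal (\<Sum>k\<in>UNIV. cmod (f u) powr (p - q) * ?a k powr q)"
              by (rule ennreal_mult) (use K0 in \<open>simp_all add: sum_nonneg\<close>)
            also have "ennreal (\<Sum>k\<in>UNIV. cmod (f u) powr (p - q) * ?a k powr q)
              = (\<Sum>k\<in>UNIV. ennreal (cmod (f u) powr (p - q) * ?a k powr q))"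
              by (rule sum_ennreal[symmetric]) simp
            finally show ?thesis .
          qed
          finally show ?thesis using True u by (simp add: T_def F_def fB_def gB_def u_def[symmetric])
        qed (simp add: T_def)
      qed
      also have "\<dots> = ennreal K * (\<Sum>k\<in>UNIV. \<integral>\<^sup>+y. T k y \<partial>lborel)"
        using mT by (simp add: nn_integral_cmult nn_integral_sum)
      also have "\<dots> \<le> ennreal K * (\<Sum>k\<in>(UNIV::'n set). ennreal C1 * (\<integral>\<^sup>+y\<in>ball 0 (1/4). P (z + berg_map z y) \<partial>lborel))"
      proof (intro mult_left_mono sum_mono)
        fix k :: 'n
        have "(\<integral>\<^sup>+y\<in>ball 0 (1/4). P (z + berg_map z y) \<partial>lborel) = (\<integral>\<^sup>+y\<in>ball 0 (1/4). ennreal (cmod (f (z + berg_map z y)) powr p) \<partial>lborel)"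
        proof (intro nn_integral_cong, goal_cases)
          case (1 y)
          then show ?case using berg_map_in_ball[OF z, of y] by (cases "y \<in> ball 0 (1/4)") (simp_all add: P_def fB_def)
        qed
        then show "(\<integral>\<^sup>+y. T k y \<partial>lborel) \<le> ennreal C1 * (\<integral>\<^sup>+y\<in>ball 0 (1/4). P (z + berg_map z y) \<partial>lborel)"
          unfolding T_def using loc[OF f z, of k] by simp
      qed simp
      also have "\<dots> = ennreal (K * (N * C1)) * (\<integral>\<^sup>+y\<in>ball 0 (1/4). P (z + berg_map z y) \<partial>lborel)"
        using K0 C1 by (simp add: N_def ennreal_mult ennreal_of_nat_eq_real_of_nat mult_ac)
      finally show ?thesis .
    qed
    have mI[measurable]: "(\<lambda>z. \<integral>\<^sup>+y\<in>ball 0 (1/4). P (z + berg_map z y) \<partial>lborel) \<in> borel_measurable borel"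
      by measurable
    have "ennreal ((1/64) ^ d) * ?V * wint \<omega> F \<le> ennreal c * wint \<omega> (\<lambda>z. \<integral>\<^sup>+y\<in>ball 0 (1/16). F (z + berg_map z y) \<partial>lborel)"
      using average_lower[OF w mF, of "1/16"] unfolding cc d_def by simp
    also have "\<dots> \<le> ennreal c * wint \<omega> (\<lambda>z. ennreal (K * (N * C1)) * (\<integral>\<^sup>+y\<in>ball 0 (1/4). P (z + berg_map z y) \<partial>lborel))"
      by (intro mult_left_mono wint_mono inner) auto
    also have "\<dots> = ennreal c * (ennreal (K * (N * C1)) * wint \<omega> (\<lambda>z. \<integral>\<^sup>+y\<in>ball 0 (1/4). P (z + berg_map z y) \<partial>lborel))"
      by (subst wint_cmult[OF w]) simp_all
    also have "\<dots> \<le> ennreal c * (ennreal (K * (N * C1)) * (ennreal c * ?V * wint \<omega> P))"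
      using average_upper[OF w mP] unfolding cc by (intro mult_left_mono) auto
    also have "\<dots> = ennreal (c * (K * (N * C1) * c)) * ?V * wint \<omega> P"
      using c0 K0 C1 by (simp add: ennreal_mult N_def mult_ac)
    finally have le: "ennreal ((1/64) ^ d) * ?V * wint \<omega> F \<le> ennreal (c * (K * (N * C1) * c)) * ?V * wint \<omega> P" .
    have "ennreal (64 ^ d) * ennreal ((1/64) ^ d) = ennreal (64 ^ d * (1/64) ^ d)"
      by (rule ennreal_mult[symmetric]) simp_all
    then have one: "ennreal (64 ^ d) * ennreal ((1/64) ^ d) = 1" by (simp add: power_divide)
    have "?V * wint \<omega> F = (ennreal (64 ^ d) * ennreal ((1/64) ^ d)) * (?V * wint \<omega> F)" unfolding one by simp
    also have "\<dots> = ennreal (64 ^ d) * (ennreal ((1/64) ^ d) * ?V * wint \<omega> F)" by (simp only: mult.assoc)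
    also have "\<dots> \<le> ennreal (64 ^ d) * (ennreal (c * (K * (N * C1) * c)) * ?V * wint \<omega> P)"
      by (rule mult_left_mono[OF le]) simp
    also have "\<dots> = ?V * ((ennreal (64 ^ d) * ennreal (c * (K * (N * C1) * c))) * wint \<omega> P)"
      by (simp only: mult_ac)
    also have "ennreal (64 ^ d) * ennreal (c * (K * (N * C1) * c)) = ennreal (64 ^ d * (c * (K * (N * C1) * c)))"
      by (rule ennreal_mult[symmetric]) (use c0 K0 C1 in \<open>simp_all add: N_def\<close>)
    finally have "?V * wint \<omega> F \<le> ?V * (ennreal (64 ^ d * (c * (K * (N * C1) * c))) * wint \<omega> P)" .
    then have "wint \<omega> F \<le> ennreal (64 ^ d * (c * (K * (N * C1) * c))) * wint \<omega> P"
      using uvol_bounds[where 'a="complex^'n"] by (simp add: ennreal_mult_le_mult_iff)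
    also have "\<dots> \<le> ennreal C * wint \<omega> P" by (intro mult_right_mono ennreal_leI) (simp_all add: C_def)
    finally have "wint \<omega> F \<le> ennreal C * wint \<omega> P" .
    moreover have "wint \<omega> F = wint \<omega> (\<lambda>z. ennreal (cmod (f z) powr (p - q) * inv_grad_norm f z powr q))"
      by (rule wint_cong) (simp add: F_def fB_def gB_def)
    moreover have "wint \<omega> P = wint \<omega> (\<lambda>z. ennreal (cmod (f z) powr p))"
      by (rule wint_cong) (simp add: P_def fB_def)
    ultimately show ?thesis by simp
  qed
  show ?thesis
  proof (rule that)
    show "C > 0" unfolding C_def using c0 K0 C1 by (simp add: N_def add_nonneg_pos)
  qed (rule main)
qed

section \<open>Hardy's inequality along rays\<close>

lemma nn_integral_Icc_has_integral:
  fixes g :: "real \<Rightarrow> real"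
  assumes "(g has_integral I) {a..b}" "\<And>t. t \<in> {a..b} \<Longrightarrow> 0 \<le> g t"
    "(\<lambda>t. indicator {a..b} t *\<^sub>R g t) \<in> borel_measurable borel"
  shows "(\<integral>\<^sup>+t\<in>{a..b}. ennreal (g t) \<partial>lborel) = ennreal I"
proof -
  have "((\<lambda>t. if t \<in> {a..b} then g t else 0) has_integral I) UNIV"
    using assms(1) by (simp only: has_integral_restrict_UNIV)
  moreover have "(\<lambda>t. if t \<in> {a..b} then g t else 0) = (\<lambda>t. indicator {a..b} t *\<^sub>R g t)"
    by (rule ext) simp
  ultimately have "((\<lambda>t. indicator {a..b} t *\<^sub>R g t) has_integral I) UNIV" by simp
  from nn_integral_has_integral_lborel[OF assms(3) _ this]
  have "(\<integral>\<^sup>+t. ennreal (indicator {a..b} t *\<^sub>R g t) \<partial>lborel) = ennreal I"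
    using assms(2) by (simp add: indicator_def)
  moreover have "(\<lambda>t. ennreal (indicator {a..b} t *\<^sub>R g t)) = (\<lambda>t. ennreal (g t) * indicator {a..b} t)"
    by (rule ext) (simp add: indicator_def)
  ultimately show ?thesis by simp
qed

text \<open>The antiderivative (t^2 - b^2) powr (\<alpha>+1) / (\<alpha>+1) is continuous up to b
  because \<alpha> > -1. Its derivative may blow up at b, hence the interior form of the fundamental
  theorem.\<close>

lemma nn_integral_power_kernel:
  fixes \<alpha> b :: real
  assumes \<alpha>: "\<alpha> > -1" and b: "0 \<le> b" "b < 1"
  shows "(\<integral>\<^sup>+t\<in>{b..1}. ennreal (2 * t * (t\<^sup>2 - b\<^sup>2) powr \<alpha>) \<partial>lborel) = ennreal ((1 - b\<^sup>2) powr (\<alpha> + 1) / (\<alpha> + 1))"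
proof -
  define F where "F t = (t\<^sup>2 - b\<^sup>2) powr (\<alpha> + 1) / (\<alpha> + 1)" for t
  have sq: "0 \<le> t\<^sup>2 - b\<^sup>2" if "b \<le> t" for t using that b by simp
  have "((\<lambda>t. 2 * t * (t\<^sup>2 - b\<^sup>2) powr \<alpha>) has_integral F 1 - F b) {b..1}"
  proof (rule fundamental_theorem_of_calculus_interior)
    show "continuous_on {b..1} F" unfolding F_def
      using \<alpha> sq by (intro continuous_on_divide continuous_on_powr' continuous_intros) auto
    fix t assume t: "t \<in> {b<..<1}"
    then have pos: "0 < t\<^sup>2 - b\<^sup>2" using b by (simp add: power_strict_mono)
    have "((\<lambda>t. t\<^sup>2 - b\<^sup>2) has_real_derivative 2 * t) (at t)"
      by (auto intro!: derivative_eq_intros)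
    from DERIV_chain2[OF has_real_derivative_powr[OF pos, of "\<alpha> + 1"] this]
    have "((\<lambda>t. (t\<^sup>2 - b\<^sup>2) powr (\<alpha> + 1)) has_real_derivative ((\<alpha> + 1) * (t\<^sup>2 - b\<^sup>2) powr \<alpha>) * (2 * t)) (at t)"
      by simp
    from DERIV_cdivide[OF this, of "\<alpha> + 1"]
    have "(F has_real_derivative 2 * t * (t\<^sup>2 - b\<^sup>2) powr \<alpha>) (at t)"
      unfolding F_def[abs_def] using \<alpha> by (simp add: mult_ac)
    then show "(F has_vector_derivative 2 * t * (t\<^sup>2 - b\<^sup>2) powr \<alpha>) (at t)"
      by (simp add: has_real_derivative_iff_has_vector_derivative)
  qed (use b in simp)
  then have "(\<integral>\<^sup>+t\<in>{b..1}. ennreal (2 * t * (t\<^sup>2 - b\<^sup>2) powr \<alpha>) \<partial>lborel) = ennreal (F 1 - F b)"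
    using b by (intro nn_integral_Icc_has_integral) auto
  also have "F 1 - F b = (1 - b\<^sup>2) powr (\<alpha> + 1) / (\<alpha> + 1)" by (simp add: F_def)
  finally show ?thesis .
qed

text \<open>1 - (b/t)^2 equals (t^2 - b^2)/t^2 and is at most d = 1 - b^2, so monotonicity of
  \<omega> s / s powr \<alpha> reduces the integrand to a power of t^2 - b^2, integrable in closed
  form. As t^2 lies in [1/16, 1], its power costs at most 16 powr |\<alpha>|.\<close>

lemma hardy_kernel_bound:
  fixes \<alpha> \<Lambda> b :: real
  assumes w: "weight_ok \<alpha> \<Lambda> \<omega>" and \<alpha>: "\<alpha> > -1" and b: "0 \<le> b" "b < 1"
  shows "(\<integral>\<^sup>+t\<in>{1/4..1}. ennreal (\<omega> (1 - (b / t)\<^sup>2)) * indicator {t. b < t} t \<partial>lborel)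
    \<le> ennreal (2 * 16 powr \<bar>\<alpha>\<bar> / (\<alpha> + 1)) * ennreal (\<omega> (1 - b\<^sup>2) * (1 - b\<^sup>2))"
proof -
  define d where "d = 1 - b\<^sup>2"
  have "b\<^sup>2 < 1\<^sup>2" using b by (intro power_strict_mono) auto
  then have d: "0 < d" "d \<le> 1" by (auto simp: d_def)
  define K where "K = 2 * 16 powr \<bar>\<alpha>\<bar> * (d powr (-\<alpha>) * \<omega> d)"
  have K0: "K \<ge> 0" using weight_ok_nonneg[OF w] by (simp add: K_def)
  have pt: "\<omega> (1 - (b/t)\<^sup>2) \<le> K * (2 * t * (t\<^sup>2 - b\<^sup>2) powr \<alpha>)" if t: "1/4 \<le> t" "t \<le> 1" "b < t" for t
  proof -
    define s where "s = 1 - (b/t)\<^sup>2"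
    have t0: "t > 0" using t by simp
    have seq: "s = (t\<^sup>2 - b\<^sup>2) / t\<^sup>2" using t0 by (simp add: s_def power_divide field_simps)
    have pos: "t\<^sup>2 - b\<^sup>2 > 0" using t b by (simp add: power_strict_mono)
    have s0: "0 < s" using pos t0 by (simp add: seq)
    have "t\<^sup>2 \<le> 1" using t t0 by (simp add: power_le_one)
    then have "b\<^sup>2 * t\<^sup>2 \<le> b\<^sup>2" by (rule mult_left_le) simp
    then have sd: "s \<le> d" using t0 by (simp add: s_def d_def power_divide field_simps)
    have "\<omega> s * d powr \<alpha> \<le> s powr \<alpha> * \<omega> d"
      by (rule weight_ok_increasing_all[OF w, rule_format]) (use s0 sd d in simp)
    then have "\<omega> s * d powr \<alpha> * d powr (-\<alpha>) \<le> s powr \<alpha> * \<omega> d * d powr (-\<alpha>)"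
      by (rule mult_right_mono) simp
    moreover have "d powr \<alpha> * d powr (-\<alpha>) = 1" using d by (simp flip: powr_add)
    ultimately have 1: "\<omega> s \<le> s powr \<alpha> * (d powr (-\<alpha>) * \<omega> d)" by (simp add: mult_ac)
    have "s powr \<alpha> = (t\<^sup>2 - b\<^sup>2) powr \<alpha> * (t\<^sup>2) powr (-\<alpha>)"
      unfolding seq by (subst powr_divide) (use pos t0 in \<open>simp_all add: powr_minus divide_inverse\<close>)
    also have "(t\<^sup>2) powr (-\<alpha>) \<le> 16 powr \<bar>\<alpha>\<bar>"
    proof (cases "\<alpha> \<ge> 0")
      case True
      have "(1/4)\<^sup>2 \<le> t\<^sup>2" using t by (intro power_mono) auto
      then have "(t\<^sup>2) powr (-\<alpha>) \<le> (1/16) powr (-\<alpha>)" using True by (intro powr_mono2') (auto simp: power2_eq_square)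
      also have "(1/16::real) powr (-\<alpha>) = 16 powr \<alpha>" by (simp add: powr_divide powr_minus inverse_eq_divide)
      finally show ?thesis using True by simp
    next
      case False
      then have "(t\<^sup>2) powr (-\<alpha>) \<le> 1" using \<open>t\<^sup>2 \<le> 1\<close> by (intro powr_le1) auto
      also have "1 \<le> (16::real) powr \<bar>\<alpha>\<bar>" by (intro ge_one_powr_ge_zero) auto
      finally show ?thesis .
    qed
    finally have "s powr \<alpha> \<le> (t\<^sup>2 - b\<^sup>2) powr \<alpha> * 16 powr \<bar>\<alpha>\<bar>" by (simp add: mult_left_mono)
    then have "s powr \<alpha> * (d powr (-\<alpha>) * \<omega> d) \<le> (t\<^sup>2 - b\<^sup>2) powr \<alpha> * 16 powr \<bar>\<alpha>\<bar> * (d powr (-\<alpha>) * \<omega> d)"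
      using weight_ok_nonneg[OF w] by (intro mult_right_mono) auto
    \<comment> \<open>1 <= 4 t supplies the factor t that makes the kernel an exact derivative; 4 t
      = 2 (2 t) explains the 2 in K.\<close>
    also have "\<dots> \<le> (t\<^sup>2 - b\<^sup>2) powr \<alpha> * 16 powr \<bar>\<alpha>\<bar> * (d powr (-\<alpha>) * \<omega> d) * (4 * t)"
      using t weight_ok_nonneg[OF w] mult_left_mono[of 1 "4 * t" "(t\<^sup>2 - b\<^sup>2) powr \<alpha> * 16 powr \<bar>\<alpha>\<bar> * (d powr (-\<alpha>) * \<omega> d)"]
      by simp
    also have "\<dots> = K * (2 * t * (t\<^sup>2 - b\<^sup>2) powr \<alpha>)" by (simp add: K_def mult_ac)
    finally show ?thesis using 1 by (simp add: s_def)
  qed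
  have "(\<integral>\<^sup>+t\<in>{1/4..1}. ennreal (\<omega> (1 - (b / t)\<^sup>2)) * indicator {t. b < t} t \<partial>lborel)
     \<le> (\<integral>\<^sup>+t. ennreal K * (ennreal (2 * t * (t\<^sup>2 - b\<^sup>2) powr \<alpha>) * indicator {b..1} t) \<partial>lborel)"
  proof (intro nn_integral_mono)
    fix t :: real
    show "ennreal (\<omega> (1 - (b / t)\<^sup>2)) * indicator {t. b < t} t * indicator {1/4..1} t
      \<le> ennreal K * (ennreal (2 * t * (t\<^sup>2 - b\<^sup>2) powr \<alpha>) * indicator {b..1} t)"
    proof (cases "b < t \<and> 1/4 \<le> t \<and> t \<le> 1")
      case True
      have "ennreal (\<omega> (1 - (b / t)\<^sup>2)) \<le> ennreal (K * (2 * t * (t\<^sup>2 - b\<^sup>2) powr \<alpha>))"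
        using True by (intro ennreal_leI pt) auto
      also have "\<dots> = ennreal K * ennreal (2 * t * (t\<^sup>2 - b\<^sup>2) powr \<alpha>)"
        by (rule ennreal_mult) (use K0 True in auto)
      finally show ?thesis using True by simp
    next
      case False
      then have "indicator {t. b < t} t * indicator {1/4..1} t = (0::ennreal)" by (auto simp: indicator_def)
      then have z: "ennreal (\<omega> (1 - (b / t)\<^sup>2)) * indicator {t. b < t} t * indicator {1/4..1} t = 0"
        by (simp only: mult.assoc mult_zero_right)
      show ?thesis unfolding z by (rule zero_le)
    qed
  qed
  also have "\<dots> = ennreal K * (\<integral>\<^sup>+t\<in>{b..1}. ennreal (2 * t * (t\<^sup>2 - b\<^sup>2) powr \<alpha>) \<partial>lborel)"
    by (rule nn_integral_cmult) measurable
  also have "\<dots> = ennreal K * ennreal (d powr (\<alpha> + 1) / (\<alpha> + 1))"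
    unfolding nn_integral_power_kernel[OF \<alpha> b] d_def ..
  also have "\<dots> = ennreal (K * (d powr (\<alpha> + 1) / (\<alpha> + 1)))"
    by (rule ennreal_mult[symmetric]) (use K0 \<alpha> in auto)
  also have "K * (d powr (\<alpha> + 1) / (\<alpha> + 1)) = 2 * 16 powr \<bar>\<alpha>\<bar> / (\<alpha> + 1) * (\<omega> d * d)"
  proof -
    have e: "d powr (-\<alpha>) * d powr (\<alpha> + 1) = d" using d by (simp flip: powr_add)
    have "K * (d powr (\<alpha> + 1) / (\<alpha> + 1)) = 2 * 16 powr \<bar>\<alpha>\<bar> / (\<alpha> + 1) * (\<omega> d * (d powr (-\<alpha>) * d powr (\<alpha> + 1)))"
      by (simp add: K_def)
    then show ?thesis by (simp only: e)
  qed
  also have "ennreal (2 * 16 powr \<bar>\<alpha>\<bar> / (\<alpha> + 1) * (\<omega> d * d)) = ennreal (2 * 16 powr \<bar>\<alpha>\<bar> / (\<alpha> + 1)) * ennreal (\<omega> d * d)"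
    by (rule ennreal_mult) (use \<alpha> d weight_ok_nonneg[OF w] in auto)
  finally show ?thesis by (simp add: d_def)
qed

text \<open>For fixed t the substitution y = t z has Jacobian at most 4 powr the real dimension,
  because rays start at t = 1/4. For fixed y the point y/t lies in the ball exactly when t > norm y,
  and the remaining integral in t is the Hardy kernel; it gains one factor of the defect.\<close>

lemma hardy_average:
  fixes H :: "complex^'n \<Rightarrow> ennreal"
  assumes w: "weight_ok \<alpha> \<Lambda> \<omega>" and \<alpha>: "\<alpha> > -1" and H[measurable]: "H \<in> borel_measurable borel"
  shows "wint \<omega> (\<lambda>z. \<integral>\<^sup>+t\<in>{1/4..1}. H (t *\<^sub>R z) \<partial>lborel)
    \<le> ennreal (4 ^ DIM(complex^'n) * (2 * 16 powr \<bar>\<alpha>\<bar> / (\<alpha> + 1))) * wint \<omega> (\<lambda>y. ennreal (defect y) * H y)"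
proof -
  let ?B = "ball 0 1 :: (complex^'n) set"
  let ?k = "2 * 16 powr \<bar>\<alpha>\<bar> / (\<alpha> + 1)"
  let ?D = "ennreal (4 ^ DIM(complex^'n))"
  have [measurable]: "\<omega> \<in> borel_measurable borel" using w by (rule weight_ok_measurable)
  have [measurable]: "?B \<in> sets borel" by simp
  define c where "c z = ennreal (\<omega> (defect z)) * indicator ?B z" for z
  have [measurable]: "c \<in> borel_measurable borel" unfolding c_def by measurable
  have "wint \<omega> (\<lambda>z. \<integral>\<^sup>+t\<in>{1/4..1}. H (t *\<^sub>R z) \<partial>lborel)
    = (\<integral>\<^sup>+z. (\<integral>\<^sup>+t. c z * (H (t *\<^sub>R z) * indicator {1/4..1} t) \<partial>lborel) \<partial>lborel)"
    unfolding wint_def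
  proof (intro nn_integral_cong)
    fix z :: "complex^'n"
    have "ennreal (\<omega> (defect z)) * (\<integral>\<^sup>+t\<in>{1/4..1}. H (t *\<^sub>R z) \<partial>lborel) * indicator ?B z
      = c z * (\<integral>\<^sup>+t\<in>{1/4..1}. H (t *\<^sub>R z) \<partial>lborel)" by (simp only: c_def mult_ac)
    also have "\<dots> = (\<integral>\<^sup>+t. c z * (H (t *\<^sub>R z) * indicator {1/4..1} t) \<partial>lborel)"
      by (rule nn_integral_cmult[symmetric]) measurable
    finally show "ennreal (\<omega> (defect z)) * (\<integral>\<^sup>+t\<in>{1/4..1}. H (t *\<^sub>R z) \<partial>lborel) * indicator ?B z
      = (\<integral>\<^sup>+t. c z * (H (t *\<^sub>R z) * indicator {1/4..1} t) \<partial>lborel)" .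
  qed
  also have "\<dots> = (\<integral>\<^sup>+t. (\<integral>\<^sup>+z. c z * (H (t *\<^sub>R z) * indicator {1/4..1} t) \<partial>lborel) \<partial>lborel)"
    by (rule lborel_pair.Fubini') measurable
  also have "\<dots> \<le> (\<integral>\<^sup>+t. (\<integral>\<^sup>+y. ?D * (c ((1/t) *\<^sub>R y) * H y) * indicator {1/4..1} t \<partial>lborel) \<partial>lborel)"
  proof (rule nn_integral_mono)
    fix t :: real
    show "(\<integral>\<^sup>+z. c z * (H (t *\<^sub>R z) * indicator {1/4..1} t) \<partial>lborel)
      \<le> (\<integral>\<^sup>+y. ?D * (c ((1/t) *\<^sub>R y) * H y) * indicator {1/4..1} t \<partial>lborel)"
    proof (cases "t \<in> {1/4..1}")
      case True
      then have t: "t > 0" "1/4 \<le> t" by auto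
      let ?F = "\<lambda>y. c ((1/t) *\<^sub>R y) * H y"
      have "(\<integral>\<^sup>+y. ?F y \<partial>lborel) = ennreal (\<bar>t\<bar> ^ DIM(complex^'n)) * (\<integral>\<^sup>+z. ?F (0 + t *\<^sub>R z) \<partial>lborel)"
        by (rule nn_integral_lborel_scale) (use t in \<open>measurable, simp\<close>)
      also have "(\<lambda>z. ?F (0 + t *\<^sub>R z)) = (\<lambda>z. c z * H (t *\<^sub>R z))" using t by simp
      finally have eq: "(\<integral>\<^sup>+y. ?F y \<partial>lborel) = ennreal (t ^ DIM(complex^'n)) * (\<integral>\<^sup>+z. c z * H (t *\<^sub>R z) \<partial>lborel)"
        using t by simp
      have "(1::ennreal) \<le> ennreal (4 ^ DIM(complex^'n) * t ^ DIM(complex^'n))"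
      proof -
        have "1 ^ DIM(complex^'n) \<le> (4 * t) ^ DIM(complex^'n)" using t by (intro power_mono) auto
        then have "1 \<le> 4 ^ DIM(complex^'n) * t ^ DIM(complex^'n)" by (simp add: power_mult_distrib)
        then show ?thesis using ennreal_leI by fastforce
      qed
      also have "\<dots> = ?D * ennreal (t ^ DIM(complex^'n))" by (rule ennreal_mult) (use t in auto)
      finally have "1 * (\<integral>\<^sup>+z. c z * H (t *\<^sub>R z) \<partial>lborel) \<le> ?D * ennreal (t ^ DIM(complex^'n)) * (\<integral>\<^sup>+z. c z * H (t *\<^sub>R z) \<partial>lborel)"
        by (rule mult_right_mono) simp
      also have "\<dots> = ?D * (\<integral>\<^sup>+y. ?F y \<partial>lborel)" unfolding eq by (simp only: mult.assoc)
      also have "\<dots> = (\<integral>\<^sup>+y. ?D * ?F y \<partial>lborel)" by (rule nn_integral_cmult[symmetric]) measurable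
      finally show ?thesis using True by simp
    qed simp
  qed
  also have "\<dots> = (\<integral>\<^sup>+y. (\<integral>\<^sup>+t. ?D * (c ((1/t) *\<^sub>R y) * H y) * indicator {1/4..1} t \<partial>lborel) \<partial>lborel)"
    by (rule lborel_pair.Fubini') measurable
  also have "\<dots> \<le> (\<integral>\<^sup>+y. ennreal (4 ^ DIM(complex^'n) * ?k) * (ennreal (\<omega> (defect y)) * (ennreal (defect y) * H y) * indicator ?B y) \<partial>lborel)"
  proof (intro nn_integral_mono)
    fix y :: "complex^'n"
    have ceq: "c ((1/t) *\<^sub>R y) = ennreal (\<omega> (1 - (norm y / t)\<^sup>2)) * indicator {t. norm y < t} t" if "t > 0" for t
      using that by (simp add: c_def defect_def indicator_def field_simps)
    have "(\<integral>\<^sup>+t. ?D * (c ((1/t) *\<^sub>R y) * H y) * indicator {1/4..1} t \<partial>lborel)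
      = (\<integral>\<^sup>+t. (?D * H y) * ((ennreal (\<omega> (1 - (norm y / t)\<^sup>2)) * indicator {t. norm y < t} t) * indicator {1/4..1} t) \<partial>lborel)"
    proof (intro nn_integral_cong)
      fix t :: real
      show "?D * (c ((1/t) *\<^sub>R y) * H y) * indicator {1/4..1} t
        = (?D * H y) * ((ennreal (\<omega> (1 - (norm y / t)\<^sup>2)) * indicator {t. norm y < t} t) * indicator {1/4..1} t)"
        using ceq[of t] by (cases "t \<in> {1/4..1}") (simp_all add: mult_ac)
    qed
    also have "\<dots> = (?D * H y) * (\<integral>\<^sup>+t\<in>{1/4..1}. ennreal (\<omega> (1 - (norm y / t)\<^sup>2)) * indicator {t. norm y < t} t \<partial>lborel)"
      by (rule nn_integral_cmult) measurable
    finally have eq: "(\<integral>\<^sup>+t. ?D * (c ((1/t) *\<^sub>R y) * H y) * indicator {1/4..1} t \<partial>lborel)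
       = (?D * H y) * (\<integral>\<^sup>+t\<in>{1/4..1}. ennreal (\<omega> (1 - (norm y / t)\<^sup>2)) * indicator {t. norm y < t} t \<partial>lborel)" .
    show "(\<integral>\<^sup>+t. ?D * (c ((1/t) *\<^sub>R y) * H y) * indicator {1/4..1} t \<partial>lborel)
       \<le> ennreal (4 ^ DIM(complex^'n) * ?k) * (ennreal (\<omega> (defect y)) * (ennreal (defect y) * H y) * indicator ?B y)"
    proof (cases "y \<in> ?B")
      case True
      have "(?D * H y) * (\<integral>\<^sup>+t\<in>{1/4..1}. ennreal (\<omega> (1 - (norm y / t)\<^sup>2)) * indicator {t. norm y < t} t \<partial>lborel)
         \<le> (?D * H y) * (ennreal ?k * ennreal (\<omega> (1 - (norm y)\<^sup>2) * (1 - (norm y)\<^sup>2)))"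
        using True by (intro mult_left_mono hardy_kernel_bound[OF w \<alpha>]) auto
      also have "ennreal (\<omega> (1 - (norm y)\<^sup>2) * (1 - (norm y)\<^sup>2)) = ennreal (\<omega> (defect y)) * ennreal (defect y)"
        unfolding defect_def[symmetric] using weight_ok_nonneg[OF w] defect_pos[OF True] by (intro ennreal_mult) auto
      also have "(?D * H y) * (ennreal ?k * (ennreal (\<omega> (defect y)) * ennreal (defect y)))
         = (?D * ennreal ?k) * (ennreal (\<omega> (defect y)) * (ennreal (defect y) * H y))" by (simp only: mult_ac)
      also have "?D * ennreal ?k = ennreal (4 ^ DIM(complex^'n) * ?k)" by (rule ennreal_mult[symmetric]) (use \<alpha> in auto)
      finally show ?thesis unfolding eq using True by simp
    next
      case False
      have "(\<integral>\<^sup>+t\<in>{1/4..1}. ennreal (\<omega> (1 - (norm y / t)\<^sup>2)) * indicator {t. norm y < t} t \<partial>lborel) = (\<integral>\<^sup>+t. 0 \<partial>(lborel :: real measure))"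
        using False by (intro nn_integral_cong) (auto simp: indicator_def)
      then show ?thesis unfolding eq by simp
    qed
  qed
  also have "\<dots> = ennreal (4 ^ DIM(complex^'n) * ?k) * wint \<omega> (\<lambda>y. ennreal (defect y) * H y)"
    unfolding wint_def by (rule nn_integral_cmult) measurable
  finally show ?thesis .
qed

text \<open>Where k has no zero, |k| powr p = (k . k) powr (p/2) is differentiable with derivative
  at most p |k| powr (p-1) |k'|. The integral is enlarged to \<open>{a..1}\<close> so that it does
  not depend on c, which later tends to a zero of k.\<close>

lemma cmod_powr_FTC:
  fixes k k' :: "real \<Rightarrow> complex"
  assumes p: "p > 0" and a: "a \<le> c" "c \<le> 1"
    and der: "\<And>t. t \<in> {a..1} \<Longrightarrow> (k has_vector_derivative k' t) (at t)"
    and cont: "continuous_on {a..1} k'"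
    and nz: "\<And>t. t \<in> {c..1} \<Longrightarrow> k t \<noteq> 0"
  shows "ennreal (cmod (k 1) powr p) \<le> ennreal (cmod (k c) powr p) + (\<integral>\<^sup>+t\<in>{a..1}. ennreal (p * cmod (k t) powr (p - 1) * cmod (k' t)) \<partial>lborel)"
proof -
  define g where "g t = p * cmod (k t) powr (p - 1) * cmod (k' t)" for t
  define \<phi>' where "\<phi>' t = (k t \<bullet> k' t + k' t \<bullet> k t) * (p/2 * (k t \<bullet> k t) powr (p/2 - 1))" for t
  have ck: "continuous_on {a..1} k"
    using der has_vector_derivative_continuous continuous_at_imp_continuous_on by (metis (no_types, lifting))
  have kk: "k t \<bullet> k t = (cmod (k t))\<^sup>2" for t by (simp add: dot_square_norm)
  have powk: "(k t \<bullet> k t) powr (p/2) = cmod (k t) powr p" for t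
    unfolding kk using square_powr[of "cmod (k t)" "p/2"] by simp
  have d: "((\<lambda>t. cmod (k t) powr p) has_vector_derivative \<phi>' t) (at t)" if t: "t \<in> {c..1}" for t
  proof -
    have ta: "t \<in> {a..1}" using t a by auto
    have "(k has_derivative (\<lambda>s. s *\<^sub>R k' t)) (at t)" using der[OF ta] by (simp add: has_vector_derivative_def)
    from has_derivative_inner[OF this this]
    have "((\<lambda>t. k t \<bullet> k t) has_derivative (\<lambda>s. s *\<^sub>R (k t \<bullet> k' t + k' t \<bullet> k t))) (at t)"
      by (simp add: distrib_left)
    then have i: "((\<lambda>t. k t \<bullet> k t) has_real_derivative (k t \<bullet> k' t + k' t \<bullet> k t)) (at t)"
      by (simp add: has_field_derivative_def mult_commute_abs)
    have pos: "k t \<bullet> k t > 0" using nz[OF t] by simp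
    from DERIV_chain2[OF has_real_derivative_powr[OF pos, of "p/2"] i]
    have "((\<lambda>t. (k t \<bullet> k t) powr (p/2)) has_real_derivative \<phi>' t) (at t)"
      unfolding \<phi>'_def by (simp only: mult.commute)
    then show ?thesis unfolding powk by (simp add: has_real_derivative_iff_has_vector_derivative)
  qed
  have I1: "(\<phi>' has_integral (cmod (k 1) powr p - cmod (k c) powr p)) {c..1}"
    by (rule fundamental_theorem_of_calculus[OF a(2)]) (rule has_vector_derivative_at_within[OF d])
  have sub: "{c..1} \<subseteq> {a..1}" using a by auto
  have cg: "continuous_on {c..1} g" unfolding g_def
    using nz by (intro continuous_on_mult continuous_on_const continuous_on_powr continuous_on_norm
       continuous_on_subset[OF ck sub] continuous_on_subset[OF cont sub]) auto
  then have I2: "(g has_integral integral {c..1} g) {c..1}"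
    using integrable_continuous_interval has_integral_iff by blast
  have le: "\<phi>' t \<le> g t" if t: "t \<in> {c..1}" for t
  proof -
    have kp: "cmod (k t) > 0" using nz[OF t] by simp
    have "(k t \<bullet> k t) powr (p/2 - 1) = cmod (k t) powr (p - 2)"
      unfolding kk using square_powr[of "cmod (k t)" "p/2 - 1"] by (simp add: algebra_simps)
    then have "\<phi>' t = p * (k t \<bullet> k' t) * cmod (k t) powr (p - 2)" by (simp add: \<phi>'_def inner_commute)
    also have "\<dots> \<le> p * (cmod (k t) * cmod (k' t)) * cmod (k t) powr (p - 2)"
      using p by (intro mult_right_mono mult_left_mono norm_cauchy_schwarz) auto
    also have "\<dots> = p * (cmod (k t) * cmod (k t) powr (p - 2)) * cmod (k' t)" by simp
    also have "cmod (k t) * cmod (k t) powr (p - 2) = cmod (k t) powr (p - 1)"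
      using kp by (simp add: powr_mult_base algebra_simps)
    finally show ?thesis by (simp add: g_def)
  qed
  have "cmod (k 1) powr p - cmod (k c) powr p \<le> integral {c..1} g"
    by (rule has_integral_le[OF I1 I2 le])
  then have "ennreal (cmod (k 1) powr p) \<le> ennreal (cmod (k c) powr p + integral {c..1} g)"
    by (intro ennreal_leI) simp
  also have "\<dots> = ennreal (cmod (k c) powr p) + ennreal (integral {c..1} g)"
  proof (rule ennreal_plus)
    show "0 \<le> integral {c..1} g" using I2 by (rule has_integral_nonneg) (use p in \<open>simp add: g_def\<close>)
  qed simp
  also have "ennreal (integral {c..1} g) = (\<integral>\<^sup>+t\<in>{c..1}. ennreal (g t) \<partial>lborel)"
  proof (rule nn_integral_Icc_has_integral[OF I2, symmetric])
    show "0 \<le> g t" for t using p by (simp add: g_def)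
    show "(\<lambda>t. indicator {c..1} t *\<^sub>R g t) \<in> borel_measurable borel"
      by (rule borel_measurable_continuous_on_indicator[OF _ cg]) simp
  qed
  also have "\<dots> \<le> (\<integral>\<^sup>+t\<in>{a..1}. ennreal (g t) \<partial>lborel)"
    using a by (intro nn_integral_mono) (auto simp: indicator_def)
  finally show ?thesis by (simp add: g_def add_left_mono)
qed

text \<open>For \<open>p < 1\<close> the power \<open>|k| powr p\<close> is not differentiable at the zeros of \<open>k\<close>; only the part of the
  interval after the last zero is used.\<close>

lemma cmod_powr_le_integral:
  fixes k k' :: "real \<Rightarrow> complex"
  assumes p: "p > 0" and a: "a \<le> 1"
    and der: "\<And>t. t \<in> {a..1} \<Longrightarrow> (k has_vector_derivative k' t) (at t)"
    and cont: "continuous_on {a..1} k'"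
  shows "ennreal (cmod (k 1) powr p) \<le> ennreal (cmod (k a) powr p) + (\<integral>\<^sup>+t\<in>{a..1}. ennreal (p * cmod (k t) powr (p - 1) * cmod (k' t)) \<partial>lborel)"
    (is "_ \<le> _ + ?I")
proof (cases "\<exists>t\<in>{a..1}. k t = 0")
  case False
  then show ?thesis by (intro cmod_powr_FTC[OF p order_refl a der cont]) auto
next
  case True
  show ?thesis
  proof (cases "k 1 = 0")
    case k1: False
    have ck: "continuous_on {a..1} k"
      by (intro continuous_at_imp_continuous_on ballI has_vector_derivative_continuous[OF der])
    define Z where "Z = {t \<in> {a..1}. k t = 0}"
    have "closed Z" unfolding Z_def using continuous_closed_preimage_constant[OF ck, of 0] by simp
    moreover have "bounded Z" by (rule bounded_subset[of "{a..1}"]) (auto simp: Z_def)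
    ultimately have "compact Z" by (simp add: compact_eq_bounded_closed)
    moreover have "Z \<noteq> {}" using True by (auto simp: Z_def)
    ultimately obtain t1 where t1: "t1 \<in> Z" and mx: "\<And>t. t \<in> Z \<Longrightarrow> t \<le> t1"
      using compact_attains_sup[of Z] by blast
    have t1': "t1 \<in> {a..1}" "k t1 = 0" using t1 by (auto simp: Z_def)
    then have "t1 \<noteq> 1" using k1 by auto
    then have lt: "t1 < 1" using t1' by simp
    \<comment> \<open>Only starting points t to the right of the last zero t1 are used; as t
      decreases to t1, the term |k t| powr p tends to 0.\<close>
    have step: "ennreal (cmod (k 1) powr p) \<le> ennreal (cmod (k t) powr p) + ?I" if "t1 < t" "t < 1" for t
    proof (rule cmod_powr_FTC[OF p _ _ der cont])
      show "k s \<noteq> 0" if "s \<in> {t..1}" for s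
        using mx[of s] that t1' \<open>t1 < t\<close> by (auto simp: Z_def)
    qed (use that t1' in auto)
    have "isCont k t1" using der[OF t1'(1)] by (rule has_vector_derivative_continuous)
    then have "(k \<longlongrightarrow> k t1) (at_right t1)" by (simp add: isCont_def filterlim_at_split)
    then have "((\<lambda>t. cmod (k t) powr p) \<longlongrightarrow> cmod (k t1) powr p) (at_right t1)"
      using p by (intro tendsto_powr' tendsto_norm tendsto_const) auto
    then have "((\<lambda>t. ennreal (cmod (k t) powr p) + ?I) \<longlongrightarrow> ennreal (cmod (k t1) powr p) + ?I) (at_right t1)"
      by (intro tendsto_add tendsto_ennrealI tendsto_const)
    moreover have "\<forall>\<^sub>F t in at_right t1. ennreal (cmod (k 1) powr p) \<le> ennreal (cmod (k t) powr p) + ?I"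
      unfolding eventually_at_right[OF lt] using step lt by blast
    ultimately have "ennreal (cmod (k 1) powr p) \<le> ennreal (cmod (k t1) powr p) + ?I"
      by (rule tendsto_lowerbound) simp
    also have "\<dots> = ?I" using t1' by simp
    also have "\<dots> \<le> ennreal (cmod (k a) powr p) + ?I" by simp
    finally show ?thesis .
  qed simp
qed

section \<open>Restriction to complex lines through the origin and the ray majorant\<close>

lemma radial_deriv_measurable:
  fixes f :: "complex^'n \<Rightarrow> complex"
  assumes f: "holo_on f (ball 0 1)"
  shows "(\<lambda>z. indicator (ball 0 1) z *\<^sub>R radial_deriv f z) \<in> borel_measurable borel"
proof -
  have [measurable]: "(\<lambda>z. indicator (ball 0 1) z *\<^sub>R pderiv_c f k z) \<in> borel_measurable borel" for k
    using cdiff_measurable[OF f open_ball, of "axis k 1"] by (simp add: cdiff_axis)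
  have [measurable]: "(\<lambda>x. (x::complex^'n) $ k) \<in> borel_measurable borel" for k
    by (intro borel_measurable_continuous_onI continuous_intros)
  have "(\<lambda>z. indicator (ball 0 1) z *\<^sub>R radial_deriv f z) =
    (\<lambda>z. \<Sum>j\<in>UNIV. z $ j * (indicator (ball 0 1) z *\<^sub>R pderiv_c f j z))"
    by (rule ext) (simp add: indicator_def radial_deriv_def)
  also have "\<dots> \<in> borel_measurable borel" by measurable
  finally show ?thesis .
qed

lemma holo_ray:
  assumes f: "holo_on f (ball 0 1)" and l: "l *s z \<in> ball 0 1"
  shows "((\<lambda>l. f (l *s z)) has_field_derivative cdiff f (l *s z) z) (at l)"
  using holo_line_deriv[OF f, of 0 l z] l by simp

lemma radial_deriv_ray: "radial_deriv f (l *s z) = l * cdiff f (l *s z) z"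
  by (simp add: radial_deriv_cdiff cdiff_cscale)

lemma ray_holomorphic:
  assumes f: "holo_on f (ball 0 1)" and z: "norm z * R \<le> 1" "norm z > 0 \<or> R > 0"
  shows "(\<lambda>l. f (l *s z)) holomorphic_on ball 0 R"
    "\<And>l. l \<in> ball 0 R \<Longrightarrow> deriv (\<lambda>l. f (l *s z)) l = cdiff f (l *s z) z"
    "\<And>l. l \<in> ball 0 R \<Longrightarrow> l *s z \<in> ball 0 1"
proof -
  show inb: "l *s z \<in> ball 0 1" if "l \<in> ball 0 R" for l
  proof (cases "z = 0")
    case True then show ?thesis by simp
  next
    case False
    then have "cmod l * norm z < R * norm z" using that by simp
    then show ?thesis using z by (simp add: norm_cscale mult.commute)
  qed
  show "deriv (\<lambda>l. f (l *s z)) l = cdiff f (l *s z) z" if "l \<in> ball 0 R" for l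
    using holo_ray[OF f inb[OF that]] by (rule DERIV_imp_deriv)
  show "(\<lambda>l. f (l *s z)) holomorphic_on ball 0 R"
  proof (rule holomorphic_onI)
    fix l assume "l \<in> ball (0::complex) R"
    then show "(\<lambda>l. f (l *s z)) field_differentiable at l within ball 0 R"
      using holo_ray[OF f inb] field_differentiable_at_within unfolding field_differentiable_def by blast
  qed
qed

text \<open>The first 4 is the reciprocal length of the interval [1/4, 1/2] of starting points on a
  ray; the second bounds 1/t when the derivative along the ray is replaced by the radial
  derivative.\<close>

definition hardy_maj :: "real \<Rightarrow> (complex^'n \<Rightarrow> complex) \<Rightarrow> complex^'n \<Rightarrow> ennreal" where
  "hardy_maj p f y = ennreal (4 * cmod (f y) powr p) * indicator (ball 0 (1/2)) y
     + ennreal (4 * (p * cmod (f y) powr (p - 1) * cmod (radial_deriv f y)))"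

text \<open>|f z| powr p is compared with its value at t z for every t in [1/4, 1/2] and the results
  are averaged. The value at the starting point becomes an integral along the ray, over points in
  the half ball, which \<open>hardy_average\<close> can handle.\<close>

lemma hardy_pointwise:
  fixes f :: "complex^'n \<Rightarrow> complex"
  assumes f: "holo_on f (ball 0 1)" and z: "z \<in> ball 0 1" and p: "p > 0"
  shows "ennreal (cmod (f z) powr p) \<le> (\<integral>\<^sup>+t\<in>{1/4..1}. hardy_maj p f (t *\<^sub>R z) * indicator (ball 0 1) (t *\<^sub>R z) \<partial>lborel)"
proof -
  have z1: "norm z < 1" using z by simp
  have inb: "t *\<^sub>R z \<in> ball 0 1" if "t \<in> {1/4..1}" for t
  proof -
    have "\<bar>t\<bar> * norm z \<le> 1 * norm z" using that by (intro mult_right_mono) auto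
    then show ?thesis using z1 by simp
  qed
  define k where "k t = f (t *\<^sub>R z)" for t
  define k' where "k' t = cdiff f (t *\<^sub>R z) z" for t
  have der: "(k has_vector_derivative k' t) (at t)" if t: "t \<in> {1/4..1}" for t
  proof -
    have "((\<lambda>l. f (l *s z)) has_field_derivative cdiff f (of_real t *s z) z) (at (of_real t))"
      using inb[OF t] by (intro holo_ray[OF f]) (simp add: cscale_of_real)
    from has_vector_derivative_real_field[OF this] show ?thesis
      by (simp add: k_def[abs_def] k'_def cscale_of_real)
  qed
  have cont: "continuous_on {1/4..1} k'"
  proof -
    \<comment> \<open>The ray extends past t = 1 to a complex disc on which f is still holomorphic;
      its derivative is therefore continuous up to t = 1.\<close>
    define R where "R = (if z = 0 then 2 else 1 / norm z)"
    have R: "R > 1" "norm z * R \<le> 1" using z1 by (auto simp: R_def)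
    note hol = ray_holomorphic[OF f R(2)]
    have h: "(\<lambda>l. f (l *s z)) holomorphic_on ball 0 R" using hol(1) R by simp
    have "deriv (\<lambda>l. f (l *s z)) holomorphic_on ball 0 R" using h by (intro holomorphic_deriv) auto
    then have c: "continuous_on (ball 0 R) (deriv (\<lambda>l. f (l *s z)))" by (rule holomorphic_on_imp_continuous_on)
    have "continuous_on {1/4..1} (\<lambda>t. deriv (\<lambda>l. f (l *s z)) (of_real t))"
      by (rule continuous_on_compose2[OF c]) (use R in \<open>auto intro!: continuous_intros\<close>)
    moreover have "deriv (\<lambda>l. f (l *s z)) (of_real t) = k' t" if "t \<in> {1/4..1}" for t
      using hol(2)[of "of_real t"] that R by (simp add: k'_def cscale_of_real)
    ultimately show ?thesis by (rule continuous_on_eq)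
  qed
  define U where "U t = ennreal (cmod (k t) powr p) * indicator {1/4..1/2} t" for t
  define J where "J t = ennreal (4 * (p * cmod (k t) powr (p - 1) * cmod (radial_deriv f (t *\<^sub>R z)))) * indicator {1/4..1} t" for t
  have rd: "cmod (k' t) \<le> 4 * cmod (radial_deriv f (t *\<^sub>R z))" if "t \<in> {1/4..1}" for t
  proof -
    have "radial_deriv f (t *\<^sub>R z) = of_real t * k' t"
      using radial_deriv_ray[of f "of_real t" z] by (simp add: k'_def cscale_of_real)
    then have "4 * cmod (radial_deriv f (t *\<^sub>R z)) = (4 * t) * cmod (k' t)" using that by (simp add: norm_mult)
    moreover have "1 * cmod (k' t) \<le> (4 * t) * cmod (k' t)" using that by (intro mult_right_mono) auto
    ultimately show ?thesis by simp
  qed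
  have step: "ennreal (cmod (k 1) powr p) \<le> ennreal (cmod (k t) powr p) + (\<integral>\<^sup>+t. J t \<partial>lborel)" if t: "t \<in> {1/4..1/2}" for t
  proof -
    have "ennreal (cmod (k 1) powr p) \<le> ennreal (cmod (k t) powr p) + (\<integral>\<^sup>+s\<in>{t..1}. ennreal (p * cmod (k s) powr (p - 1) * cmod (k' s)) \<partial>lborel)"
    proof (rule cmod_powr_le_integral[OF p])
      show "continuous_on {t..1} k'" by (rule continuous_on_subset[OF cont]) (use t in auto)
    qed (use t der in auto)
    also have "(\<integral>\<^sup>+s\<in>{t..1}. ennreal (p * cmod (k s) powr (p - 1) * cmod (k' s)) \<partial>lborel) \<le> (\<integral>\<^sup>+t. J t \<partial>lborel)"
    proof (intro nn_integral_mono)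
      fix s :: real
      show "ennreal (p * cmod (k s) powr (p - 1) * cmod (k' s)) * indicator {t..1} s \<le> J s"
      proof (cases "s \<in> {t..1}")
        case True
        then have s: "s \<in> {1/4..1}" using t by auto
        have "p * cmod (k s) powr (p - 1) * cmod (k' s) \<le> p * cmod (k s) powr (p - 1) * (4 * cmod (radial_deriv f (s *\<^sub>R z)))"
          using p by (intro mult_left_mono rd[OF s]) auto
        then show ?thesis using s True by (simp add: J_def mult_ac ennreal_leI)
      qed simp
    qed
    finally show ?thesis by (simp add: add_left_mono)
  qed
  have mk: "U \<in> borel_measurable borel"
  proof -
    have "continuous_on {1/4..1} k"
      by (intro continuous_at_imp_continuous_on ballI has_vector_derivative_continuous[OF der])
    then have "continuous_on {1/4..1/2} (\<lambda>t. cmod (k t) powr p)"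
      using p by (intro continuous_on_powr' continuous_intros continuous_on_norm) (auto elim: continuous_on_subset)
    then show ?thesis unfolding U_def by (rule borel_measurable_ennreal_indicator) simp
  qed
  let ?K = "\<integral>\<^sup>+t. J t \<partial>lborel"
  have i14: "(\<integral>\<^sup>+t. c * indicator {1/4..1/2} t \<partial>(lborel::real measure)) = c * ennreal (1/4)" for c
    by (simp add: nn_integral_cmult_indicator)
  have "ennreal (cmod (k 1) powr p) * ennreal (1/4) = (\<integral>\<^sup>+t. ennreal (cmod (k 1) powr p) * indicator {1/4..1/2} t \<partial>(lborel::real measure))"
    by (rule i14[symmetric])
  also have "\<dots> \<le> (\<integral>\<^sup>+t. U t + ?K * indicator {1/4..1/2} t \<partial>lborel)"
    using step by (intro nn_integral_mono) (simp add: U_def indicator_def)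
  also have "\<dots> = (\<integral>\<^sup>+t. U t \<partial>lborel) + (\<integral>\<^sup>+t. ?K * indicator {1/4..1/2} t \<partial>(lborel::real measure))"
    by (rule nn_integral_add) (use mk in simp_all)
  also have "\<dots> = (\<integral>\<^sup>+t. U t \<partial>lborel) + ?K * ennreal (1/4)" unfolding i14 ..
  finally have "ennreal 4 * (ennreal (cmod (k 1) powr p) * ennreal (1/4)) \<le> ennreal 4 * ((\<integral>\<^sup>+t. U t \<partial>lborel) + ?K * ennreal (1/4))"
    by (rule mult_left_mono) simp
  moreover have e4: "ennreal 4 * (x * ennreal (1/4)) = x" for x
  proof -
    have "ennreal 4 * (x * ennreal (1/4)) = (ennreal 4 * ennreal (1/4)) * x" by (simp only: mult_ac)
    also have "ennreal 4 * ennreal (1/4) = ennreal (4 * (1/4))" by (rule ennreal_mult[symmetric]) auto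
    finally show ?thesis by simp
  qed
  ultimately have "ennreal (cmod (k 1) powr p) \<le> ennreal 4 * (\<integral>\<^sup>+t. U t \<partial>lborel) + ?K"
    by (simp only: distrib_left e4)
  also have "ennreal 4 * (\<integral>\<^sup>+t. U t \<partial>lborel) = (\<integral>\<^sup>+t. ennreal 4 * U t \<partial>lborel)"
    by (rule nn_integral_cmult[symmetric]) (use mk in simp)
  also have "\<dots> + ?K = (\<integral>\<^sup>+t. ennreal 4 * U t + J t \<partial>lborel)"
  proof (rule nn_integral_add[symmetric])
    define fB where "fB u = indicator (ball 0 1) u *\<^sub>R f u" for u
    have [measurable]: "fB \<in> borel_measurable borel" unfolding fB_def by (rule holo_measurable[OF f]) simp
    define gB where "gB u = indicator (ball 0 1) u *\<^sub>R radial_deriv f u" for u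
    have [measurable]: "gB \<in> borel_measurable borel" unfolding gB_def by (rule radial_deriv_measurable[OF f])
    have "J = (\<lambda>t. ennreal (4 * (p * cmod (fB (t *\<^sub>R z)) powr (p - 1) * cmod (gB (t *\<^sub>R z)))) * indicator {1/4..1} t)"
    proof (rule ext)
      fix t
      show "J t = ennreal (4 * (p * cmod (fB (t *\<^sub>R z)) powr (p - 1) * cmod (gB (t *\<^sub>R z)))) * indicator {1/4..1} t"
        using inb[of t] by (cases "t \<in> {1/4..1}") (simp_all add: J_def fB_def gB_def k_def)
    qed
    also have "\<dots> \<in> borel_measurable borel" by measurable
    finally show "J \<in> borel_measurable lborel" by simp
  qed (use mk in simp)
  also have "\<dots> \<le> (\<integral>\<^sup>+t\<in>{1/4..1}. hardy_maj p f (t *\<^sub>R z) * indicator (ball 0 1) (t *\<^sub>R z) \<partial>lborel)"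
  proof (intro nn_integral_mono)
    fix t :: real
    show "ennreal 4 * U t + J t \<le> hardy_maj p f (t *\<^sub>R z) * indicator (ball 0 1) (t *\<^sub>R z) * indicator {1/4..1} t"
    proof (cases "t \<in> {1/4..1}")
      case True
      have "ennreal 4 * U t \<le> ennreal (4 * cmod (f (t *\<^sub>R z)) powr p) * indicator (ball 0 (1/2)) (t *\<^sub>R z)"
      proof (cases "t \<le> 1/2")
        case t2: True
        have "\<bar>t\<bar> * norm z \<le> 1/2 * norm z" using t2 True by (intro mult_right_mono) auto
        then have "t *\<^sub>R z \<in> ball 0 (1/2)" using z1 by simp
        moreover have "ennreal (4 * cmod (f (t *\<^sub>R z)) powr p) = ennreal 4 * ennreal (cmod (f (t *\<^sub>R z)) powr p)"
          by (rule ennreal_mult) auto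
        ultimately show ?thesis by (simp add: U_def k_def indicator_def)
      next
        case False
        then have "U t = 0" by (simp add: U_def)
        then show ?thesis by simp
      qed
      then show ?thesis using True inb[OF True] by (simp add: hardy_maj_def J_def k_def add_right_mono)
    next
      case False
      then have "U t = 0" "J t = 0" by (auto simp: U_def J_def)
      then show ?thesis by simp
    qed
  qed
  finally show ?thesis by (simp add: k_def)
qed

section \<open>Estimates near the centre through annuli in complex lines\<close>

abbreviation ann :: "complex set" where "ann \<equiv> {l. 1 \<le> cmod l \<and> cmod l \<le> 3/2}"

text \<open>The maximum principle moves the point to the circle of radius 5/4, and the disc of
  radius 1/4 around any point of that circle lies in the annulus. Staying where |l| >= 1 matters
  later: the radial derivative at l z is l times the derivative along the line, so there it
  dominates that derivative.\<close>

lemma annulus_estimate: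
  fixes p :: real
  assumes p: "p > 0"
  obtains C where "C > 0"
    "\<And>k c. \<lbrakk>k holomorphic_on ball 0 2; cmod c \<le> 1\<rbrakk> \<Longrightarrow>
       ennreal (cmod (k c) powr p) \<le> ennreal C * (\<integral>\<^sup>+l\<in>ann. ennreal (cmod (k l) powr p) \<partial>lborel)"
proof -
  obtain C1 where C1: "C1 > 0" and mean: "\<And>h S c r. \<lbrakk>h holomorphic_on S; open S; cball c r \<subseteq> S; r > 0\<rbrakk> \<Longrightarrow>
       ennreal (cmod (h c) powr p * r\<^sup>2) \<le> ennreal C1 * (\<integral>\<^sup>+x\<in>ball c r. ennreal (cmod (h x) powr p) \<partial>lborel)"
    by (rule cmod_powr_le_ball_integral[OF p], rule that)
  have main: "ennreal (cmod (k c) powr p) \<le> ennreal (16 * C1) * (\<integral>\<^sup>+l\<in>ann. ennreal (cmod (k l) powr p) \<partial>lborel)"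
    if k: "k holomorphic_on ball 0 2" and c: "cmod c \<le> 1" for k c
  proof -
    have sub: "cball 0 (5/4) \<subseteq> ball (0::complex) 2" by auto
    have ck: "continuous_on (cball 0 (5/4)) k"
      by (rule continuous_on_subset[OF holomorphic_on_imp_continuous_on[OF k] sub])
    have "continuous_on (sphere 0 (5/4)) (\<lambda>x. cmod (k x))"
      by (intro continuous_on_norm continuous_on_subset[OF ck]) auto
    then obtain m where m: "m \<in> sphere 0 (5/4)" and mx: "\<And>x. x \<in> sphere 0 (5/4) \<Longrightarrow> cmod (k x) \<le> cmod (k m)"
      using continuous_attains_sup[of "sphere (0::complex) (5/4)" "\<lambda>x. cmod (k x)"] by auto
    have "cmod (k c) \<le> cmod (k m)"
    proof (rule maximum_modulus_frontier[of k "cball 0 (5/4)"])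
      show "k holomorphic_on interior (cball 0 (5/4))"
        using k by (rule holomorphic_on_subset) auto
      show "continuous_on (closure (cball 0 (5/4))) k" using ck by simp
      show "cmod (k z) \<le> cmod (k m)" if "z \<in> frontier (cball 0 (5/4))" for z
        using that mx by (simp add: frontier_cball)
    qed (use c in auto)
    then have "ennreal (cmod (k c) powr p) \<le> ennreal (16 * (cmod (k m) powr p * (1/4)\<^sup>2))"
      using p by (intro ennreal_leI) (simp add: power2_eq_square powr_mono2)
    also have "\<dots> = ennreal 16 * ennreal (cmod (k m) powr p * (1/4)\<^sup>2)" by (rule ennreal_mult) auto
    also have "\<dots> \<le> ennreal 16 * (ennreal C1 * (\<integral>\<^sup>+x\<in>ball m (1/4). ennreal (cmod (k x) powr p) \<partial>lborel))"
    proof (intro mult_left_mono mean[OF k open_ball])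
      show "cball m (1/4) \<subseteq> ball 0 2"
      proof
        fix x assume "x \<in> cball m (1/4)"
        then show "x \<in> ball 0 2" using m norm_triangle_ineq[of "x - m" m] by (simp add: dist_norm norm_minus_commute)
      qed
    qed auto
    also have "(\<integral>\<^sup>+x\<in>ball m (1/4). ennreal (cmod (k x) powr p) \<partial>lborel) \<le> (\<integral>\<^sup>+l\<in>ann. ennreal (cmod (k l) powr p) \<partial>lborel)"
    proof (intro nn_integral_mono mult_left_mono)
      fix x :: complex
      have "x \<in> ann" if "x \<in> ball m (1/4)"
        using that m norm_triangle_ineq[of "x - m" m] norm_triangle_ineq[of "m - x" x] by (simp add: dist_norm norm_minus_commute)
      then show "indicator (ball m (1/4)) x \<le> (indicator ann x :: ennreal)"
        by (simp add: indicator_def)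
    qed auto
    also have "ennreal 16 * (ennreal C1 * (\<integral>\<^sup>+l\<in>ann. ennreal (cmod (k l) powr p) \<partial>lborel))
       = ennreal (16 * C1) * (\<integral>\<^sup>+l\<in>ann. ennreal (cmod (k l) powr p) \<partial>lborel)"
      using C1 by (simp add: ennreal_mult mult.assoc)
    finally show ?thesis by (simp add: mult_left_mono)
  qed
  show ?thesis
  proof (rule that)
    show "16 * C1 > 0" using C1 by simp
  qed (rule main)
qed

lemma ann_sets [measurable]: "ann \<in> sets borel"
  by measurable

text \<open>For |l| >= 1 the map z -> l z does not shrink volumes, so each integral over z is at
  most the one over y. The factor 9 pi is the area of the disc of radius 3, which contains the
  annulus.\<close>

lemma dilation_average:
  fixes G :: "complex^'n \<Rightarrow> ennreal"
  assumes G[measurable]: "G \<in> borel_measurable borel" and r: "r > 0"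
  shows "(\<integral>\<^sup>+z\<in>ball 0 r. (\<integral>\<^sup>+l\<in>ann. G (l *s z) \<partial>lborel) \<partial>lborel) \<le> ennreal (9 * pi) * (\<integral>\<^sup>+y\<in>ball 0 (3/2 * r). G y \<partial>lborel)"
proof -
  have [measurable]: "ball (0::complex^'n) s \<in> sets borel" for s by simp
  define G' where "G' y = G y * indicator (ball 0 (3/2 * r)) y" for y
  have [measurable]: "G' \<in> borel_measurable borel" unfolding G'_def by measurable
  have cv: "(\<integral>\<^sup>+z. G' (l *s z) \<partial>lborel) \<le> (\<integral>\<^sup>+y. G' y \<partial>lborel)" if l: "l \<in> ann" for l
  proof -
    have l0: "l \<noteq> 0" using l by auto
    have "(\<integral>\<^sup>+z. G' (l *s z) \<partial>lborel) * uvol TYPE(complex^'n) = emeasure lborel {y::complex^'n. norm (l *s y) < 1} * (\<integral>\<^sup>+y. G' y \<partial>lborel)"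
    proof (rule nn_integral_linear_change[where S="\<lambda>z. inverse l *s z"])
      show "linear (\<lambda>z::complex^'n. l *s z)" "linear (\<lambda>z::complex^'n. inverse l *s z)"
        using bounded_linear_cscale_right bounded_linear.linear by blast+
      show "l *s (inverse l *s x) = x" for x :: "complex^'n" using l0 by (simp add: vec_eq_iff)
    qed measurable
    also have "\<dots> \<le> uvol TYPE(complex^'n) * (\<integral>\<^sup>+y. G' y \<partial>lborel)"
    proof (intro mult_right_mono emeasure_mono subsetI)
      fix y :: "complex^'n" assume "y \<in> {y. norm (l *s y) < 1}"
      then have "cmod l * norm y < 1" by (simp add: norm_cscale)
      moreover have "1 * norm y \<le> cmod l * norm y" using l by (intro mult_right_mono) auto
      ultimately show "y \<in> ball 0 1" by simp
    qed auto
    finally have "uvol TYPE(complex^'n) * (\<integral>\<^sup>+z. G' (l *s z) \<partial>lborel) \<le> uvol TYPE(complex^'n) * (\<integral>\<^sup>+y. G' y \<partial>lborel)"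
      by (simp only: mult.commute)
    then show ?thesis using uvol_bounds[where 'a="complex^'n"] by (simp add: ennreal_mult_le_mult_iff)
  qed
  have "(\<integral>\<^sup>+z\<in>ball 0 r. (\<integral>\<^sup>+l\<in>ann. G (l *s z) \<partial>lborel) \<partial>lborel) \<le> (\<integral>\<^sup>+z. (\<integral>\<^sup>+l. G' (l *s z) * indicator ann l \<partial>lborel) \<partial>lborel)"
  proof (rule nn_integral_mono)
    fix z :: "complex^'n"
    show "(\<integral>\<^sup>+l\<in>ann. G (l *s z) \<partial>lborel) * indicator (ball 0 r) z \<le> (\<integral>\<^sup>+l. G' (l *s z) * indicator ann l \<partial>lborel)"
    proof (cases "z \<in> ball 0 r")
      case True
      have "(\<integral>\<^sup>+l\<in>ann. G (l *s z) \<partial>lborel) \<le> (\<integral>\<^sup>+l. G' (l *s z) * indicator ann l \<partial>lborel)"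
      proof (rule nn_integral_mono)
        fix l :: complex
        show "G (l *s z) * indicator ann l \<le> G' (l *s z) * indicator ann l"
        proof (cases "l \<in> ann")
          case l: True
          have "cmod l * norm z \<le> 3/2 * norm z" using l by (intro mult_right_mono) auto
          then have "l *s z \<in> ball 0 (3/2 * r)" using True by (simp add: norm_cscale)
          then show ?thesis by (simp add: G'_def)
        qed simp
      qed
      then show ?thesis using True by simp
    qed simp
  qed
  also have "\<dots> = (\<integral>\<^sup>+l. (\<integral>\<^sup>+z. G' (l *s z) * indicator ann l \<partial>lborel) \<partial>lborel)"
    by (rule lborel_pair.Fubini') measurable
  also have "\<dots> = (\<integral>\<^sup>+l. (\<integral>\<^sup>+z. G' (l *s z) \<partial>lborel) * indicator ann l \<partial>lborel)"
    by (rule nn_integral_cong) (rule nn_integral_multc, measurable)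
  also have "\<dots> \<le> (\<integral>\<^sup>+l. (\<integral>\<^sup>+y. G' y \<partial>lborel) * indicator ann l \<partial>lborel)"
  proof (rule nn_integral_mono)
    fix l :: complex
    show "(\<integral>\<^sup>+z. G' (l *s z) \<partial>lborel) * indicator ann l \<le> (\<integral>\<^sup>+y. G' y \<partial>lborel) * indicator ann l"
      using cv[of l] by (cases "l \<in> ann") simp_all
  qed
  also have "\<dots> = (\<integral>\<^sup>+y. G' y \<partial>lborel) * emeasure lborel ann"
    by (rule nn_integral_cmult_indicator) simp
  also have "\<dots> \<le> (\<integral>\<^sup>+y. G' y \<partial>lborel) * ennreal (9 * pi)"
  proof (rule mult_left_mono)
    have "emeasure lborel ann \<le> emeasure lborel (ball (0::complex) 3)" by (rule emeasure_mono) auto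
    also have "\<dots> = ennreal (pi * 3\<^sup>2)" by (rule emeasure_complex_ball) simp
    finally show "emeasure lborel ann \<le> ennreal (9 * pi)" by (simp add: mult.commute)
  qed simp
  finally show ?thesis by (simp add: G'_def mult.commute)
qed

text \<open>The annulus estimate at the centre of each complex line, averaged over the z of the half
  ball that spans the line.\<close>

lemma center_estimate:
  fixes p :: real
  assumes p: "p > 0"
  obtains C where "C > 0"
    "\<And>f :: complex^'n \<Rightarrow> complex. holo_on f (ball 0 1) \<Longrightarrow>
       ennreal (cmod (f 0) powr p) \<le> ennreal C * (\<integral>\<^sup>+y\<in>ball 0 (3/4). ennreal (cmod (f y) powr p) \<partial>lborel)"
proof -
  obtain C1 where C1: "C1 > 0" and ann: "\<And>k c. \<lbrakk>k holomorphic_on ball 0 2; cmod c \<le> 1\<rbrakk> \<Longrightarrow>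
       ennreal (cmod (k c) powr p) \<le> ennreal C1 * (\<integral>\<^sup>+l\<in>ann. ennreal (cmod (k l) powr p) \<partial>lborel)"
    by (rule annulus_estimate[OF p], rule that)
  define V where "V = measure lborel (ball (0::complex^'n) (1/2))"
  have eV: "emeasure lborel (ball (0::complex^'n) (1/2)) = ennreal V"
    unfolding V_def using emeasure_lborel_ball_finite[of "0::complex^'n" "1/2"] by (intro emeasure_eq_ennreal_measure) auto
  have V: "V > 0" using eV emeasure_ball_pos[of "1/2" "0::complex^'n"] by (cases "V > 0") (auto simp: ennreal_neg not_less)
  have main: "ennreal (cmod (f 0) powr p) \<le> ennreal (C1 * (9 * pi) / V) * (\<integral>\<^sup>+y\<in>ball 0 (3/4). ennreal (cmod (f y) powr p) \<partial>lborel)"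
    if f: "holo_on f (ball 0 1)" for f :: "complex^'n \<Rightarrow> complex"
  proof -
    have [measurable]: "ball (0::complex^'n) s \<in> sets borel" for s by simp
    define fB where "fB u = indicator (ball 0 1) u *\<^sub>R f u" for u
    have [measurable]: "fB \<in> borel_measurable borel" unfolding fB_def by (rule holo_measurable[OF f]) simp
    define G where "G u = ennreal (cmod (fB u) powr p)" for u
    have mG[measurable]: "G \<in> borel_measurable borel" unfolding G_def by measurable
    have pt: "ennreal (cmod (f 0) powr p) \<le> ennreal C1 * (\<integral>\<^sup>+l\<in>ann. G (l *s z) \<partial>lborel)" if z: "z \<in> ball 0 (1/2)" for z
    proof -
      have z2: "norm z * 2 \<le> 1" using z by simp
      note hol = ray_holomorphic[OF f z2]
      have "ennreal (cmod (f (0 *s z)) powr p) \<le> ennreal C1 * (\<integral>\<^sup>+l\<in>ann. ennreal (cmod (f (l *s z)) powr p) \<partial>lborel)"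
        by (rule ann[of "\<lambda>l. f (l *s z)"]) (use hol(1) in auto)
      also have "(\<integral>\<^sup>+l\<in>ann. ennreal (cmod (f (l *s z)) powr p) \<partial>lborel) = (\<integral>\<^sup>+l\<in>ann. G (l *s z) \<partial>lborel)"
      proof (rule nn_integral_cong)
        fix l :: complex
        show "ennreal (cmod (f (l *s z)) powr p) * indicator ann l = G (l *s z) * indicator ann l"
        proof (cases "l \<in> ann")
          case True
          then have "l *s z \<in> ball 0 1" by (intro hol(3)) auto
          then show ?thesis by (simp add: G_def fB_def)
        qed simp
      qed
      finally show ?thesis by simp
    qed
    have "ennreal (cmod (f 0) powr p) * ennreal V = (\<integral>\<^sup>+z. ennreal (cmod (f 0) powr p) * indicator (ball (0::complex^'n) (1/2)) z \<partial>lborel)"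
      by (simp add: nn_integral_cmult_indicator eV)
    also have "\<dots> \<le> (\<integral>\<^sup>+z. ennreal C1 * ((\<integral>\<^sup>+l\<in>ann. G (l *s z) \<partial>lborel) * indicator (ball 0 (1/2)) z) \<partial>lborel)"
    proof (rule nn_integral_mono)
      fix z :: "complex^'n"
      show "ennreal (cmod (f 0) powr p) * indicator (ball (0::complex^'n) (1/2)) z \<le> ennreal C1 * ((\<integral>\<^sup>+l\<in>ann. G (l *s z) \<partial>lborel) * indicator (ball 0 (1/2)) z)"
        using pt[of z] by (cases "z \<in> ball 0 (1/2)") simp_all
    qed
    also have "\<dots> = ennreal C1 * (\<integral>\<^sup>+z\<in>ball 0 (1/2). (\<integral>\<^sup>+l\<in>ann. G (l *s z) \<partial>lborel) \<partial>lborel)"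
      by (rule nn_integral_cmult) measurable
    also have "\<dots> \<le> ennreal C1 * (ennreal (9 * pi) * (\<integral>\<^sup>+y\<in>ball 0 (3/2 * (1/2)). G y \<partial>lborel))"
      by (intro mult_left_mono dilation_average) auto
    also have "(\<integral>\<^sup>+y\<in>ball 0 (3/2 * (1/2)). G y \<partial>lborel) = (\<integral>\<^sup>+y\<in>ball 0 (3/4). ennreal (cmod (f y) powr p) \<partial>lborel)"
      by (rule nn_integral_cong) (simp add: G_def fB_def indicator_def)
    finally have le: "ennreal (cmod (f 0) powr p) * ennreal V \<le> ennreal C1 * (ennreal (9 * pi) * (\<integral>\<^sup>+y\<in>ball 0 (3/4). ennreal (cmod (f y) powr p) \<partial>lborel))" .
    have "ennreal (1/V) * ennreal V = ennreal (1/V * V)" by (rule ennreal_mult[symmetric]) (use V in auto)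
    then have "ennreal (1/V) * ennreal V = 1" using V by simp
    then have "ennreal (cmod (f 0) powr p) = ennreal (1/V) * (ennreal (cmod (f 0) powr p) * ennreal V)"
      by (metis mult.left_commute mult.right_neutral)
    also have "\<dots> \<le> ennreal (1/V) * (ennreal C1 * (ennreal (9 * pi) * (\<integral>\<^sup>+y\<in>ball 0 (3/4). ennreal (cmod (f y) powr p) \<partial>lborel)))"
      by (rule mult_left_mono[OF le]) simp
    also have "\<dots> = ennreal (C1 * (9 * pi) / V) * (\<integral>\<^sup>+y\<in>ball 0 (3/4). ennreal (cmod (f y) powr p) \<partial>lborel)"
    proof -
      have "ennreal (C1 * (9 * pi) / V) = ennreal (1/V * (C1 * (9 * pi)))" by simp
      also have "\<dots> = ennreal (1/V) * (ennreal C1 * ennreal (9 * pi))"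
        by (subst ennreal_mult, use V C1 in simp, use C1 in simp) (subst ennreal_mult, use C1 in auto)
      finally show ?thesis by (simp only: mult.assoc)
    qed
    finally show ?thesis .
  qed
  show ?thesis
  proof (rule that)
    show "C1 * (9 * pi) / V > 0" using C1 V by simp
  qed (rule main)
qed

text \<open>Either h is constant or its zeros in the disc are finitely many. Radial terms vanish at
  zeros of f by the powr convention although the derivative may not; this makes the loss
  negligible.\<close>

lemma zero_with_nonzero_deriv_null:
  assumes h: "h holomorphic_on ball 0 2"
  shows "AE l in lborel. \<not> (l \<in> cball 0 (3/2) \<and> h l = 0 \<and> deriv h l \<noteq> 0)"
proof -
  have "countable {l \<in> cball 0 (3/2). h l = 0 \<and> deriv h l \<noteq> 0}"
  proof (cases "h constant_on ball 0 2")
    case True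
    then obtain c where c: "\<And>x. x \<in> ball 0 2 \<Longrightarrow> h x = c" by (auto simp: constant_on_def)
    have "deriv h l = 0" if l: "l \<in> ball 0 2" for l
    proof -
      have "((\<lambda>_. c) has_field_derivative 0) (at l)" by simp
      then have "(h has_field_derivative 0) (at l)"
        by (rule has_field_derivative_transform_within_open[OF _ open_ball l]) (simp add: c)
      then show ?thesis by (rule DERIV_imp_deriv)
    qed
    moreover have "cball 0 (3/2) \<subseteq> ball (0::complex) 2" by auto
    ultimately have "{l \<in> cball 0 (3/2). h l = 0 \<and> deriv h l \<noteq> 0} = {}" by blast
    then show ?thesis by (simp only: countable_empty)
  next
    case False
    have "finite {z \<in> cball 0 (3/2). h z = 0}"
      by (rule holomorphic_compact_finite_zeros[OF h open_ball connected_ball compact_cball _ False]) auto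
    then have "finite {l \<in> cball 0 (3/2). h l = 0 \<and> deriv h l \<noteq> 0}"
      by (rule finite_subset[rotated]) auto
    then show ?thesis by (rule countable_finite)
  qed
  then have "{l \<in> cball 0 (3/2). h l = 0 \<and> deriv h l \<noteq> 0} \<in> null_sets lborel"
    by (rule countable_imp_null_set_lborel)
  then show ?thesis by (rule AE_I') auto
qed

text \<open>On the complex line through z, f z differs from f 0 by at most the maximum of |h'| on
  the unit disc. The annulus estimate for h' bounds that maximum by an integral over the annulus,
  where |h'| is dominated by the radial derivative.\<close>

lemma small_ball_estimate:
  fixes p :: real
  assumes p: "p > 0"
  obtains C where "C > 0"
    "\<And>f :: complex^'n \<Rightarrow> complex. holo_on f (ball 0 1) \<Longrightarrow>
       (\<integral>\<^sup>+z\<in>ball 0 (1/2). ennreal (cmod (f z) powr p) \<partial>lborel)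
       \<le> ennreal C * (ennreal (cmod (f 0) powr p) +
           (\<integral>\<^sup>+y\<in>ball 0 (3/4). (if f y = 0 then 0 else ennreal (cmod (radial_deriv f y) powr p)) \<partial>lborel))"
proof -
  obtain C1 where C1: "C1 > 0" and ann: "\<And>k c. \<lbrakk>k holomorphic_on ball 0 2; cmod c \<le> 1\<rbrakk> \<Longrightarrow>
       ennreal (cmod (k c) powr p) \<le> ennreal C1 * (\<integral>\<^sup>+l\<in>ann. ennreal (cmod (k l) powr p) \<partial>lborel)"
    by (rule annulus_estimate[OF p], rule that)
  define V where "V = measure lborel (ball (0::complex^'n) (1/2))"
  have eV: "emeasure lborel (ball (0::complex^'n) (1/2)) = ennreal V"
    unfolding V_def using emeasure_lborel_ball_finite[of "0::complex^'n" "1/2"] by (intro emeasure_eq_ennreal_measure) auto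
  have V: "V \<ge> 0" by (simp add: V_def)
  define C where "C = 2 powr p * (V + C1 * (9 * pi))"
  have main: "(\<integral>\<^sup>+z\<in>ball 0 (1/2). ennreal (cmod (f z) powr p) \<partial>lborel)
       \<le> ennreal C * (ennreal (cmod (f 0) powr p) +
           (\<integral>\<^sup>+y\<in>ball 0 (3/4). (if f y = 0 then 0 else ennreal (cmod (radial_deriv f y) powr p)) \<partial>lborel))"
    if f: "holo_on f (ball 0 1)" for f :: "complex^'n \<Rightarrow> complex"
  proof -
    have [measurable]: "ball (0::complex^'n) s \<in> sets borel" for s by simp
    define fB where "fB u = indicator (ball 0 1) u *\<^sub>R f u" for u
    have [measurable]: "fB \<in> borel_measurable borel" unfolding fB_def by (rule holo_measurable[OF f]) simp
    define gB where "gB u = indicator (ball 0 1) u *\<^sub>R radial_deriv f u" for u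
    have [measurable]: "gB \<in> borel_measurable borel" unfolding gB_def by (rule radial_deriv_measurable[OF f])
    define G where "G u = (if fB u = 0 then 0 else ennreal (cmod (gB u) powr p))" for u
    have mG[measurable]: "G \<in> borel_measurable borel" unfolding G_def by measurable
    let ?f0 = "ennreal (cmod (f 0) powr p)"
    let ?I = "\<lambda>z. (\<integral>\<^sup>+l\<in>ann. G (l *s z) \<partial>lborel)"
    have pt: "ennreal (cmod (f z) powr p) \<le> ennreal (2 powr p) * (?f0 + ennreal C1 * ?I z)" if z: "z \<in> ball 0 (1/2)" for z
    proof -
      have z2: "norm z * 2 \<le> 1" using z by simp
      note hol0 = ray_holomorphic[OF f z2]
      define h where "h l = f (l *s z)" for l
      have h: "h holomorphic_on ball 0 2" using hol0(1) by (simp add: h_def[abs_def])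
      have dh: "deriv h l = cdiff f (l *s z) z" if "l \<in> ball 0 2" for l
        using hol0(2)[OF _ that] unfolding h_def[abs_def] by simp
      have inb: "l *s z \<in> ball 0 1" if "l \<in> ball 0 2" for l using hol0(3)[OF _ that] by simp
      have h': "deriv h holomorphic_on ball 0 2" using h by (intro holomorphic_deriv) auto
      have "continuous_on (cball 0 1) (\<lambda>x. cmod (deriv h x))"
        by (intro continuous_on_norm continuous_on_subset[OF holomorphic_on_imp_continuous_on[OF h']]) auto
      then obtain m where m: "m \<in> cball 0 1" and mx: "\<And>x. x \<in> cball 0 1 \<Longrightarrow> cmod (deriv h x) \<le> cmod (deriv h m)"
        using continuous_attains_sup[of "cball (0::complex) 1" "\<lambda>x. cmod (deriv h x)"] by auto
      have "cmod (h 1 - h 0) \<le> cmod (deriv h m) * cmod (1 - 0)"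
      proof (rule field_differentiable_bound[of "cball 0 1" h "deriv h"])
        show "(h has_field_derivative deriv h x) (at x within cball 0 1)" if "x \<in> cball 0 1" for x
          using holomorphic_derivI[OF h open_ball, of x] that has_field_derivative_at_within by (force simp: subset_iff)
      qed (use mx in auto)
      then have le: "cmod (f z) \<le> cmod (f 0) + cmod (deriv h m)"
        using norm_triangle_ineq2[of "h 1" "h 0"] by (simp add: h_def)
      have "cmod (f z) powr p \<le> 2 powr p * (cmod (f 0) powr p + cmod (deriv h m) powr p)"
      proof -
        define M where "M = max (cmod (f 0)) (cmod (deriv h m))"
        have "cmod (f z) powr p \<le> (2 * M) powr p" using le p by (intro powr_mono2) (auto simp: M_def)
        also have "\<dots> = 2 powr p * M powr p" by (simp add: M_def powr_mult)
        also have "M powr p \<le> cmod (f 0) powr p + cmod (deriv h m) powr p" by (auto simp: M_def max_def)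
        finally show ?thesis by (simp add: mult_left_mono)
      qed
      then have "ennreal (cmod (f z) powr p) \<le> ennreal (2 powr p * (cmod (f 0) powr p + cmod (deriv h m) powr p))"
        by (rule ennreal_leI)
      also have "\<dots> = ennreal (2 powr p) * ennreal (cmod (f 0) powr p + cmod (deriv h m) powr p)"
        by (rule ennreal_mult) auto
      also have "ennreal (cmod (f 0) powr p + cmod (deriv h m) powr p) = ?f0 + ennreal (cmod (deriv h m) powr p)"
        by (rule ennreal_plus) auto
      also have "ennreal (cmod (deriv h m) powr p) \<le> ennreal C1 * (\<integral>\<^sup>+l\<in>ann. ennreal (cmod (deriv h l) powr p) \<partial>lborel)"
        by (rule ann[OF h']) (use m in simp)
      also have "(\<integral>\<^sup>+l\<in>ann. ennreal (cmod (deriv h l) powr p) \<partial>lborel) \<le> ?I z"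
      proof (rule nn_integral_mono_AE)
        show "AE l in lborel. ennreal (cmod (deriv h l) powr p) * indicator ann l \<le> G (l *s z) * indicator ann l"
          using zero_with_nonzero_deriv_null[OF h]
        proof eventually_elim
          case (elim l)
          show ?case
          proof (cases "l \<in> ann")
            case True
            then have l: "l \<in> ball 0 2" by auto
            show ?thesis
            proof (cases "deriv h l = 0")
              case False
              then have hl: "h l \<noteq> 0" using elim True by auto
              have "cmod (deriv h l) * 1 \<le> cmod (deriv h l) * cmod l" using True by (intro mult_left_mono) auto
              also have "\<dots> = cmod (radial_deriv f (l *s z))"
                by (simp add: radial_deriv_ray dh[OF l] norm_mult mult.commute)
              finally have "cmod (deriv h l) powr p \<le> cmod (radial_deriv f (l *s z)) powr p"
                using p by (intro powr_mono2) auto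
              then have "ennreal (cmod (deriv h l) powr p) \<le> ennreal (cmod (radial_deriv f (l *s z)) powr p)" by (rule ennreal_leI)
              then show ?thesis using hl inb[OF l] by (simp add: G_def fB_def gB_def h_def mult_right_mono)
            qed simp
          qed simp
        qed
      qed
      finally show ?thesis by (simp add: mult_left_mono add_left_mono)
    qed
    have "(\<integral>\<^sup>+z\<in>ball 0 (1/2). ennreal (cmod (f z) powr p) \<partial>lborel)
       \<le> (\<integral>\<^sup>+z. ennreal (2 powr p) * (?f0 * indicator (ball 0 (1/2)) z + ennreal C1 * (?I z * indicator (ball 0 (1/2)) z)) \<partial>lborel)"
    proof (rule nn_integral_mono)
      fix z :: "complex^'n"
      show "ennreal (cmod (f z) powr p) * indicator (ball 0 (1/2)) z
        \<le> ennreal (2 powr p) * (?f0 * indicator (ball 0 (1/2)) z + ennreal C1 * (?I z * indicator (ball 0 (1/2)) z))"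
        using pt[of z] by (cases "z \<in> ball 0 (1/2)") simp_all
    qed
    also have "\<dots> = ennreal (2 powr p) * (\<integral>\<^sup>+z. ?f0 * indicator (ball 0 (1/2)) z + ennreal C1 * (?I z * indicator (ball 0 (1/2)) z) \<partial>lborel)"
      by (rule nn_integral_cmult) measurable
    also have "(\<integral>\<^sup>+z. ?f0 * indicator (ball (0::complex^'n) (1/2)) z + ennreal C1 * (?I z * indicator (ball 0 (1/2)) z) \<partial>lborel)
       = (\<integral>\<^sup>+z. ?f0 * indicator (ball (0::complex^'n) (1/2)) z \<partial>lborel) + (\<integral>\<^sup>+z. ennreal C1 * (?I z * indicator (ball 0 (1/2)) z) \<partial>lborel)"
      by (rule nn_integral_add) measurable
    also have "(\<integral>\<^sup>+z. ?f0 * indicator (ball (0::complex^'n) (1/2)) z \<partial>lborel) = ?f0 * ennreal V"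
      by (simp add: nn_integral_cmult_indicator eV)
    also have "(\<integral>\<^sup>+z. ennreal C1 * (?I z * indicator (ball 0 (1/2)) z) \<partial>lborel) = ennreal C1 * (\<integral>\<^sup>+z\<in>ball 0 (1/2). ?I z \<partial>lborel)"
      by (rule nn_integral_cmult) measurable
    also have "(\<integral>\<^sup>+z\<in>ball 0 (1/2). ?I z \<partial>lborel) \<le> ennreal (9 * pi) * (\<integral>\<^sup>+y\<in>ball 0 (3/2 * (1/2)). G y \<partial>lborel)"
      by (rule dilation_average) auto
    also have "(\<integral>\<^sup>+y\<in>ball 0 (3/2 * (1/2)). G y \<partial>lborel) = (\<integral>\<^sup>+y\<in>ball 0 (3/4). (if f y = 0 then 0 else ennreal (cmod (radial_deriv f y) powr p)) \<partial>lborel)"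
      by (rule nn_integral_cong) (simp add: G_def fB_def gB_def indicator_def)
    finally have le: "(\<integral>\<^sup>+z\<in>ball 0 (1/2). ennreal (cmod (f z) powr p) \<partial>lborel)
      \<le> ennreal (2 powr p) * (?f0 * ennreal V + ennreal C1 * (ennreal (9 * pi) *
        (\<integral>\<^sup>+y\<in>ball 0 (3/4). (if f y = 0 then 0 else ennreal (cmod (radial_deriv f y) powr p)) \<partial>lborel)))"
      (is "_ \<le> _ * (_ + _ * (_ * ?R))")
      by (simp add: mult_left_mono add_left_mono)
    have "?f0 * ennreal V + ennreal C1 * (ennreal (9 * pi) * ?R) \<le> ennreal (V + C1 * (9 * pi)) * (?f0 + ?R)"
    proof -
      have "?f0 * ennreal V \<le> ennreal (V + C1 * (9 * pi)) * ?f0"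
        unfolding mult.commute[of ?f0] using C1 by (intro mult_right_mono ennreal_leI) auto
      moreover have "ennreal C1 * (ennreal (9 * pi) * ?R) = ennreal (C1 * (9 * pi)) * ?R"
        using C1 by (simp add: ennreal_mult mult.assoc)
      moreover have "ennreal (C1 * (9 * pi)) * ?R \<le> ennreal (V + C1 * (9 * pi)) * ?R"
        using V by (intro mult_right_mono ennreal_leI) auto
      ultimately show ?thesis unfolding distrib_left by (intro add_mono) simp_all
    qed
    then have "ennreal (2 powr p) * (?f0 * ennreal V + ennreal C1 * (ennreal (9 * pi) * ?R))
       \<le> ennreal (2 powr p) * (ennreal (V + C1 * (9 * pi)) * (?f0 + ?R))" by (rule mult_left_mono) simp
    also have "\<dots> = ennreal C * (?f0 + ?R)"
    proof -
      have "ennreal C = ennreal (2 powr p) * ennreal (V + C1 * (9 * pi))"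
        unfolding C_def by (rule ennreal_mult) (use V C1 in auto)
      then show ?thesis by (simp only: mult.assoc)
    qed
    finally show ?thesis using le by (rule order_trans[rotated])
  qed
  show ?thesis
  proof (rule that)
    show "C > 0" unfolding C_def using V C1 by (intro mult_pos_pos add_nonneg_pos) auto
  qed (rule main)
qed

section \<open>Radial derivatives control the function\<close>

text \<open>For x <= d = e powr (1/b) the constant e already suffices, and for x >= X = e powr
  (-1/(t-b)) the term e x powr t does. In between, x powr b is bounded by X powr b and x powr q is
  bounded below by d powr q.\<close>

lemma powr_interpolation:
  fixes b t q e :: real
  assumes "0 < b" "b < t" "0 < q" "0 < e"
  obtains C where "C \<ge> 0" "\<And>x. 0 \<le> x \<Longrightarrow> x powr b \<le> e * (1 + x powr t) + C * x powr q"
proof -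
  define d where "d = e powr (1/b)"
  define X where "X = e powr (- 1 / (t - b))"
  define C where "C = X powr b / d powr q"
  have d: "d > 0" and X: "X > 0" using assms by (auto simp: d_def X_def)
  have C: "C \<ge> 0" using d X by (simp add: C_def)
  have "x powr b \<le> e * (1 + x powr t) + C * x powr q" if x: "0 \<le> x" for x
  proof -
    consider "x \<le> d" | "x \<ge> X" | "d < x" "x < X" by linarith
    then show ?thesis
    proof cases
      case 1
      have "x powr b \<le> d powr b" using 1 x assms by (intro powr_mono2) auto
      also have "\<dots> = e" using assms by (simp add: d_def powr_powr)
      also have "e \<le> e * (1 + x powr t)" using assms by (simp add: distrib_left)
      finally show ?thesis using C by (simp add: add_increasing2)
    next
      case 2
      then have x0: "x > 0" using X by linarith
      have "x powr b = x powr t * x powr (- (t - b))" by (simp flip: powr_add)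
      also have "\<dots> \<le> x powr t * X powr (- (t - b))"
        using 2 X assms by (intro mult_left_mono powr_mono2') auto
      also have "X powr (- (t - b)) = e"
      proof -
        have inv: "(- 1 / s) * (- s) = 1" if "s \<noteq> 0" for s :: real using that by simp
        have "t - b \<noteq> 0" using assms by simp
        from inv[OF this] have e1: "(- 1 / (t - b)) * (- (t - b)) = 1" .
        show ?thesis unfolding X_def powr_powr e1 using assms by simp
      qed
      finally have "x powr b \<le> e * (1 + x powr t)" using assms by (simp add: distrib_left mult.commute)
      then show ?thesis using C by (simp add: add_increasing2)
    next
      case 3
      have "d powr q \<le> x powr q" using 3 d assms by (intro powr_mono2) auto
      then have "1 \<le> x powr q / d powr q" using d by simp
      then have "X powr b * 1 \<le> X powr b * (x powr q / d powr q)" by (intro mult_left_mono) auto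
      moreover have "x powr b \<le> X powr b" using 3 x assms by (intro powr_mono2) auto
      ultimately have "x powr b \<le> C * x powr q" by (simp add: C_def)
      moreover have "0 \<le> e * (1 + x powr t)" using assms by simp
      ultimately show ?thesis by linarith
    qed
  qed
  then show ?thesis using that[OF C] by blast
qed

text \<open>The integrand of \<open>I2\<close> with its exponent left free: 1, p, p + 1 and q all
  occur.\<close>

definition rad_term :: "real \<Rightarrow> real \<Rightarrow> (complex^'n \<Rightarrow> complex) \<Rightarrow> complex^'n \<Rightarrow> ennreal" where
  "rad_term p b f z = ennreal (cmod (f z) powr (p - b) * (defect z * cmod (radial_deriv f z)) powr b)"

lemma rad_term_measurable:
  fixes f :: "complex^'n \<Rightarrow> complex"
  assumes f: "holo_on f (ball 0 1)"
  shows "(\<lambda>z. rad_term p b f z * indicator (ball 0 1) z) \<in> borel_measurable borel"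
proof -
  have [measurable]: "ball (0::complex^'n) 1 \<in> sets borel" by simp
  define fB where "fB u = indicator (ball 0 1) u *\<^sub>R f u" for u
  have [measurable]: "fB \<in> borel_measurable borel" unfolding fB_def by (rule holo_measurable[OF f]) simp
  define gB where "gB u = indicator (ball 0 1) u *\<^sub>R radial_deriv f u" for u
  have [measurable]: "gB \<in> borel_measurable borel" unfolding gB_def by (rule radial_deriv_measurable[OF f])
  have "(\<lambda>z. rad_term p b f z * indicator (ball 0 1) z) =
    (\<lambda>z. ennreal (cmod (fB z) powr (p - b) * (defect z * cmod (gB z)) powr b) * indicator (ball 0 1) z)"
    by (rule ext) (simp add: rad_term_def fB_def gB_def indicator_def)
  also have "\<dots> \<in> borel_measurable borel" by measurable
  finally show ?thesis .
qed

lemma cmod_powr_measurable: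
  fixes f :: "complex^'n \<Rightarrow> complex"
  assumes f: "holo_on f (ball 0 1)"
  shows "(\<lambda>z. ennreal (cmod (f z) powr p) * indicator (ball 0 1) z) \<in> borel_measurable borel"
proof -
  have [measurable]: "ball (0::complex^'n) 1 \<in> sets borel" by simp
  define fB where "fB u = indicator (ball 0 1) u *\<^sub>R f u" for u
  have [measurable]: "fB \<in> borel_measurable borel" unfolding fB_def by (rule holo_measurable[OF f]) simp
  have "(\<lambda>z. ennreal (cmod (f z) powr p) * indicator (ball 0 1) z) =
    (\<lambda>z. ennreal (cmod (fB z) powr p) * indicator (ball 0 1) z)"
    by (rule ext) (simp add: fB_def indicator_def)
  also have "\<dots> \<in> borel_measurable borel" by measurable
  finally show ?thesis .
qed

lemma rad_term_le_inv_grad: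
  assumes f: "holo_on f (ball 0 1)" and z: "z \<in> ball 0 1" and b: "b > 0"
  shows "rad_term p b f z \<le> ennreal (cmod (f z) powr (p - b) * inv_grad_norm f z powr b)"
proof -
  have d: "defect z > 0" by (rule defect_pos[OF z])
  have "defect z * cmod (radial_deriv f z) \<le> defect z * cgrad_norm f z"
    using d by (intro mult_left_mono radial_le_cgrad[OF z]) auto
  also have "\<dots> \<le> inv_grad_norm f z" by (rule defect_cgrad_le_inv_grad[OF f z])
  finally show ?thesis unfolding rad_term_def
    using d b by (intro ennreal_leI mult_left_mono powr_mono2) auto
qed

lemma defect_three_quarters: "y \<in> ball 0 (3/4) \<Longrightarrow> 1 \<le> 3 * defect y"
proof -
  assume "y \<in> ball 0 (3/4)"
  then have "(norm y)\<^sup>2 \<le> (3/4)\<^sup>2" by (intro power_mono) auto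
  then show ?thesis by (simp add: defect_def power2_eq_square)
qed

text \<open>On this ball the defect is at least 7/16, so it and 1 are within the factor 3 of the
  doubling condition, and \<omega> 1 = 1.\<close>

lemma weight_ok_near_center:
  assumes w: "weight_ok \<alpha> \<Lambda> \<omega>" and y: "y \<in> ball 0 (3/4)"
  shows "\<omega> (defect y) \<le> \<Lambda>" "1 \<le> \<Lambda> * \<omega> (defect y)"
proof -
  have "y \<in> ball 0 1" using y by simp
  then have c: "0 < defect y" "defect y \<le> 1" "1 \<le> 3 * defect y"
    using defect_pos defect_le_1 defect_three_quarters[OF y] by auto
  have "\<omega> (defect y) \<le> \<Lambda> * \<omega> 1"
    by (rule weight_ok_doubling_all[OF w, rule_format]) (use c in auto)
  then show "\<omega> (defect y) \<le> \<Lambda>" by (simp add: weight_ok_1[OF w])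
  have "\<omega> 1 \<le> \<Lambda> * \<omega> (defect y)"
    by (rule weight_ok_doubling_all[OF w, rule_format]) (use c in auto)
  then show "1 \<le> \<Lambda> * \<omega> (defect y)" by (simp add: weight_ok_1[OF w])
qed

text \<open>Near the centre weight and defect can be inserted at the price of \<Lambda> and 3 powr
  p. The case distinction reproduces the value of |f| powr (p - p), which is 0 at zeros of f and 1
  elsewhere.\<close>

lemma radial_small_ball_le:
  fixes f :: "complex^'n \<Rightarrow> complex"
  assumes f: "holo_on f (ball 0 1)" and w: "weight_ok \<alpha> \<Lambda> \<omega>" and p: "p > 0"
  shows "(\<integral>\<^sup>+y\<in>ball 0 (3/4). (if f y = 0 then 0 else ennreal (cmod (radial_deriv f y) powr p)) \<partial>lborel)
     \<le> ennreal (3 powr p * \<Lambda>) * wint \<omega> (rad_term p p f)"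
proof -
  have L: "\<Lambda> \<ge> 0" using weight_ok_Lambda_pos[OF w] by simp
  have "(\<integral>\<^sup>+y\<in>ball 0 (3/4). (if f y = 0 then 0 else ennreal (cmod (radial_deriv f y) powr p)) \<partial>lborel)
    \<le> wint \<omega> (\<lambda>y. ennreal (3 powr p * \<Lambda>) * rad_term p p f y)"
    unfolding wint_def
  proof (rule nn_integral_mono)
    fix y :: "complex^'n"
    show "(if f y = 0 then 0 else ennreal (cmod (radial_deriv f y) powr p)) * indicator (ball 0 (3/4)) y
       \<le> ennreal (\<omega> (defect y)) * (ennreal (3 powr p * \<Lambda>) * rad_term p p f y) * indicator (ball 0 1) y"
    proof (cases "y \<in> ball 0 (3/4) \<and> f y \<noteq> 0")
      case True
      then have y: "y \<in> ball 0 (3/4)" "y \<in> ball 0 1" by auto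
      let ?R = "cmod (radial_deriv f y)"
      have "1 * ?R \<le> (3 * defect y) * ?R" using defect_three_quarters[OF y(1)] by (intro mult_right_mono) auto
      then have "?R powr p \<le> (3 * (defect y * ?R)) powr p" using p by (intro powr_mono2) auto
      also have "\<dots> = 1 * (3 powr p * (defect y * ?R) powr p)" using defect_pos[OF y(2)] by (simp add: powr_mult)
      also have "\<dots> \<le> (\<Lambda> * \<omega> (defect y)) * (3 powr p * (defect y * ?R) powr p)"
        using weight_ok_near_center(2)[OF w y(1)] by (intro mult_right_mono) auto
      finally have "ennreal (?R powr p) \<le> ennreal (\<omega> (defect y) * (3 powr p * \<Lambda> * (defect y * ?R) powr p))"
        by (intro ennreal_leI) (simp add: mult_ac)
      also have "\<dots> = ennreal (\<omega> (defect y)) * ennreal (3 powr p * \<Lambda> * (defect y * ?R) powr p)"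
        by (rule ennreal_mult) (use weight_ok_nonneg[OF w] L in auto)
      also have "ennreal (3 powr p * \<Lambda> * (defect y * ?R) powr p) = ennreal (3 powr p * \<Lambda>) * ennreal ((defect y * ?R) powr p)"
        by (rule ennreal_mult) (use L in auto)
      finally show ?thesis using True y by (simp add: rad_term_def)
    next
      case False
      then have z: "(if f y = 0 then 0 else ennreal (cmod (radial_deriv f y) powr p)) * indicator (ball 0 (3/4)) y = 0"
        by (auto simp: indicator_def)
      show ?thesis unfolding z by (rule zero_le)
    qed
  qed
  also have "\<dots> = ennreal (3 powr p * \<Lambda>) * wint \<omega> (rad_term p p f)"
    by (rule wint_cmult[OF w rad_term_measurable[OF f]])
  finally show ?thesis .
qed

text \<open>The defect gained by \<open>hardy_average\<close> turns |f| powr (p-1) |Rf| into the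
  radial term with exponent 1. The other part of the majorant lives on the half ball, and
  \<open>small_ball_estimate\<close> converts it into f 0 and the radial term with exponent
  p.\<close>

lemma hardy_estimate:
  fixes p \<alpha> \<Lambda> :: real
  assumes p: "p > 0" and \<alpha>: "\<alpha> > -1"
  obtains A where "A > 0"
    "\<And>(f :: complex^'n \<Rightarrow> complex) \<omega>. \<lbrakk>holo_on f (ball 0 1); weight_ok \<alpha> \<Lambda> \<omega>\<rbrakk> \<Longrightarrow>
      wint \<omega> (\<lambda>z. ennreal (cmod (f z) powr p))
      \<le> ennreal A * (ennreal (cmod (f 0) powr p) + wint \<omega> (rad_term p p f) + wint \<omega> (rad_term p 1 f))"
proof -
  obtain C2 where C2: "C2 > 0" and small: "\<And>f :: complex^'n \<Rightarrow> complex. holo_on f (ball 0 1) \<Longrightarrow>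
       (\<integral>\<^sup>+z\<in>ball 0 (1/2). ennreal (cmod (f z) powr p) \<partial>lborel)
       \<le> ennreal C2 * (ennreal (cmod (f 0) powr p) +
           (\<integral>\<^sup>+y\<in>ball 0 (3/4). (if f y = 0 then 0 else ennreal (cmod (radial_deriv f y) powr p)) \<partial>lborel))"
    by (rule small_ball_estimate[OF p], rule that)
  define Kh where "Kh = 4 ^ DIM(complex^'n) * (2 * 16 powr \<bar>\<alpha>\<bar> / (\<alpha> + 1))"
  have Kh: "Kh > 0" using \<alpha> by (simp add: Kh_def)
  define M where "M = 4 * \<bar>\<Lambda>\<bar> * C2 * (1 + 3 powr p * \<bar>\<Lambda>\<bar>) + 4 * p"
  have M: "M > 0" unfolding M_def using p C2 by (intro add_nonneg_pos) auto
  have main: "wint \<omega> (\<lambda>z. ennreal (cmod (f z) powr p))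
      \<le> ennreal (Kh * M) * (ennreal (cmod (f 0) powr p) + wint \<omega> (rad_term p p f) + wint \<omega> (rad_term p 1 f))"
    if f: "holo_on f (ball 0 1)" and w: "weight_ok \<alpha> \<Lambda> \<omega>" for f :: "complex^'n \<Rightarrow> complex" and \<omega>
  proof -
    let ?f0 = "ennreal (cmod (f 0) powr p)"
    let ?Jp = "wint \<omega> (rad_term p p f)" and ?J1 = "wint \<omega> (rad_term p 1 f)"
    have L: "\<Lambda> \<ge> 1" by (rule weight_ok_Lambda_pos[OF w])
    have [measurable]: "ball (0::complex^'n) s \<in> sets borel" for s by simp
    define fB where "fB u = indicator (ball 0 1) u *\<^sub>R f u" for u
    have [measurable]: "fB \<in> borel_measurable borel" unfolding fB_def by (rule holo_measurable[OF f]) simp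
    define gB where "gB u = indicator (ball 0 1) u *\<^sub>R radial_deriv f u" for u
    have [measurable]: "gB \<in> borel_measurable borel" unfolding gB_def by (rule radial_deriv_measurable[OF f])
    define H where "H y = hardy_maj p f y * indicator (ball 0 1) y" for y
    have mH: "H \<in> borel_measurable borel"
    proof -
      have "H = (\<lambda>y. (ennreal (4 * cmod (fB y) powr p) * indicator (ball 0 (1/2)) y
         + ennreal (4 * (p * cmod (fB y) powr (p - 1) * cmod (gB y)))) * indicator (ball 0 1) y)"
        by (rule ext) (simp add: H_def hardy_maj_def fB_def gB_def indicator_def)
      also have "\<dots> \<in> borel_measurable borel" by measurable
      finally show ?thesis .
    qed
    define S where "S z = ennreal (cmod (f z) powr p) * indicator (ball 0 (1/2)) z" for z
    have mS: "(\<lambda>z. S z * indicator (ball 0 1) z) \<in> borel_measurable borel"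
    proof -
      have "(\<lambda>z. S z * indicator (ball 0 1) z) = (\<lambda>y. ennreal (cmod (fB y) powr p) * indicator (ball 0 (1/2)) y * indicator (ball 0 1) y)"
        by (rule ext) (simp add: S_def fB_def indicator_def)
      also have "\<dots> \<in> borel_measurable borel" by measurable
      finally show ?thesis .
    qed
    note mR = rad_term_measurable[OF f, of p 1]
    have "wint \<omega> (\<lambda>z. ennreal (cmod (f z) powr p)) \<le> wint \<omega> (\<lambda>z. \<integral>\<^sup>+t\<in>{1/4..1}. H (t *\<^sub>R z) \<partial>lborel)"
      unfolding H_def by (rule wint_mono) (rule hardy_pointwise[OF f _ p])
    also have "\<dots> \<le> ennreal Kh * wint \<omega> (\<lambda>y. ennreal (defect y) * H y)"
      unfolding Kh_def by (rule hardy_average[OF w \<alpha> mH])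
    also have "wint \<omega> (\<lambda>y. ennreal (defect y) * H y) \<le> wint \<omega> (\<lambda>y. ennreal 4 * S y + ennreal (4 * p) * rad_term p 1 f y)"
    proof (rule wint_mono)
      fix y :: "complex^'n" assume y: "y \<in> ball 0 1"
      note d = defect_pos[OF y]
      let ?R = "cmod (radial_deriv f y)"
      have "ennreal (defect y) * (ennreal (4 * cmod (f y) powr p) * indicator (ball 0 (1/2)) y)
         \<le> 1 * (ennreal (4 * cmod (f y) powr p) * indicator (ball 0 (1/2)) y)"
        using ennreal_leI[OF defect_le_1[of y]] by (intro mult_right_mono) auto
      also have "\<dots> = ennreal 4 * S y" by (simp add: S_def ennreal_mult mult.assoc)
      finally have 1: "ennreal (defect y) * (ennreal (4 * cmod (f y) powr p) * indicator (ball 0 (1/2)) y) \<le> ennreal 4 * S y" .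
      have "ennreal (defect y) * ennreal (4 * (p * cmod (f y) powr (p - 1) * ?R)) = ennreal (defect y * (4 * (p * cmod (f y) powr (p - 1) * ?R)))"
        by (rule ennreal_mult[symmetric]) (use d p in auto)
      also have "defect y * (4 * (p * cmod (f y) powr (p - 1) * ?R)) = (4 * p) * (cmod (f y) powr (p - 1) * (defect y * ?R) powr 1)"
        using d by simp
      also have "ennreal ((4 * p) * (cmod (f y) powr (p - 1) * (defect y * ?R) powr 1)) = ennreal (4 * p) * rad_term p 1 f y"
        unfolding rad_term_def by (rule ennreal_mult) (use p in auto)
      finally have 2: "ennreal (defect y) * ennreal (4 * (p * cmod (f y) powr (p - 1) * ?R)) = ennreal (4 * p) * rad_term p 1 f y" .
      show "ennreal (defect y) * H y \<le> ennreal 4 * S y + ennreal (4 * p) * rad_term p 1 f y"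
        using y 1 by (simp only: H_def hardy_maj_def indicator_simps mult_1_right distrib_left 2) (rule add_right_mono)
    qed
    also have "\<dots> = wint \<omega> (\<lambda>y. ennreal 4 * S y) + wint \<omega> (\<lambda>y. ennreal (4 * p) * rad_term p 1 f y)"
    proof (rule wint_add[OF w])
      show "(\<lambda>z. ennreal 4 * S z * indicator (ball 0 1) z) \<in> borel_measurable borel"
        unfolding mult.assoc by (rule borel_measurable_times_ennreal[OF borel_measurable_const mS])
      show "(\<lambda>z. ennreal (4 * p) * rad_term p 1 f z * indicator (ball 0 1) z) \<in> borel_measurable borel"
        unfolding mult.assoc by (rule borel_measurable_times_ennreal[OF borel_measurable_const mR])
    qed
    also have "wint \<omega> (\<lambda>y. ennreal 4 * S y) = ennreal 4 * wint \<omega> S" by (rule wint_cmult[OF w mS])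
    also have "wint \<omega> (\<lambda>y. ennreal (4 * p) * rad_term p 1 f y) = ennreal (4 * p) * ?J1" by (rule wint_cmult[OF w mR])
    also have "wint \<omega> S \<le> ennreal \<Lambda> * (ennreal C2 * (?f0 + ennreal (3 powr p * \<Lambda>) * ?Jp))"
    proof -
      have mSS: "S \<in> borel_measurable borel"
      proof -
        have "S = (\<lambda>z. S z * indicator (ball 0 1) z)" by (rule ext) (simp add: S_def indicator_def)
        then show ?thesis using mS by simp
      qed
      have "wint \<omega> S \<le> (\<integral>\<^sup>+z. ennreal \<Lambda> * S z \<partial>lborel)"
        unfolding wint_def
      proof (rule nn_integral_mono)
        fix z :: "complex^'n"
        show "ennreal (\<omega> (defect z)) * S z * indicator (ball 0 1) z \<le> ennreal \<Lambda> * S z"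
        proof (cases "z \<in> ball 0 (1/2)")
          case True
          then have "z \<in> ball 0 (3/4)" "z \<in> ball 0 1" by auto
          then show ?thesis using weight_ok_near_center(1)[OF w, of z] by (simp add: mult_right_mono ennreal_leI)
        qed (simp add: S_def)
      qed
      also have "\<dots> = ennreal \<Lambda> * (\<integral>\<^sup>+z. S z \<partial>lborel)" by (rule nn_integral_cmult) (use mSS in simp)
      also have "(\<integral>\<^sup>+z. S z \<partial>lborel) \<le> ennreal C2 * (?f0 + ennreal (3 powr p * \<Lambda>) * ?Jp)"
        unfolding S_def by (rule order_trans[OF small[OF f]]) (intro mult_left_mono add_left_mono radial_small_ball_le[OF f w p], simp)
      finally show ?thesis by (simp add: mult_left_mono)
    qed
    finally have le: "wint \<omega> (\<lambda>z. ennreal (cmod (f z) powr p))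
      \<le> ennreal Kh * (ennreal 4 * (ennreal \<Lambda> * (ennreal C2 * (?f0 + ennreal (3 powr p * \<Lambda>) * ?Jp))) + ennreal (4 * p) * ?J1)"
      by (simp add: mult_left_mono add_right_mono)
    have "ennreal 4 * (ennreal \<Lambda> * (ennreal C2 * (?f0 + ennreal (3 powr p * \<Lambda>) * ?Jp))) + ennreal (4 * p) * ?J1
       \<le> ennreal M * (?f0 + ?Jp + ?J1)"
    proof -
      define m where "m = 4 * \<Lambda> * C2"
      have m: "m \<ge> 0" using L C2 by (simp add: m_def)
      have "ennreal 4 * (ennreal \<Lambda> * (ennreal C2 * (?f0 + ennreal (3 powr p * \<Lambda>) * ?Jp)))
        = ennreal m * ?f0 + ennreal (m * (3 powr p * \<Lambda>)) * ?Jp"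
      proof -
        have "ennreal m = ennreal 4 * ennreal \<Lambda> * ennreal C2" unfolding m_def using L C2 by (simp add: ennreal_mult)
        moreover have "ennreal (m * (3 powr p * \<Lambda>)) = ennreal m * ennreal (3 powr p * \<Lambda>)"
          by (rule ennreal_mult) (use m L in auto)
        ultimately show ?thesis by (simp only: distrib_left mult.assoc)
      qed
      moreover have "ennreal m * ?f0 \<le> ennreal M * ?f0"
        using L C2 p by (intro mult_right_mono ennreal_leI) (auto simp: M_def m_def distrib_left)
      moreover have "ennreal (m * (3 powr p * \<Lambda>)) * ?Jp \<le> ennreal M * ?Jp"
        using L C2 p by (intro mult_right_mono ennreal_leI) (auto simp: M_def m_def distrib_left)
      moreover have "ennreal (4 * p) * ?J1 \<le> ennreal M * ?J1"
        using L C2 p by (intro mult_right_mono ennreal_leI) (auto simp: M_def)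
      ultimately show ?thesis unfolding distrib_left by (simp only:) (intro add_mono)
    qed
    then have "ennreal Kh * (ennreal 4 * (ennreal \<Lambda> * (ennreal C2 * (?f0 + ennreal (3 powr p * \<Lambda>) * ?Jp))) + ennreal (4 * p) * ?J1)
       \<le> ennreal Kh * (ennreal M * (?f0 + ?Jp + ?J1))" by (rule mult_left_mono) simp
    also have "\<dots> = ennreal (Kh * M) * (?f0 + ?Jp + ?J1)"
      using Kh M by (simp add: ennreal_mult mult.assoc)
    finally show ?thesis using le by (rule order_trans[rotated])
  qed
  show ?thesis
  proof (rule that)
    show "Kh * M > 0" using Kh M by simp
  qed (rule main)
qed

text \<open>The scalar inequality at x = d |Rf| / |f|, with d = \<open>defect z\<close>, multiplied
  by |f| powr p; at zeros of f the left side is 0.\<close>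

lemma rad_term_interpolation:
  assumes C: "C \<ge> 0" "\<And>x. 0 \<le> x \<Longrightarrow> x powr b \<le> e * (1 + x powr t) + C * x powr q" and e: "e \<ge> 0"
    and z: "z \<in> ball 0 1"
  shows "rad_term p b f z \<le> ennreal e * (ennreal (cmod (f z) powr p) + rad_term p t f z) + ennreal C * rad_term p q f z"
proof (cases "f z = 0")
  case False
  define x where "x = defect z * cmod (radial_deriv f z) / cmod (f z)"
  have x: "x \<ge> 0" using defect_pos[OF z] by (simp add: x_def)
  have eq: "cmod (f z) powr (p - c) * (defect z * cmod (radial_deriv f z)) powr c = cmod (f z) powr p * x powr c" for c
  proof -
    have "defect z * cmod (radial_deriv f z) = cmod (f z) * x" using False by (simp add: x_def)
    then have "(defect z * cmod (radial_deriv f z)) powr c = cmod (f z) powr c * x powr c" using x by (simp add: powr_mult)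
    then show ?thesis using False by (simp add: powr_diff)
  qed
  have "cmod (f z) powr p * x powr b \<le> cmod (f z) powr p * (e * (1 + x powr t) + C * x powr q)"
    by (intro mult_left_mono C(2) x) auto
  also have "\<dots> = e * (cmod (f z) powr p + cmod (f z) powr p * x powr t) + C * (cmod (f z) powr p * x powr q)"
    by (simp add: algebra_simps)
  finally have "rad_term p b f z \<le> ennreal (e * (cmod (f z) powr p + cmod (f z) powr p * x powr t) + C * (cmod (f z) powr p * x powr q))"
    unfolding rad_term_def eq by (rule ennreal_leI)
  also have "\<dots> = ennreal (e * (cmod (f z) powr p + cmod (f z) powr p * x powr t)) + ennreal (C * (cmod (f z) powr p * x powr q))"
    by (rule ennreal_plus) (use e C in auto)
  also have "ennreal (C * (cmod (f z) powr p * x powr q)) = ennreal C * rad_term p q f z"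
    unfolding rad_term_def eq by (rule ennreal_mult) (use C in auto)
  also have "ennreal (e * (cmod (f z) powr p + cmod (f z) powr p * x powr t)) = ennreal e * ennreal (cmod (f z) powr p + cmod (f z) powr p * x powr t)"
    by (rule ennreal_mult) (use e in auto)
  also have "ennreal (cmod (f z) powr p + cmod (f z) powr p * x powr t) = ennreal (cmod (f z) powr p) + rad_term p t f z"
    unfolding rad_term_def eq by (rule ennreal_plus) auto
  finally show ?thesis .
qed (simp add: rad_term_def)

text \<open>Finiteness of the left-hand integral is needed to absorb it into itself.\<close>

lemma apriori_estimate:
  fixes p q \<alpha> \<Lambda> :: real
  assumes p: "p > 0" and \<alpha>: "\<alpha> > -1" and q: "0 < q"
  obtains C where "C > 0"
    "\<And>(f :: complex^'n \<Rightarrow> complex) \<omega>. \<lbrakk>holo_on f (ball 0 1); weight_ok \<alpha> \<Lambda> \<omega>; wint \<omega> (\<lambda>z. ennreal (cmod (f z) powr p)) < top\<rbrakk> \<Longrightarrow>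
      wint \<omega> (\<lambda>z. ennreal (cmod (f z) powr p)) \<le> ennreal C * (ennreal (cmod (f 0) powr p) + wint \<omega> (rad_term p q f))"
proof -
  \<comment> \<open>Interpolation needs t above both 1 and p, the upper estimate needs t < p +
    2.\<close>
  define t where "t = p + 1"
  have t: "0 < t" "t < p + 2" "1 < t" "p < t" using p by (auto simp: t_def)
  obtain C1 where C1: "C1 > 0" and up: "\<And>(f :: complex^'n \<Rightarrow> complex) \<omega>. \<lbrakk>holo_on f (ball 0 1); weight_ok \<alpha> \<Lambda> \<omega>\<rbrakk> \<Longrightarrow>
      wint \<omega> (\<lambda>z. ennreal (cmod (f z) powr (p - t) * inv_grad_norm f z powr t))
      \<le> ennreal C1 * wint \<omega> (\<lambda>z. ennreal (cmod (f z) powr p))"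
    by (rule wint_inv_grad_le[OF p t(1) t(2), of \<alpha> \<Lambda>], rule that)
  obtain A where A: "A > 0" and hardy: "\<And>(f :: complex^'n \<Rightarrow> complex) \<omega>. \<lbrakk>holo_on f (ball 0 1); weight_ok \<alpha> \<Lambda> \<omega>\<rbrakk> \<Longrightarrow>
      wint \<omega> (\<lambda>z. ennreal (cmod (f z) powr p))
      \<le> ennreal A * (ennreal (cmod (f 0) powr p) + wint \<omega> (rad_term p p f) + wint \<omega> (rad_term p 1 f))"
    by (rule hardy_estimate[OF p \<alpha>, of \<Lambda>], rule that)
  \<comment> \<open>Each of the two interpolated terms contributes A e (1 + C1) X, so together they
    amount to X/2.\<close>
  define e where "e = 1 / (4 * A * (1 + C1))"
  have e: "e > 0" using A C1 by (simp add: e_def)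
  obtain D1 where D1: "D1 \<ge> 0" "\<And>x. 0 \<le> x \<Longrightarrow> x powr 1 \<le> e * (1 + x powr t) + D1 * x powr q"
    by (rule powr_interpolation[of 1 t q e]) (use t q e in auto)
  obtain D2 where D2: "D2 \<ge> 0" "\<And>x. 0 \<le> x \<Longrightarrow> x powr p \<le> e * (1 + x powr t) + D2 * x powr q"
    by (rule powr_interpolation[of p t q e]) (use t p q e in auto)
  define C where "C = 2 * A * (1 + D1 + D2)"
  have main: "wint \<omega> (\<lambda>z. ennreal (cmod (f z) powr p)) \<le> ennreal C * (ennreal (cmod (f 0) powr p) + wint \<omega> (rad_term p q f))"
    if f: "holo_on f (ball 0 1)" and w: "weight_ok \<alpha> \<Lambda> \<omega>" and fin: "wint \<omega> (\<lambda>z. ennreal (cmod (f z) powr p)) < top"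
    for f :: "complex^'n \<Rightarrow> complex" and \<omega>
  proof (cases "wint \<omega> (rad_term p q f) = top")
    case True
    have "C > 0" unfolding C_def using A D1 D2 by (intro mult_pos_pos) auto
    then show ?thesis unfolding True by (simp add: ennreal_mult_top)
  next
    case False
    define X where "X = enn2real (wint \<omega> (\<lambda>z. ennreal (cmod (f z) powr p)))"
    have X: "wint \<omega> (\<lambda>z. ennreal (cmod (f z) powr p)) = ennreal X" "X \<ge> 0"
      using fin by (auto simp: X_def)
    define J where "J = enn2real (wint \<omega> (rad_term p q f))"
    have J: "wint \<omega> (rad_term p q f) = ennreal J" "J \<ge> 0"
      using False by (auto simp: J_def less_top)
    define u where "u = cmod (f 0) powr p"
    have Jt: "wint \<omega> (rad_term p t f) \<le> ennreal (C1 * X)"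
    proof -
      have "wint \<omega> (rad_term p t f) \<le> wint \<omega> (\<lambda>z. ennreal (cmod (f z) powr (p - t) * inv_grad_norm f z powr t))"
        by (rule wint_mono) (rule rad_term_le_inv_grad[OF f _ t(1)])
      also have "\<dots> \<le> ennreal C1 * ennreal X" using up[OF f w] unfolding X(1) .
      also have "\<dots> = ennreal (C1 * X)" by (rule ennreal_mult[symmetric]) (use C1 X in auto)
      finally show ?thesis .
    qed
    have Jb: "wint \<omega> (rad_term p b f) \<le> ennreal (e * (X + C1 * X) + D * J)"
      if D: "D \<ge> 0" "\<And>x. 0 \<le> x \<Longrightarrow> x powr b \<le> e * (1 + x powr t) + D * x powr q" for b D
    proof -
      note m1 = cmod_powr_measurable[OF f, of p] and m2 = rad_term_measurable[OF f, of p t] and m3 = rad_term_measurable[OF f, of p q]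
      have m12: "(\<lambda>z. (ennreal (cmod (f z) powr p) + rad_term p t f z) * indicator (ball 0 1) z) \<in> borel_measurable borel"
        unfolding distrib_right using m1 m2 by (rule borel_measurable_add)
      have m12': "(\<lambda>z. ennreal e * (ennreal (cmod (f z) powr p) + rad_term p t f z) * indicator (ball 0 1) z) \<in> borel_measurable borel"
        unfolding mult.assoc by (rule borel_measurable_times_ennreal[OF borel_measurable_const m12])
      have m3': "(\<lambda>z. ennreal D * rad_term p q f z * indicator (ball 0 1) z) \<in> borel_measurable borel"
        unfolding mult.assoc by (rule borel_measurable_times_ennreal[OF borel_measurable_const m3])
      have "wint \<omega> (rad_term p b f) \<le> wint \<omega> (\<lambda>z. ennreal e * (ennreal (cmod (f z) powr p) + rad_term p t f z) + ennreal D * rad_term p q f z)"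
        by (rule wint_mono) (rule rad_term_interpolation[OF D less_imp_le[OF e]])
      also have "\<dots> = wint \<omega> (\<lambda>z. ennreal e * (ennreal (cmod (f z) powr p) + rad_term p t f z)) + wint \<omega> (\<lambda>z. ennreal D * rad_term p q f z)"
        by (rule wint_add[OF w m12' m3'])
      also have "wint \<omega> (\<lambda>z. ennreal D * rad_term p q f z) = ennreal D * ennreal J"
        unfolding wint_cmult[OF w m3] J(1) ..
      also have "wint \<omega> (\<lambda>z. ennreal e * (ennreal (cmod (f z) powr p) + rad_term p t f z)) = ennreal e * (ennreal X + wint \<omega> (rad_term p t f))"
        unfolding wint_cmult[OF w m12] wint_add[OF w m1 m2] X(1) ..
      also have "ennreal e * (ennreal X + wint \<omega> (rad_term p t f)) \<le> ennreal e * (ennreal X + ennreal (C1 * X))"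
        by (intro mult_left_mono add_left_mono Jt) auto
      also have "ennreal e * (ennreal X + ennreal (C1 * X)) = ennreal (e * (X + C1 * X))"
      proof -
        have "ennreal X + ennreal (C1 * X) = ennreal (X + C1 * X)" by (rule ennreal_plus[symmetric]) (use X C1 in auto)
        moreover have "ennreal e * ennreal (X + C1 * X) = ennreal (e * (X + C1 * X))" by (rule ennreal_mult[symmetric]) (use X C1 e in auto)
        ultimately show ?thesis by (simp only:)
      qed
      also have "ennreal D * ennreal J = ennreal (D * J)" by (rule ennreal_mult[symmetric]) (use J D in auto)
      also have "ennreal (e * (X + C1 * X)) + ennreal (D * J) = ennreal (e * (X + C1 * X) + D * J)"
        by (rule ennreal_plus[symmetric]) (use X C1 e J D in auto)
      finally show ?thesis by (simp add: add_right_mono)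
    qed
    define Y where "Y b = e * (X + C1 * X) + b * J" for b
    have Y: "Y D1 \<ge> 0" "Y D2 \<ge> 0" using X C1 e J D1 D2 by (auto simp: Y_def)
    have "ennreal X \<le> ennreal A * (ennreal u + wint \<omega> (rad_term p p f) + wint \<omega> (rad_term p 1 f))"
      using hardy[OF f w] unfolding X(1) u_def .
    also have "\<dots> \<le> ennreal A * (ennreal u + ennreal (Y D2) + ennreal (Y D1))"
      unfolding Y_def by (intro mult_left_mono add_mono Jb D1 D2 order_refl) auto
    also have "\<dots> = ennreal (A * (u + Y D2 + Y D1))"
    proof -
      have "ennreal u + ennreal (Y D2) = ennreal (u + Y D2)" by (rule ennreal_plus[symmetric]) (use Y in \<open>auto simp: u_def\<close>)
      moreover have "ennreal (u + Y D2) + ennreal (Y D1) = ennreal (u + Y D2 + Y D1)"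
        by (rule ennreal_plus[symmetric]) (use Y in \<open>auto simp: u_def\<close>)
      moreover have "ennreal A * ennreal (u + Y D2 + Y D1) = ennreal (A * (u + Y D2 + Y D1))"
        by (rule ennreal_mult[symmetric]) (use A Y in \<open>auto simp: u_def\<close>)
      ultimately show ?thesis by (simp only:)
    qed
    finally have "X \<le> A * (u + Y D2 + Y D1)"
      by (subst (asm) ennreal_le_iff) (use A Y in \<open>auto simp: u_def\<close>)
    also have "A * (u + Y D2 + Y D1) = A * u + (2 * A * e * (1 + C1)) * X + A * (D1 + D2) * J"
      by (simp add: Y_def algebra_simps)
    also have "2 * A * e * (1 + C1) = 1/2"
    proof -
      define s where "s = A * (1 + C1)"
      have "s \<noteq> 0" using A C1 by (simp add: s_def)
      moreover have "2 * A * e * (1 + C1) = 2 * (s * (1 / (4 * s)))" unfolding e_def s_def by (simp only: mult_ac)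
      ultimately show ?thesis by simp
    qed
    finally have "X \<le> 2 * (A * u) + 2 * (A * (D1 + D2) * J)" by simp
    also have "\<dots> \<le> C * u + C * J"
    proof -
      have "A * u \<le> A * (1 + D1 + D2) * u"
        using A D1 D2 by (intro mult_right_mono) (auto simp: u_def distrib_left)
      moreover have "A * (D1 + D2) * J \<le> A * (1 + D1 + D2) * J"
        using A D1 D2 J by (intro mult_right_mono mult_left_mono) auto
      ultimately show ?thesis by (simp add: C_def mult.assoc)
    qed
    also have "\<dots> = C * (u + J)" by (simp add: distrib_left)
    finally have "ennreal X \<le> ennreal (C * (u + J))" by (rule ennreal_leI)
    also have "\<dots> = ennreal C * ennreal (u + J)" by (rule ennreal_mult) (use A D1 D2 J in \<open>auto simp: C_def u_def\<close>)
    also have "ennreal (u + J) = ennreal u + ennreal J" by (rule ennreal_plus) (use J in \<open>auto simp: u_def\<close>)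
    finally show ?thesis unfolding X(1) J(1) u_def .
  qed
  show ?thesis
  proof (rule that)
    show "C > 0" unfolding C_def using A D1 D2 by (intro mult_pos_pos) auto
  qed (rule main)
qed

section \<open>Truncated weights, dilations and removal of the finiteness assumption\<close>

lemma wint_weight_mono:
  assumes "\<And>s. 0 < s \<Longrightarrow> s \<le> 1 \<Longrightarrow> \<omega> s \<le> \<omega>' s"
  shows "wint \<omega> F \<le> wint \<omega>' F"
  unfolding wint_def
proof (rule nn_integral_mono)
  fix z :: "complex^'a"
  show "ennreal (\<omega> (defect z)) * F z * indicator (ball 0 1) z \<le> ennreal (\<omega>' (defect z)) * F z * indicator (ball 0 1) z"
  proof (cases "z \<in> ball 0 1")
    case True
    have "\<omega> (defect z) \<le> \<omega>' (defect z)" by (rule assms[OF defect_pos[OF True] defect_le_1])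
    then show ?thesis by (intro mult_right_mono ennreal_leI) auto
  qed simp
qed

lemma wint_weight_cong:
  assumes "\<And>s. 0 < s \<Longrightarrow> s \<le> 1 \<Longrightarrow> \<omega> s = \<omega>' s"
  shows "wint \<omega> F = wint \<omega>' F"
  by (intro antisym wint_weight_mono) (simp_all add: assms)

text \<open>A truncation of s powr \<alpha> near the sphere: it is at most k powr N times s powr
  (\<alpha> + N), and it equals s powr \<alpha> as soon as k s >= 1.\<close>

definition reg_weight :: "real \<Rightarrow> real \<Rightarrow> real \<Rightarrow> real \<Rightarrow> real" where
  "reg_weight \<alpha> N k s = s powr \<alpha> * (min 1 (k * s)) powr N"

text \<open>min 1 (k s) <= 3 min 1 (k t) whenever s <= 3 t, whatever k is; so the doubling constant
  does not depend on the truncation, and a bound uniform in k follows.\<close>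

lemma weight_ok_reg_weight:
  assumes N: "N \<ge> 0" and k: "k \<ge> 1"
  shows "weight_ok \<alpha> (3 powr (\<bar>\<alpha>\<bar> + N)) (reg_weight \<alpha> N k)"
  unfolding weight_ok_def
proof (intro conjI allI impI)
  show "reg_weight \<alpha> N k \<in> borel_measurable borel" unfolding reg_weight_def[abs_def] by measurable
  show "reg_weight \<alpha> N k 1 = 1" using k by (simp add: reg_weight_def)
  show "0 \<le> reg_weight \<alpha> N k s" for s by (simp add: reg_weight_def)
  show "reg_weight \<alpha> N k s \<le> 3 powr (\<bar>\<alpha>\<bar> + N) * reg_weight \<alpha> N k t"
    if A: "0 < s \<and> s \<le> 1 \<and> 0 < t \<and> t \<le> 1 \<and> s \<le> 3 * t \<and> t \<le> 3 * s" for s t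
  proof -
    have a: "s powr \<alpha> \<le> 3 powr \<bar>\<alpha>\<bar> * t powr \<alpha>"
    proof (cases "\<alpha> \<ge> 0")
      case True
      then have "s powr \<alpha> \<le> (3 * t) powr \<alpha>" using A by (intro powr_mono2) auto
      then show ?thesis using A True by (simp add: powr_mult)
    next
      case False
      then have "s powr \<alpha> \<le> (t / 3) powr \<alpha>" using A by (intro powr_mono2') auto
      also have "\<dots> = t powr \<alpha> / 3 powr \<alpha>" by (rule powr_divide)
      also have "\<dots> = 3 powr (- \<alpha>) * t powr \<alpha>" by (simp add: powr_minus_divide)
      also have "- \<alpha> = \<bar>\<alpha>\<bar>" using False by simp
      finally show ?thesis .
    qed
    have "k * s \<le> 3 * (k * t)" using mult_left_mono[of s "3 * t" k] A k by simp
    moreover have "0 < k * t" "0 < k * s" using A k by auto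
    ultimately have "min 1 (k * s) \<le> 3 * min 1 (k * t)" by linarith
    then have "(min 1 (k * s)) powr N \<le> (3 * min 1 (k * t)) powr N"
      using N \<open>0 < k * s\<close> by (intro powr_mono2) auto
    also have "\<dots> = 3 powr N * (min 1 (k * t)) powr N" using \<open>0 < k * t\<close> by (simp add: powr_mult)
    finally have "s powr \<alpha> * (min 1 (k * s)) powr N \<le> (3 powr \<bar>\<alpha>\<bar> * t powr \<alpha>) * (3 powr N * (min 1 (k * t)) powr N)"
      by (intro mult_mono a) auto
    then show ?thesis by (simp add: reg_weight_def powr_add mult_ac)
  qed
  show "reg_weight \<alpha> N k s * t powr \<alpha> \<le> s powr \<alpha> * reg_weight \<alpha> N k t" if A: "0 < s \<and> s \<le> t \<and> t \<le> 1" for s t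
  proof -
    have "k * s \<le> k * t" "0 < k * s" using A k by auto
    then have "(min 1 (k * s)) powr N \<le> (min 1 (k * t)) powr N" using N by (intro powr_mono2) auto
    then have "s powr \<alpha> * t powr \<alpha> * (min 1 (k * s)) powr N \<le> s powr \<alpha> * t powr \<alpha> * (min 1 (k * t)) powr N"
      by (intro mult_left_mono) auto
    then show ?thesis by (simp add: reg_weight_def mult_ac)
  qed
qed

text \<open>The pure power \<alpha> enters the weighted estimates as the case N = 0. Agreement is
  needed only for s > 0; at s = 0 the convention for 0 powr 0 would intervene.\<close>

lemma wint_reg_weight_0: "k \<ge> 1 \<Longrightarrow> wint (reg_weight \<alpha> 0 k) F = wint (\<lambda>s. s powr \<alpha>) F"
proof (rule wint_weight_cong)
  fix s :: real assume "k \<ge> 1" "0 < s" "s \<le> 1"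
  then have "min 1 (k * s) > 0" by simp
  then show "reg_weight \<alpha> 0 k s = s powr \<alpha>" by (simp add: reg_weight_def)
qed

lemma wint_fatou:
  fixes F :: "complex^'n \<Rightarrow> ennreal"
  assumes meas: "\<And>k. (\<lambda>z. ennreal (\<omega>' k (defect z)) * F' k z * indicator (ball 0 1) z) \<in> borel_measurable borel"
    and lim: "\<And>z. z \<in> ball 0 1 \<Longrightarrow> (\<lambda>k::nat. ennreal (\<omega>' k (defect z)) * F' k z) \<longlonglongrightarrow> ennreal (\<omega> (defect z)) * F z"
    and le: "\<And>k. wint (\<omega>' k) (F' k) \<le> K"
  shows "wint \<omega> F \<le> K"
proof -
  have "wint \<omega> F = (\<integral>\<^sup>+z. liminf (\<lambda>k. ennreal (\<omega>' k (defect z)) * F' k z * indicator (ball 0 1) z) \<partial>lborel)"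
    unfolding wint_def
  proof (rule nn_integral_cong)
    fix z :: "complex^'n"
    show "ennreal (\<omega> (defect z)) * F z * indicator (ball 0 1) z = liminf (\<lambda>k. ennreal (\<omega>' k (defect z)) * F' k z * indicator (ball 0 1) z)"
    proof (cases "z \<in> ball 0 1")
      case True
      have "liminf (\<lambda>k. ennreal (\<omega>' k (defect z)) * F' k z) = ennreal (\<omega> (defect z)) * F z"
        by (rule lim_imp_Liminf[OF _ lim[OF True]]) simp
      then show ?thesis using True by simp
    next
      case False
      then show ?thesis by (simp add: Liminf_const)
    qed
  qed
  also have "\<dots> \<le> liminf (\<lambda>k. wint (\<omega>' k) (F' k))"
    unfolding wint_def by (rule nn_integral_liminf) (use meas in simp)
  also have "\<dots> \<le> liminf (\<lambda>k::nat. K)"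
    by (intro Liminf_mono always_eventually allI le)
  also have "\<dots> = K" by (simp add: Liminf_const)
  finally show ?thesis .
qed

lemma dilate:
  fixes f :: "complex^'n \<Rightarrow> complex"
  assumes f: "holo_on f (ball 0 1)" and r: "0 < r" "r < 1"
  shows "holo_on (\<lambda>z. f (r *\<^sub>R z)) (ball 0 1)"
    "\<And>z::complex^'n. z \<in> ball 0 1 \<Longrightarrow> r *\<^sub>R z \<in> ball 0 1"
    "\<And>z. z \<in> ball 0 1 \<Longrightarrow> radial_deriv (\<lambda>z. f (r *\<^sub>R z)) z = radial_deriv f (r *\<^sub>R z)"
proof -
  show inb: "r *\<^sub>R z \<in> ball 0 1" if "z \<in> ball 0 1" for z :: "complex^'n"
  proof -
    have "r * norm z \<le> 1 * norm z" using r by (intro mult_right_mono) auto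
    then show ?thesis using that r by simp
  qed
  have der: "((\<lambda>z. f (r *\<^sub>R z)) has_derivative (\<lambda>v. cdiff f (r *\<^sub>R z) (r *\<^sub>R v))) (at z)" if z: "z \<in> ball 0 1" for z
  proof -
    have "((\<lambda>z::complex^'n. r *\<^sub>R z) has_derivative (\<lambda>v. r *\<^sub>R v)) (at z)"
      by (auto intro!: derivative_eq_intros)
    from diff_chain_at[OF this holo_has_derivative[OF f inb[OF z]]] show ?thesis by (simp only: o_def)
  qed
  show h: "holo_on (\<lambda>z. f (r *\<^sub>R z)) (ball 0 1)"
    unfolding holo_on_def
  proof (intro ballI exI conjI allI)
    fix z :: "complex^'n" assume z: "z \<in> ball 0 1"
    show "((\<lambda>z. f (r *\<^sub>R z)) has_derivative (\<lambda>v. cdiff f (r *\<^sub>R z) (r *\<^sub>R v))) (at z)" by (rule der[OF z])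
    show "cdiff f (r *\<^sub>R z) (r *\<^sub>R (c *s v)) = c * cdiff f (r *\<^sub>R z) (r *\<^sub>R v)" for c v
      by (simp add: cdiff_cscale mult_ac flip: cscale_of_real)
  qed
  show "radial_deriv (\<lambda>z. f (r *\<^sub>R z)) z = radial_deriv f (r *\<^sub>R z)" if z: "z \<in> ball 0 1" for z
  proof -
    have "cdiff (\<lambda>z. f (r *\<^sub>R z)) z = (\<lambda>v. cdiff f (r *\<^sub>R z) (r *\<^sub>R v))"
      by (rule has_derivative_unique[OF holo_has_derivative[OF h z] der[OF z]])
    then show ?thesis by (simp add: radial_deriv_cdiff)
  qed
qed

lemma wint_dilate_finite:
  fixes f :: "complex^'n \<Rightarrow> complex"
  assumes f: "holo_on f (ball 0 1)" and r: "0 < r" "r < 1" and \<beta>: "\<beta> \<ge> 0" and p: "p > 0"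
  shows "wint (\<lambda>s. s powr \<beta>) (\<lambda>z. ennreal (cmod (f (r *\<^sub>R z)) powr p)) < top"
proof -
  have sub: "cball 0 r \<subseteq> ball (0::complex^'n) 1" using r by auto
  have "continuous_on (cball 0 r) f" by (rule continuous_on_subset[OF holo_on_continuous_on[OF f] sub])
  then have "bounded (f ` cball 0 r)" by (intro compact_imp_bounded compact_continuous_image) auto
  then obtain M where "\<forall>y\<in>cball 0 r. cmod (f y) \<le> M"
    unfolding bounded_iff by auto
  then have M: "\<And>y. y \<in> cball 0 r \<Longrightarrow> cmod (f y) \<le> M" by blast
  have "wint (\<lambda>s. s powr \<beta>) (\<lambda>z. ennreal (cmod (f (r *\<^sub>R z)) powr p)) \<le> (\<integral>\<^sup>+z. ennreal (M powr p) * indicator (ball (0::complex^'n) 1) z \<partial>lborel)"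
    unfolding wint_def
  proof (rule nn_integral_mono)
    fix z :: "complex^'n"
    show "ennreal (defect z powr \<beta>) * ennreal (cmod (f (r *\<^sub>R z)) powr p) * indicator (ball 0 1) z \<le> ennreal (M powr p) * indicator (ball 0 1) z"
    proof (cases "z \<in> ball 0 1")
      case True
      then have "r * norm z \<le> r * 1" using r by (intro mult_left_mono) auto
      then have "cmod (f (r *\<^sub>R z)) \<le> M" using r by (intro M) simp
      then have 1: "cmod (f (r *\<^sub>R z)) powr p \<le> M powr p" using p by (intro powr_mono2) auto
      have "defect z powr \<beta> \<le> 1" using defect_pos[OF True] defect_le_1[of z] \<beta> by (intro powr_le1) auto
      then have "ennreal (defect z powr \<beta>) * ennreal (cmod (f (r *\<^sub>R z)) powr p) \<le> ennreal 1 * ennreal (M powr p)"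
        using 1 by (intro mult_mono ennreal_leI) auto
      then show ?thesis using True by simp
    qed simp
  qed
  also have "\<dots> = ennreal (M powr p) * uvol TYPE(complex^'n)"
    by (rule nn_integral_cmult_indicator) simp
  also have "\<dots> < top" using uvol_bounds[where 'a="complex^'n"] by (simp add: ennreal_mult_less_top)
  finally show ?thesis .
qed

text \<open>The defect grows when z is replaced by r z, and for \<beta> >= 0 so does its power; the
  substitution y = r z then costs 2 powr the real dimension, as r >= 1/2.\<close>

lemma wint_rad_term_dilate:
  fixes f :: "complex^'n \<Rightarrow> complex"
  assumes f: "holo_on f (ball 0 1)" and r: "1/2 \<le> r" "r < 1" and \<beta>: "\<beta> \<ge> 0" and q: "q > 0"
  shows "wint (\<lambda>s. s powr \<beta>) (rad_term p q (\<lambda>z. f (r *\<^sub>R z))) \<le> ennreal (2 ^ DIM(complex^'n)) * wint (\<lambda>s. s powr \<beta>) (rad_term p q f)"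
proof -
  have r0: "0 < r" using r by simp
  define \<Phi> where "\<Phi> y = ennreal (defect y powr \<beta>) * rad_term p q f y * indicator (ball 0 1) y" for y
  have m[measurable]: "\<Phi> \<in> borel_measurable borel"
  proof -
    have "(\<lambda>y::complex^'n. ennreal (defect y powr \<beta>)) \<in> borel_measurable borel" by measurable
    from borel_measurable_times_ennreal[OF this rad_term_measurable[OF f, of p q]]
    show ?thesis unfolding \<Phi>_def[abs_def] by (simp only: mult.assoc)
  qed
  have "wint (\<lambda>s. s powr \<beta>) (rad_term p q (\<lambda>z. f (r *\<^sub>R z))) \<le> (\<integral>\<^sup>+z. \<Phi> (0 + r *\<^sub>R z) \<partial>lborel)"
    unfolding wint_def
  proof (rule nn_integral_mono)
    fix z :: "complex^'n"
    show "ennreal (defect z powr \<beta>) * rad_term p q (\<lambda>z. f (r *\<^sub>R z)) z * indicator (ball 0 1) z \<le> \<Phi> (0 + r *\<^sub>R z)"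
    proof (cases "z \<in> ball 0 1")
      case True
      have y: "r *\<^sub>R z \<in> ball 0 1" by (rule dilate(2)[OF f r0 r(2) True])
      have "(r * norm z)\<^sup>2 \<le> (1 * norm z)\<^sup>2" using r by (intro power_mono mult_right_mono) auto
      then have d: "defect z \<le> defect (r *\<^sub>R z)" using r0 by (simp add: defect_def)
      have dz: "0 < defect z" by (rule defect_pos[OF True])
      have "ennreal (defect z powr \<beta>) \<le> ennreal (defect (r *\<^sub>R z) powr \<beta>)"
        using d dz \<beta> by (intro ennreal_leI powr_mono2) auto
      moreover have "rad_term p q (\<lambda>z. f (r *\<^sub>R z)) z \<le> rad_term p q f (r *\<^sub>R z)"
        unfolding rad_term_def dilate(3)[OF f r0 r(2) True]
        using d dz q by (intro ennreal_leI mult_left_mono powr_mono2 mult_right_mono) auto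
      ultimately have "ennreal (defect z powr \<beta>) * rad_term p q (\<lambda>z. f (r *\<^sub>R z)) z \<le> ennreal (defect (r *\<^sub>R z) powr \<beta>) * rad_term p q f (r *\<^sub>R z)"
        by (rule mult_mono) auto
      then show ?thesis using True y by (simp add: \<Phi>_def)
    qed simp
  qed
  also have "\<dots> = 1 * (\<integral>\<^sup>+z. \<Phi> (0 + r *\<^sub>R z) \<partial>lborel)" by simp
  also have "\<dots> \<le> (ennreal (2 ^ DIM(complex^'n)) * ennreal (\<bar>r\<bar> ^ DIM(complex^'n))) * (\<integral>\<^sup>+z. \<Phi> (0 + r *\<^sub>R z) \<partial>lborel)"
  proof (rule mult_right_mono)
    have "1 ^ DIM(complex^'n) \<le> (2 * r) ^ DIM(complex^'n)" using r by (intro power_mono) auto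
    then have "1 \<le> 2 ^ DIM(complex^'n) * \<bar>r\<bar> ^ DIM(complex^'n)" using r0 by (simp add: power_mult_distrib)
    then have "ennreal 1 \<le> ennreal (2 ^ DIM(complex^'n) * \<bar>r\<bar> ^ DIM(complex^'n))" by (rule ennreal_leI)
    also have "\<dots> = ennreal (2 ^ DIM(complex^'n)) * ennreal (\<bar>r\<bar> ^ DIM(complex^'n))" by (rule ennreal_mult) auto
    finally show "1 \<le> ennreal (2 ^ DIM(complex^'n)) * ennreal (\<bar>r\<bar> ^ DIM(complex^'n))" by simp
  qed simp
  also have "\<dots> = ennreal (2 ^ DIM(complex^'n)) * (\<integral>\<^sup>+y. \<Phi> y \<partial>lborel)"
    using nn_integral_lborel_scale[OF m, of r 0] r0 by (simp only: mult.assoc)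
  finally show ?thesis unfolding \<Phi>_def wint_def .
qed

lemma weighted_measurable:
  assumes [measurable]: "\<omega> \<in> borel_measurable borel" and F: "(\<lambda>z. F z * indicator (ball 0 1) z) \<in> borel_measurable borel"
  shows "(\<lambda>z. ennreal (\<omega> (defect z)) * F z * indicator (ball 0 1) z) \<in> borel_measurable borel"
proof -
  have "(\<lambda>y::complex^'a. ennreal (\<omega> (defect y))) \<in> borel_measurable borel" by measurable
  from borel_measurable_times_ennreal[OF this F] show ?thesis by (simp only: mult.assoc)
qed

text \<open>Two limits remove the finiteness assumption: dilations settle exponents \<open>\<beta> \<ge> 0\<close> (for negative
  exponents they are not monotone in the radius), and truncated weights then pass from \<open>max \<alpha> 0\<close> to \<open>\<alpha>\<close>.\<close>

lemma norm_le_radial_term: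
  fixes p q \<alpha> :: real
  assumes p: "p > 0" and \<alpha>: "\<alpha> > -1" and q: "0 < q"
  obtains C where "C > 0"
    "\<And>f :: complex^'n \<Rightarrow> complex. holo_on f (ball 0 1) \<Longrightarrow>
      wint (\<lambda>s. s powr \<alpha>) (\<lambda>z. ennreal (cmod (f z) powr p))
      \<le> ennreal C * (ennreal (cmod (f 0) powr p) + wint (\<lambda>s. s powr \<alpha>) (rad_term p q f))"
proof -
  \<comment> \<open>The dilation argument needs a nonnegative exponent. As \<beta> >= \<alpha> and
    defects are at most 1, finiteness of the radial term for \<alpha> gives it for \<beta>.\<close>
  define \<beta> where "\<beta> = max \<alpha> 0"
  define N where "N = \<beta> - \<alpha>"
  have \<beta>: "\<beta> \<ge> 0" "\<beta> > -1" and N: "N \<ge> 0" by (auto simp: \<beta>_def N_def)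
  obtain C1 where C1: "C1 > 0" and ap1: "\<And>(f :: complex^'n \<Rightarrow> complex) \<omega>. \<lbrakk>holo_on f (ball 0 1); weight_ok \<beta> (3 powr (\<bar>\<beta>\<bar> + 0)) \<omega>; wint \<omega> (\<lambda>z. ennreal (cmod (f z) powr p)) < top\<rbrakk> \<Longrightarrow>
      wint \<omega> (\<lambda>z. ennreal (cmod (f z) powr p)) \<le> ennreal C1 * (ennreal (cmod (f 0) powr p) + wint \<omega> (rad_term p q f))"
    by (rule apriori_estimate[OF p \<beta>(2) q, of "3 powr (\<bar>\<beta>\<bar> + 0)"], rule that)
  obtain C2 where C2: "C2 > 0" and ap2: "\<And>(f :: complex^'n \<Rightarrow> complex) \<omega>. \<lbrakk>holo_on f (ball 0 1); weight_ok \<alpha> (3 powr (\<bar>\<alpha>\<bar> + N)) \<omega>; wint \<omega> (\<lambda>z. ennreal (cmod (f z) powr p)) < top\<rbrakk> \<Longrightarrow>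
      wint \<omega> (\<lambda>z. ennreal (cmod (f z) powr p)) \<le> ennreal C2 * (ennreal (cmod (f 0) powr p) + wint \<omega> (rad_term p q f))"
    by (rule apriori_estimate[OF p \<alpha> q, of "3 powr (\<bar>\<alpha>\<bar> + N)"], rule that)
  have main: "wint (\<lambda>s. s powr \<alpha>) (\<lambda>z. ennreal (cmod (f z) powr p))
      \<le> ennreal C2 * (ennreal (cmod (f 0) powr p) + wint (\<lambda>s. s powr \<alpha>) (rad_term p q f))"
    if f: "holo_on f (ball 0 1)" for f :: "complex^'n \<Rightarrow> complex"
  proof (cases "wint (\<lambda>s. s powr \<alpha>) (rad_term p q f) = top")
    case True
    then show ?thesis using C2 by (simp add: ennreal_mult_top)
  next
    case False
    let ?f0 = "ennreal (cmod (f 0) powr p)"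
    let ?D = "ennreal (2 ^ DIM(complex^'n))"
    have Jle: "wint (\<lambda>s. s powr \<beta>) (rad_term p q f) \<le> wint (\<lambda>s. s powr \<alpha>) (rad_term p q f)"
      by (rule wint_weight_mono, rule powr_mono') (auto simp: \<beta>_def)
    \<comment> \<open>K depends on the loss from dilating and serves only to show that the
      \<beta>-integral of |f| powr p is finite; the final bound carries C2 instead.\<close>
    define K where "K = ennreal C1 * (?f0 + ?D * wint (\<lambda>s. s powr \<beta>) (rad_term p q f))"
    have K: "K < top"
    proof -
      have "wint (\<lambda>s. s powr \<alpha>) (rad_term p q f) < top" using False by (simp add: less_top)
      from le_less_trans[OF Jle this] have "wint (\<lambda>s. s powr \<beta>) (rad_term p q f) < top" .
      then show ?thesis unfolding K_def by (simp add: ennreal_mult_less_top)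
    qed
    have "wint (\<lambda>s. s powr \<beta>) (\<lambda>z. ennreal (cmod (f z) powr p)) \<le> K"
    proof (rule wint_fatou)
      \<comment> \<open>Shifting by 2 keeps r at least 1/2 from the start, as the substitution
        requires.\<close>
      define r where "r k = 1 - 1 / (real k + 2)" for k :: nat
      have r: "1/2 \<le> r k" "0 < r k" "r k < 1" for k by (auto simp: r_def field_simps)
      have r1: "r \<longlonglongrightarrow> 1"
      proof -
        have "(\<lambda>k. 1 / (real (k + 2))) \<longlonglongrightarrow> 0" by (rule LIMSEQ_ignore_initial_segment[OF lim_1_over_n])
        from tendsto_diff[OF tendsto_const[of 1] this] show ?thesis by (simp add: r_def[abs_def] add.commute)
      qed
      show "(\<lambda>z::complex^'n. ennreal (defect z powr \<beta>) * ennreal (cmod (f (r k *\<^sub>R z)) powr p) * indicator (ball 0 1) z) \<in> borel_measurable borel" for k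
        by (rule weighted_measurable[of "\<lambda>s. s powr \<beta>", OF _ cmod_powr_measurable[OF dilate(1)[OF f r(2) r(3)]]]) measurable
      show "(\<lambda>k. ennreal (defect z powr \<beta>) * ennreal (cmod (f (r k *\<^sub>R z)) powr p)) \<longlonglongrightarrow> ennreal (defect z powr \<beta>) * ennreal (cmod (f z) powr p)"
        if z: "z \<in> ball 0 1" for z
      proof -
        have "isCont f z" using holo_has_derivative[OF f z] by (rule has_derivative_continuous)
        moreover have "(\<lambda>k. r k *\<^sub>R z) \<longlonglongrightarrow> 1 *\<^sub>R z" by (intro tendsto_scaleR r1 tendsto_const)
        ultimately have "(\<lambda>k. f (r k *\<^sub>R z)) \<longlonglongrightarrow> f z" using isCont_tendsto_compose[of z f] by simp
        then have "(\<lambda>k. defect z powr \<beta> * cmod (f (r k *\<^sub>R z)) powr p) \<longlonglongrightarrow> defect z powr \<beta> * cmod (f z) powr p"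
          using p by (intro tendsto_mult tendsto_const tendsto_powr' tendsto_norm) auto
        then have "(\<lambda>k. ennreal (defect z powr \<beta> * cmod (f (r k *\<^sub>R z)) powr p)) \<longlonglongrightarrow> ennreal (defect z powr \<beta> * cmod (f z) powr p)"
          by (rule tendsto_ennrealI)
        then show ?thesis by (simp add: ennreal_mult)
      qed
      fix k
      let ?g = "\<lambda>z. f (r k *\<^sub>R z)"
      have g: "holo_on ?g (ball 0 1)" by (rule dilate(1)[OF f r(2) r(3)])
      have fin: "wint (\<lambda>s. s powr \<beta>) (\<lambda>z. ennreal (cmod (?g z) powr p)) < top"
        by (rule wint_dilate_finite[OF f r(2) r(3) \<beta>(1) p])
      have "wint (reg_weight \<beta> 0 1) (\<lambda>z. ennreal (cmod (?g z) powr p)) \<le> ennreal C1 * (ennreal (cmod (?g 0) powr p) + wint (reg_weight \<beta> 0 1) (rad_term p q ?g))"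
        by (rule ap1[OF g weight_ok_reg_weight]) (simp_all add: wint_reg_weight_0 fin)
      then have "wint (\<lambda>s. s powr \<beta>) (\<lambda>z. ennreal (cmod (?g z) powr p)) \<le> ennreal C1 * (?f0 + wint (\<lambda>s. s powr \<beta>) (rad_term p q ?g))"
        by (simp add: wint_reg_weight_0)
      also have "\<dots> \<le> K" unfolding K_def
        by (intro mult_left_mono add_left_mono wint_rad_term_dilate[OF f r(1) r(3) \<beta>(1) q]) simp
      finally show "wint (\<lambda>s. s powr \<beta>) (\<lambda>z. ennreal (cmod (?g z) powr p)) \<le> K" .
    qed
    then have fin\<beta>: "wint (\<lambda>s. s powr \<beta>) (\<lambda>z. ennreal (cmod (f z) powr p)) < top" using K by (rule le_less_trans)
    \<comment> \<open>Since \<alpha> + N = \<beta>, each truncated weight is at most a constant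
      times s powr \<beta>, so absorption is legitimate for it. At every point the truncation is
      eventually inactive, and C2 does not depend on k.\<close>
    let ?w = "\<lambda>k::nat. reg_weight \<alpha> N (real (Suc k))"
    have ok: "weight_ok \<alpha> (3 powr (\<bar>\<alpha>\<bar> + N)) (?w k)" for k
      by (rule weight_ok_reg_weight[OF N]) simp
    show ?thesis
    proof (rule wint_fatou)
      show "(\<lambda>z::complex^'n. ennreal (?w k (defect z)) * ennreal (cmod (f z) powr p) * indicator (ball 0 1) z) \<in> borel_measurable borel" for k
        by (rule weighted_measurable[OF weight_ok_measurable[OF ok] cmod_powr_measurable[OF f]])
      show "(\<lambda>k. ennreal (?w k (defect z)) * ennreal (cmod (f z) powr p)) \<longlonglongrightarrow> ennreal (defect z powr \<alpha>) * ennreal (cmod (f z) powr p)"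
        if z: "z \<in> ball 0 1" for z
      proof (rule tendsto_eventually)
        have d: "defect z > 0" by (rule defect_pos[OF z])
        obtain n :: nat where n: "1 / defect z < real n" using reals_Archimedean2 by blast
        show "\<forall>\<^sub>F k in sequentially. ennreal (?w k (defect z)) * ennreal (cmod (f z) powr p) = ennreal (defect z powr \<alpha>) * ennreal (cmod (f z) powr p)"
          unfolding eventually_sequentially
        proof (intro exI allI impI)
          fix k assume "n \<le> k"
          then have "1 / defect z < real (Suc k)" using n by linarith
          then have "1 < real (Suc k) * defect z" using d by (simp only: pos_divide_less_eq)
          then have "min 1 (real (Suc k) * defect z) = 1" by linarith
          then have "?w k (defect z) = defect z powr \<alpha>" unfolding reg_weight_def by (simp only: powr_one_eq_one mult_1_right)
          then show "ennreal (?w k (defect z)) * ennreal (cmod (f z) powr p) = ennreal (defect z powr \<alpha>) * ennreal (cmod (f z) powr p)" by (simp only:)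
        qed
      qed
      fix k
      have b1: "?w k s \<le> s powr \<alpha>" if "0 < s" "s \<le> 1" for s
      proof -
        have "(min 1 (real (Suc k) * s)) powr N \<le> 1" using N that by (intro powr_le1) auto
        then have "s powr \<alpha> * (min 1 (real (Suc k) * s)) powr N \<le> s powr \<alpha> * 1" by (rule mult_left_mono) simp
        then show ?thesis by (simp only: reg_weight_def mult_1_right)
      qed
      have b2: "?w k s \<le> real (Suc k) powr N * s powr \<beta>" if "0 < s" "s \<le> 1" for s
      proof -
        have "(min 1 (real (Suc k) * s)) powr N \<le> (real (Suc k) * s) powr N" using N that by (intro powr_mono2) auto
        also have "\<dots> = real (Suc k) powr N * s powr N" by (rule powr_mult)
        finally have "s powr \<alpha> * (min 1 (real (Suc k) * s)) powr N \<le> s powr \<alpha> * (real (Suc k) powr N * s powr N)" by (rule mult_left_mono) simp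
        also have "\<dots> = real (Suc k) powr N * (s powr \<alpha> * s powr N)" by (simp only: mult_ac)
        also have "s powr \<alpha> * s powr N = s powr \<beta>" by (simp add: N_def flip: powr_add)
        finally show ?thesis by (simp only: reg_weight_def)
      qed
      have "wint (?w k) (\<lambda>z. ennreal (cmod (f z) powr p)) \<le> wint (\<lambda>s. real (Suc k) powr N * s powr \<beta>) (\<lambda>z. ennreal (cmod (f z) powr p))"
        by (rule wint_weight_mono[OF b2])
      also have "\<dots> = wint (reg_weight \<beta> 0 1) (\<lambda>z. ennreal (real (Suc k) powr N) * ennreal (cmod (f z) powr p))"
        unfolding wint_reg_weight_0[OF order_refl] unfolding wint_def
        by (rule nn_integral_cong) (simp add: ennreal_mult mult_ac)
      also have "\<dots> = ennreal (real (Suc k) powr N) * wint (reg_weight \<beta> 0 1) (\<lambda>z. ennreal (cmod (f z) powr p))"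
        by (rule wint_cmult[OF weight_ok_reg_weight cmod_powr_measurable[OF f]]) simp_all
      also have "\<dots> < top" using fin\<beta> by (simp add: wint_reg_weight_0 ennreal_mult_less_top)
      finally have "wint (?w k) (\<lambda>z. ennreal (cmod (f z) powr p)) \<le> ennreal C2 * (?f0 + wint (?w k) (rad_term p q f))"
        by (rule ap2[OF f ok])
      also have "\<dots> \<le> ennreal C2 * (?f0 + wint (\<lambda>s. s powr \<alpha>) (rad_term p q f))"
        by (intro mult_left_mono add_left_mono wint_weight_mono b1) auto
      finally show "wint (?w k) (\<lambda>z. ennreal (cmod (f z) powr p)) \<le> ennreal C2 * (?f0 + wint (\<lambda>s. s powr \<alpha>) (rad_term p q f))" .
    qed
  qed
  show ?thesis by (rule that[OF C2]) (rule main)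
qed

section \<open>Value at the centre, total mass and the return to the normalised measure\<close>

lemma center_le_norm:
  fixes p \<alpha> :: real
  assumes p: "p > 0"
  obtains C where "C > 0"
    "\<And>f :: complex^'n \<Rightarrow> complex. holo_on f (ball 0 1) \<Longrightarrow>
      ennreal (cmod (f 0) powr p) \<le> ennreal C * wint (\<lambda>s. s powr \<alpha>) (\<lambda>z. ennreal (cmod (f z) powr p))"
proof -
  obtain C1 where C1: "C1 > 0" and ce: "\<And>f :: complex^'n \<Rightarrow> complex. holo_on f (ball 0 1) \<Longrightarrow>
       ennreal (cmod (f 0) powr p) \<le> ennreal C1 * (\<integral>\<^sup>+y\<in>ball 0 (3/4). ennreal (cmod (f y) powr p) \<partial>lborel)"
    by (rule center_estimate[OF p], rule that)
  define \<Lambda> where "\<Lambda> = 3 powr (\<bar>\<alpha>\<bar> + 0)"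
  have L: "\<Lambda> > 0" by (simp add: \<Lambda>_def)
  have w: "weight_ok \<alpha> \<Lambda> (reg_weight \<alpha> 0 1)" unfolding \<Lambda>_def by (rule weight_ok_reg_weight) auto
  have main: "ennreal (cmod (f 0) powr p) \<le> ennreal (C1 * \<Lambda>) * wint (\<lambda>s. s powr \<alpha>) (\<lambda>z. ennreal (cmod (f z) powr p))"
    if f: "holo_on f (ball 0 1)" for f :: "complex^'n \<Rightarrow> complex"
  proof -
    have "(\<integral>\<^sup>+y\<in>ball 0 (3/4). ennreal (cmod (f y) powr p) \<partial>lborel)
      \<le> wint (reg_weight \<alpha> 0 1) (\<lambda>z. ennreal \<Lambda> * ennreal (cmod (f z) powr p))"
      unfolding wint_def
    proof (rule nn_integral_mono)
      fix y :: "complex^'n"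
      show "ennreal (cmod (f y) powr p) * indicator (ball 0 (3/4)) y
        \<le> ennreal (reg_weight \<alpha> 0 1 (defect y)) * (ennreal \<Lambda> * ennreal (cmod (f y) powr p)) * indicator (ball 0 1) y"
      proof (cases "y \<in> ball 0 (3/4)")
        case True
        have "ennreal 1 \<le> ennreal (\<Lambda> * reg_weight \<alpha> 0 1 (defect y))"
          by (rule ennreal_leI[OF weight_ok_near_center(2)[OF w True]])
        also have "\<dots> = ennreal \<Lambda> * ennreal (reg_weight \<alpha> 0 1 (defect y))"
          by (rule ennreal_mult) (use L weight_ok_nonneg[OF w] in auto)
        finally have "1 * ennreal (cmod (f y) powr p) \<le> (ennreal \<Lambda> * ennreal (reg_weight \<alpha> 0 1 (defect y))) * ennreal (cmod (f y) powr p)"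
          by (intro mult_right_mono) auto
        moreover have "y \<in> ball 0 1" using True by auto
        ultimately show ?thesis using True by (simp add: mult_ac)
      qed simp
    qed
    also have "\<dots> = ennreal \<Lambda> * wint (reg_weight \<alpha> 0 1) (\<lambda>z. ennreal (cmod (f z) powr p))"
      by (rule wint_cmult[OF w cmod_powr_measurable[OF f]])
    finally have "ennreal C1 * (\<integral>\<^sup>+y\<in>ball 0 (3/4). ennreal (cmod (f y) powr p) \<partial>lborel)
      \<le> ennreal C1 * (ennreal \<Lambda> * wint (\<lambda>s. s powr \<alpha>) (\<lambda>z. ennreal (cmod (f z) powr p)))"
      unfolding wint_reg_weight_0[OF order_refl] by (rule mult_left_mono) simp
    also have "\<dots> = ennreal (C1 * \<Lambda>) * wint (\<lambda>s. s powr \<alpha>) (\<lambda>z. ennreal (cmod (f z) powr p))"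
      using C1 L by (simp add: ennreal_mult mult.assoc)
    finally show ?thesis by (rule order_trans[OF ce[OF f]])
  qed
  show ?thesis
  proof (rule that)
    show "C1 * \<Lambda> > 0" using C1 L by simp
  qed (rule main)
qed

text \<open>Finiteness is \<open>hardy_average\<close> for H = 1: the left side is 3/4 of the mass,
  and on the right the extra defect turns the weight into one bounded by 1. Positivity is
  \<open>center_le_norm\<close> for the constant function 1.\<close>

lemma total_mass:
  fixes \<alpha> :: real
  assumes \<alpha>: "\<alpha> > -1"
  obtains \<zeta> where "\<zeta> > 0"
    "(\<integral>\<^sup>+ (w::complex^'n). indicator (ball 0 1) w * ennreal ((1 - (norm w)\<^sup>2) powr \<alpha>) \<partial>lborel) = ennreal \<zeta>"
proof -
  let ?V = "uvol TYPE(complex^'n)"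
  define \<Lambda> where "\<Lambda> = 3 powr (\<bar>\<alpha>\<bar> + 0)"
  have w: "weight_ok \<alpha> \<Lambda> (reg_weight \<alpha> 0 1)" unfolding \<Lambda>_def by (rule weight_ok_reg_weight) auto
  define Z where "Z = wint (\<lambda>s. s powr \<alpha>) (\<lambda>_::complex^'n. 1)"
  have Zeq: "(\<integral>\<^sup>+ (w::complex^'n). indicator (ball 0 1) w * ennreal ((1 - (norm w)\<^sup>2) powr \<alpha>) \<partial>lborel) = Z"
    unfolding Z_def wint_def by (simp add: defect_def mult.commute)
  have i: "(\<integral>\<^sup>+t\<in>{1/4..1}. 1 \<partial>(lborel :: real measure)) = ennreal (3/4)" by simp
  have "wint (reg_weight \<alpha> 0 1) (\<lambda>z::complex^'n. \<integral>\<^sup>+t\<in>{1/4..1}. 1 \<partial>(lborel::real measure))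
      \<le> ennreal (4 ^ DIM(complex^'n) * (2 * 16 powr \<bar>\<alpha>\<bar> / (\<alpha> + 1))) * wint (reg_weight \<alpha> 0 1) (\<lambda>y::complex^'n. ennreal (defect y) * 1)"
    by (rule hardy_average[OF w \<alpha>, of "\<lambda>_. 1"]) simp
  moreover have "wint (reg_weight \<alpha> 0 1) (\<lambda>y::complex^'n. ennreal (defect y) * 1) \<le> ?V"
  proof -
    have "wint (\<lambda>s. s powr \<alpha>) (\<lambda>y::complex^'n. ennreal (defect y) * 1) \<le> (\<integral>\<^sup>+y. indicator (ball (0::complex^'n) 1) y \<partial>lborel)"
      unfolding wint_def
    proof (rule nn_integral_mono)
      fix y :: "complex^'n"
      show "ennreal (defect y powr \<alpha>) * (ennreal (defect y) * 1) * indicator (ball 0 1) y \<le> indicator (ball 0 1) y"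
      proof (cases "y \<in> ball 0 1")
        case True
        note d = defect_pos[OF True]
        have "ennreal (defect y powr \<alpha>) * ennreal (defect y) = ennreal (defect y powr \<alpha> * defect y)"
          by (rule ennreal_mult[symmetric]) (use d in auto)
        also have "defect y powr \<alpha> * defect y = defect y powr (\<alpha> + 1)" using d by (simp add: powr_add)
        also have "defect y powr (\<alpha> + 1) \<le> 1" using d defect_le_1[of y] \<alpha> by (intro powr_le1) auto
        finally show ?thesis using True by (simp add: ennreal_leI)
      qed simp
    qed
    then show ?thesis by (simp add: wint_reg_weight_0)
  qed
  ultimately have "wint (reg_weight \<alpha> 0 1) (\<lambda>z::complex^'n. \<integral>\<^sup>+t\<in>{1/4..1}. 1 \<partial>(lborel::real measure))
    \<le> ennreal (4 ^ DIM(complex^'n) * (2 * 16 powr \<bar>\<alpha>\<bar> / (\<alpha> + 1))) * ?V"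
    by (meson mult_left_mono order_trans zero_le)
  also have "\<dots> < top" using uvol_bounds[where 'a="complex^'n"] by (simp add: ennreal_mult_less_top)
  finally have "wint (reg_weight \<alpha> 0 1) (\<lambda>z::complex^'n. ennreal (3/4) * 1) < top" unfolding i by simp
  also have "wint (reg_weight \<alpha> 0 1) (\<lambda>z::complex^'n. ennreal (3/4) * 1) = ennreal (3/4) * wint (reg_weight \<alpha> 0 1) (\<lambda>z::complex^'n. 1)"
    by (rule wint_cmult[OF w])
       (intro borel_measurable_times_ennreal borel_measurable_const borel_measurable_indicator, simp)
  finally have fin: "Z < top"
    unfolding Z_def wint_reg_weight_0[OF order_refl] by (auto simp: ennreal_mult_less_top)
  have pos: "Z > 0"
  proof -
    have "holo_on (\<lambda>z::complex^'n. 1::complex) (ball 0 1)"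
      unfolding holo_on_def by (intro ballI exI[of _ "\<lambda>_. 0"]) auto
    moreover obtain C where "\<And>f :: complex^'n \<Rightarrow> complex. holo_on f (ball 0 1) \<Longrightarrow>
      ennreal (cmod (f 0) powr 1) \<le> ennreal C * wint (\<lambda>s. s powr \<alpha>) (\<lambda>z. ennreal (cmod (f z) powr 1))"
      by (rule center_le_norm[of 1 \<alpha>]) auto
    ultimately have "ennreal (cmod 1 powr 1) \<le> ennreal C * wint (\<lambda>s. s powr \<alpha>) (\<lambda>z::complex^'n. ennreal (cmod 1 powr 1))" by blast
    then have "1 \<le> ennreal C * Z" by (simp add: Z_def)
    then show ?thesis by (cases "Z = 0") (auto simp: zero_less_iff_neq_zero)
  qed
  have "Z = ennreal (enn2real Z)" "enn2real Z > 0"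
    using fin pos by (auto simp: enn2real_positive_iff)
  then show ?thesis using that[of "enn2real Z"] Zeq by simp
qed

text \<open>Measurability is asked of g only on the ball, because f is arbitrary outside it; the
  density vanishes there.\<close>

lemma nn_integral_dv_alpha:
  fixes g :: "complex^'n \<Rightarrow> ennreal"
  assumes \<zeta>: "\<zeta> > 0" "(\<integral>\<^sup>+ (w::complex^'n). indicator (ball 0 1) w * ennreal ((1 - (norm w)\<^sup>2) powr \<alpha>) \<partial>lborel) = ennreal \<zeta>"
    and g: "(\<lambda>z. g z * indicator (ball 0 1) z) \<in> borel_measurable borel"
  shows "(\<integral>\<^sup>+z. g z \<partial>dv_alpha \<alpha>) = ennreal (1 / \<zeta>) * wint (\<lambda>s. s powr \<alpha>) g"
proof -
  have [measurable]: "ball (0::complex^'n) 1 \<in> sets borel" by simp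
  define \<rho> where "\<rho> z = indicator (ball 0 1) z * ennreal ((1 - (norm z)\<^sup>2) powr \<alpha>) / ennreal \<zeta>" for z :: "complex^'n"
  have m\<rho>[measurable]: "\<rho> \<in> borel_measurable borel" unfolding \<rho>_def by measurable
  have dv: "dv_alpha \<alpha> = density lborel \<rho>" unfolding dv_alpha_def \<rho>_def[abs_def] \<zeta>(2) ..
  have "(\<integral>\<^sup>+z. g z \<partial>dv_alpha \<alpha>) = (\<integral>\<^sup>+z. g z * indicator (ball 0 1) z \<partial>density lborel \<rho>)"
    unfolding dv
  proof (rule nn_integral_cong_AE)
    have "AE z in lborel. 0 < \<rho> z \<longrightarrow> g z = g z * indicator (ball 0 1) z"
    proof (rule AE_I2, rule impI)
      fix z assume "0 < \<rho> z"
      then have "z \<in> ball 0 1" by (cases "z \<in> ball 0 1") (simp_all add: \<rho>_def)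
      then show "g z = g z * indicator (ball 0 1) z" by simp
    qed
    then show "AE z in density lborel \<rho>. g z = g z * indicator (ball 0 1) z"
      by (subst AE_density) (use m\<rho> in simp_all)
  qed
  also have "\<dots> = (\<integral>\<^sup>+z. \<rho> z * (g z * indicator (ball 0 1) z) \<partial>lborel)"
    by (rule nn_integral_density) (use m\<rho> g in simp_all)
  also have "\<dots> = (\<integral>\<^sup>+z. ennreal (1 / \<zeta>) * (ennreal (defect z powr \<alpha>) * g z * indicator (ball 0 1) z) \<partial>lborel)"
  proof (rule nn_integral_cong)
    fix z :: "complex^'n"
    have "\<rho> z = ennreal (1 / \<zeta>) * ennreal (defect z powr \<alpha>)" if "z \<in> ball 0 1"
    proof -
      have "\<rho> z = ennreal (defect z powr \<alpha>) / ennreal \<zeta>" using that by (simp add: \<rho>_def defect_def)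
      also have "\<dots> = ennreal (defect z powr \<alpha> / \<zeta>)" using \<zeta>(1) by (intro divide_ennreal) auto
      also have "\<dots> = ennreal (1 / \<zeta> * defect z powr \<alpha>)" by simp
      also have "\<dots> = ennreal (1 / \<zeta>) * ennreal (defect z powr \<alpha>)" by (rule ennreal_mult) (use \<zeta>(1) in auto)
      finally show ?thesis .
    qed
    then show "\<rho> z * (g z * indicator (ball 0 1) z) = ennreal (1 / \<zeta>) * (ennreal (defect z powr \<alpha>) * g z * indicator (ball 0 1) z)"
      by (cases "z \<in> ball 0 1") (simp_all add: mult.assoc)
  qed
  also have "\<dots> = ennreal (1 / \<zeta>) * wint (\<lambda>s. s powr \<alpha>) g"
    unfolding wint_def
  proof (rule nn_integral_cmult)
    have "(\<lambda>z::complex^'n. ennreal (defect z powr \<alpha>) * g z * indicator (ball 0 1) z) \<in> borel_measurable borel"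
      by (rule weighted_measurable[of "\<lambda>s. s powr \<alpha>", OF _ g]) measurable
    then show "(\<lambda>z::complex^'n. ennreal (defect z powr \<alpha>) * g z * indicator (ball 0 1) z) \<in> borel_measurable lborel" by simp
  qed
  finally show ?thesis .
qed

lemma grad_terms_measurable:
  fixes f :: "complex^'n \<Rightarrow> complex"
  assumes f: "holo_on f (ball 0 1)"
  shows "(\<lambda>z. ennreal (cmod (f z) powr a * ((1 - (norm z)\<^sup>2) * cgrad_norm f z) powr q) * indicator (ball 0 1) z) \<in> borel_measurable borel"
    "(\<lambda>z. ennreal (cmod (f z) powr a * inv_grad_norm f z powr q) * indicator (ball 0 1) z) \<in> borel_measurable borel"
proof -
  have [measurable]: "ball (0::complex^'n) 1 \<in> sets borel" by simp
  define fB where "fB u = indicator (ball 0 1) u *\<^sub>R f u" for u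
  have [measurable]: "fB \<in> borel_measurable borel" unfolding fB_def by (rule holo_measurable[OF f]) simp
  define gB where "gB u = indicator (ball 0 1) u * inv_grad_norm f u" for u
  have [measurable]: "gB \<in> borel_measurable borel" unfolding gB_def by (rule inv_grad_norm_measurable[OF f])
  have [measurable]: "(\<lambda>z. indicator (ball 0 1) z *\<^sub>R pderiv_c f k z) \<in> borel_measurable borel" for k
    using cdiff_measurable[OF f open_ball, of "axis k 1"] by (simp add: cdiff_axis)
  have "(\<lambda>z. ennreal (cmod (f z) powr a * ((1 - (norm z)\<^sup>2) * cgrad_norm f z) powr q) * indicator (ball 0 1) z)
    = (\<lambda>z. ennreal (cmod (fB z) powr a * ((1 - (norm z)\<^sup>2) * sqrt (\<Sum>k\<in>UNIV. (cmod (indicator (ball 0 1) z *\<^sub>R pderiv_c f k z))\<^sup>2)) powr q) * indicator (ball 0 1) z)"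
    by (rule ext) (simp add: fB_def cgrad_norm_def indicator_def)
  also have "\<dots> \<in> borel_measurable borel" by measurable
  finally show "(\<lambda>z. ennreal (cmod (f z) powr a * ((1 - (norm z)\<^sup>2) * cgrad_norm f z) powr q) * indicator (ball 0 1) z) \<in> borel_measurable borel" .
  have "(\<lambda>z. ennreal (cmod (f z) powr a * inv_grad_norm f z powr q) * indicator (ball 0 1) z)
    = (\<lambda>z. ennreal (cmod (fB z) powr a * gB z powr q) * indicator (ball 0 1) z)"
    by (rule ext) (simp add: fB_def gB_def indicator_def)
  also have "\<dots> \<in> borel_measurable borel" by measurable
  finally show "(\<lambda>z. ennreal (cmod (f z) powr a * inv_grad_norm f z powr q) * indicator (ball 0 1) z) \<in> borel_measurable borel" .
qed

lemma Bergman_integrals_comparable: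
  fixes p q \<alpha> :: real
  assumes p: "p > 0" and \<alpha>: "\<alpha> > -1" and q: "0 < q" "q < p + 2"
  obtains K where "K \<ge> 1"
    "\<And>f :: complex^'n \<Rightarrow> complex. holo_on f (ball 0 1) \<Longrightarrow>
      I2 p q \<alpha> f \<le> I3 p q \<alpha> f \<and> I3 p q \<alpha> f \<le> I4 p q \<alpha> f \<and> I4 p q \<alpha> f \<le> ennreal K * I1 p \<alpha> f \<and>
      ennreal (cmod (f 0) powr p) \<le> ennreal K * I1 p \<alpha> f \<and>
      I1 p \<alpha> f \<le> ennreal K * (ennreal (cmod (f 0) powr p) + I2 p q \<alpha> f)"
proof -
  obtain \<zeta> where \<zeta>: "\<zeta> > 0" "(\<integral>\<^sup>+ (w::complex^'n). indicator (ball 0 1) w * ennreal ((1 - (norm w)\<^sup>2) powr \<alpha>) \<partial>lborel) = ennreal \<zeta>"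
    by (rule total_mass[OF \<alpha>], rule that)
  obtain A where A: "A > 0" and low: "\<And>f :: complex^'n \<Rightarrow> complex. holo_on f (ball 0 1) \<Longrightarrow>
      wint (\<lambda>s. s powr \<alpha>) (\<lambda>z. ennreal (cmod (f z) powr p))
      \<le> ennreal A * (ennreal (cmod (f 0) powr p) + wint (\<lambda>s. s powr \<alpha>) (rad_term p q f))"
    by (rule norm_le_radial_term[OF p \<alpha> q(1)], rule that)
  obtain B where B: "B > 0" and cen: "\<And>f :: complex^'n \<Rightarrow> complex. holo_on f (ball 0 1) \<Longrightarrow>
      ennreal (cmod (f 0) powr p) \<le> ennreal B * wint (\<lambda>s. s powr \<alpha>) (\<lambda>z. ennreal (cmod (f z) powr p))"
    by (rule center_le_norm[OF p, of \<alpha>], rule that)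
  obtain D where D: "D > 0" and up: "\<And>(f :: complex^'n \<Rightarrow> complex) \<omega>. \<lbrakk>holo_on f (ball 0 1); weight_ok \<alpha> (3 powr (\<bar>\<alpha>\<bar> + 0)) \<omega>\<rbrakk> \<Longrightarrow>
      wint \<omega> (\<lambda>z. ennreal (cmod (f z) powr (p - q) * inv_grad_norm f z powr q))
      \<le> ennreal D * wint \<omega> (\<lambda>z. ennreal (cmod (f z) powr p))"
    by (rule wint_inv_grad_le[OF p q, of \<alpha> "3 powr (\<bar>\<alpha>\<bar> + 0)"], rule that)
  \<comment> \<open>One summand for each inequality. The factors \<zeta> and 1/\<zeta> appear
    because |f 0| powr p, unlike the integrals, does not scale with the normalisation of the
    measure.\<close>
  define K where "K = 1 + D + B * \<zeta> + A + A / \<zeta>"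
  have K: "K \<ge> 1" "D \<le> K" "B * \<zeta> \<le> K" "A \<le> K" "A / \<zeta> \<le> K"
    using A B D \<zeta>(1) by (auto simp: K_def)
  have main: "I2 p q \<alpha> f \<le> I3 p q \<alpha> f \<and> I3 p q \<alpha> f \<le> I4 p q \<alpha> f \<and> I4 p q \<alpha> f \<le> ennreal K * I1 p \<alpha> f \<and>
      ennreal (cmod (f 0) powr p) \<le> ennreal K * I1 p \<alpha> f \<and>
      I1 p \<alpha> f \<le> ennreal K * (ennreal (cmod (f 0) powr p) + I2 p q \<alpha> f)"
    if f: "holo_on f (ball 0 1)" for f :: "complex^'n \<Rightarrow> complex"
  proof -
    let ?W = "wint (\<lambda>s. s powr \<alpha>)"
    let ?z = "ennreal (1 / \<zeta>)"
    let ?f0 = "ennreal (cmod (f 0) powr p)"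
    have i1: "I1 p \<alpha> f = ?z * ?W (\<lambda>z. ennreal (cmod (f z) powr p))"
      unfolding I1_def by (rule nn_integral_dv_alpha[OF \<zeta> cmod_powr_measurable[OF f]])
    have i2: "I2 p q \<alpha> f = ?z * ?W (rad_term p q f)"
      using nn_integral_dv_alpha[OF \<zeta> rad_term_measurable[OF f, of p q]]
      unfolding I2_def rad_term_def[abs_def] defect_def .
    have i3: "I3 p q \<alpha> f = ?z * ?W (\<lambda>z. ennreal (cmod (f z) powr (p - q) * ((1 - (norm z)\<^sup>2) * cgrad_norm f z) powr q))"
      unfolding I3_def by (rule nn_integral_dv_alpha[OF \<zeta> grad_terms_measurable(1)[OF f]])
    have i4: "I4 p q \<alpha> f = ?z * ?W (\<lambda>z. ennreal (cmod (f z) powr (p - q) * inv_grad_norm f z powr q))"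
      unfolding I4_def by (rule nn_integral_dv_alpha[OF \<zeta> grad_terms_measurable(2)[OF f]])
    have 23: "I2 p q \<alpha> f \<le> I3 p q \<alpha> f"
      unfolding i2 i3
    proof (intro mult_left_mono wint_mono)
      fix z :: "complex^'n" assume z: "z \<in> ball 0 1"
      show "rad_term p q f z \<le> ennreal (cmod (f z) powr (p - q) * ((1 - (norm z)\<^sup>2) * cgrad_norm f z) powr q)"
        unfolding rad_term_def defect_def[symmetric] using defect_pos[OF z] q
        by (intro ennreal_leI mult_left_mono powr_mono2 radial_le_cgrad[OF z]) auto
    qed simp
    have 34: "I3 p q \<alpha> f \<le> I4 p q \<alpha> f"
      unfolding i3 i4
    proof (intro mult_left_mono wint_mono)
      fix z :: "complex^'n" assume z: "z \<in> ball 0 1"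
      show "ennreal (cmod (f z) powr (p - q) * ((1 - (norm z)\<^sup>2) * cgrad_norm f z) powr q) \<le> ennreal (cmod (f z) powr (p - q) * inv_grad_norm f z powr q)"
        unfolding defect_def[symmetric] using defect_pos[OF z] q
        by (intro ennreal_leI mult_left_mono powr_mono2 defect_cgrad_le_inv_grad[OF f z]) (auto simp: cgrad_norm_nonneg)
    qed simp
    have 4: "I4 p q \<alpha> f \<le> ennreal K * I1 p \<alpha> f"
    proof -
      have "?W (\<lambda>z. ennreal (cmod (f z) powr (p - q) * inv_grad_norm f z powr q)) \<le> ennreal D * ?W (\<lambda>z. ennreal (cmod (f z) powr p))"
        using up[OF f weight_ok_reg_weight[of 0 1]] by (simp add: wint_reg_weight_0)
      also have "\<dots> \<le> ennreal K * ?W (\<lambda>z. ennreal (cmod (f z) powr p))"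
        using K by (intro mult_right_mono ennreal_leI) auto
      finally have "I4 p q \<alpha> f \<le> ?z * (ennreal K * ?W (\<lambda>z. ennreal (cmod (f z) powr p)))"
        unfolding i4 by (rule mult_left_mono) simp
      then show ?thesis unfolding i1 by (simp only: mult_ac)
    qed
    have zz: "ennreal \<zeta> * ?z = 1"
    proof -
      have "ennreal \<zeta> * ?z = ennreal (\<zeta> * (1 / \<zeta>))" by (rule ennreal_mult[symmetric]) (use \<zeta>(1) in auto)
      then show ?thesis using \<zeta>(1) by simp
    qed
    have 0: "?f0 \<le> ennreal K * I1 p \<alpha> f"
    proof -
      have "?W (\<lambda>z. ennreal (cmod (f z) powr p)) = (ennreal \<zeta> * ?z) * ?W (\<lambda>z. ennreal (cmod (f z) powr p))"
        unfolding zz by simp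
      also have "\<dots> = ennreal \<zeta> * I1 p \<alpha> f" unfolding i1 by (simp only: mult.assoc)
      finally have "?f0 \<le> ennreal B * (ennreal \<zeta> * I1 p \<alpha> f)" using cen[OF f] by simp
      also have "\<dots> = ennreal (B * \<zeta>) * I1 p \<alpha> f" using B \<zeta>(1) by (simp add: ennreal_mult mult.assoc)
      also have "\<dots> \<le> ennreal K * I1 p \<alpha> f" using K by (intro mult_right_mono ennreal_leI) auto
      finally show ?thesis .
    qed
    have 1: "I1 p \<alpha> f \<le> ennreal K * (?f0 + I2 p q \<alpha> f)"
    proof -
      have "I1 p \<alpha> f \<le> ?z * (ennreal A * (?f0 + ?W (rad_term p q f)))"
        unfolding i1 by (rule mult_left_mono[OF low[OF f]]) simp
      also have "\<dots> = (ennreal A * ?z) * ?f0 + ennreal A * I2 p q \<alpha> f"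
        unfolding i2 by (simp only: distrib_left mult_ac)
      also have "ennreal A * ?z = ennreal (A * (1 / \<zeta>))" by (rule ennreal_mult[symmetric]) (use A \<zeta>(1) in auto)
      also have "ennreal (A * (1 / \<zeta>)) * ?f0 + ennreal A * I2 p q \<alpha> f \<le> ennreal K * ?f0 + ennreal K * I2 p q \<alpha> f"
        using K by (intro add_mono mult_right_mono ennreal_leI) auto
      finally show ?thesis by (simp only: distrib_left)
    qed
    show ?thesis using 23 34 4 0 1 by (intro conjI)
  qed
  show ?thesis by (rule that[OF K(1)]) (rule main)
qed

theorem theorem2:
  fixes p q \<alpha> :: real
  assumes "p > 0" and "\<alpha> > -1" and "0 < q" and "q < p + 2"
  shows "(\<forall>f :: complex^'n \<Rightarrow> complex. holo_on f (ball 0 1) \<longrightarrow>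
            ((I1 p \<alpha> f < \<infinity> \<longleftrightarrow> I2 p q \<alpha> f < \<infinity>) \<and>
             (I1 p \<alpha> f < \<infinity> \<longleftrightarrow> I3 p q \<alpha> f < \<infinity>) \<and>
             (I1 p \<alpha> f < \<infinity> \<longleftrightarrow> I4 p q \<alpha> f < \<infinity>)))
       \<and> (\<exists>C :: real. C > 0 \<and>
            (\<forall>f :: complex^'n \<Rightarrow> complex. holo_on f (ball 0 1) \<longrightarrow>
              (let Q = (\<lambda>i::nat. if i = 1 then I1 p \<alpha> f
                          else if i = 2 then ennreal (cmod (f 0) powr p) + I2 p q \<alpha> f
                          else if i = 3 then ennreal (cmod (f 0) powr p) + I3 p q \<alpha> f
                          else ennreal (cmod (f 0) powr p) + I4 p q \<alpha> f)
               in \<forall>i\<in>{1..4}. \<forall>j\<in>{1..4}. Q i \<le> ennreal C * Q j)))"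
proof -
  obtain K where K: "K \<ge> 1" and cmp: "\<And>f :: complex^'n \<Rightarrow> complex. holo_on f (ball 0 1) \<Longrightarrow>
      I2 p q \<alpha> f \<le> I3 p q \<alpha> f \<and> I3 p q \<alpha> f \<le> I4 p q \<alpha> f \<and> I4 p q \<alpha> f \<le> ennreal K * I1 p \<alpha> f \<and>
      ennreal (cmod (f 0) powr p) \<le> ennreal K * I1 p \<alpha> f \<and>
      I1 p \<alpha> f \<le> ennreal K * (ennreal (cmod (f 0) powr p) + I2 p q \<alpha> f)"
    by (rule Bergman_integrals_comparable[OF assms], rule that)
  show ?thesis
  proof (intro conjI allI impI exI)
    fix f :: "complex^'n \<Rightarrow> complex" assume f: "holo_on f (ball 0 1)"
    from cmp[OF f] have c: "I2 p q \<alpha> f \<le> I3 p q \<alpha> f" "I3 p q \<alpha> f \<le> I4 p q \<alpha> f" "I4 p q \<alpha> f \<le> ennreal K * I1 p \<alpha> f"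
      "I1 p \<alpha> f \<le> ennreal K * (ennreal (cmod (f 0) powr p) + I2 p q \<alpha> f)"
      by - (elim conjE, assumption)+
    have fin: "I4 p q \<alpha> f < \<infinity>" if "I1 p \<alpha> f < \<infinity>"
    proof -
      have "ennreal K * I1 p \<alpha> f < \<infinity>" using that by (simp add: ennreal_mult_less_top)
      then show ?thesis by (rule le_less_trans[OF c(3)])
    qed
    have fin': "I1 p \<alpha> f < \<infinity>" if "I2 p q \<alpha> f < \<infinity>"
    proof -
      have "ennreal K * (ennreal (cmod (f 0) powr p) + I2 p q \<alpha> f) < \<infinity>" using that by (simp add: ennreal_mult_less_top)
      then show ?thesis by (rule le_less_trans[OF c(4)])
    qed
    have 34: "I3 p q \<alpha> f < \<infinity>" if "I4 p q \<alpha> f < \<infinity>" by (rule le_less_trans[OF c(2) that])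
    have 23: "I2 p q \<alpha> f < \<infinity>" if "I3 p q \<alpha> f < \<infinity>" by (rule le_less_trans[OF c(1) that])
    show "I1 p \<alpha> f < \<infinity> \<longleftrightarrow> I2 p q \<alpha> f < \<infinity>" by (rule iffI, rule 23, rule 34, erule fin, erule fin')
    show "I1 p \<alpha> f < \<infinity> \<longleftrightarrow> I3 p q \<alpha> f < \<infinity>" by (rule iffI, rule 34, erule fin, rule fin', erule 23)
    show "I1 p \<alpha> f < \<infinity> \<longleftrightarrow> I4 p q \<alpha> f < \<infinity>" by (rule iffI, erule fin, rule fin', rule 23, erule 34)
  next
    \<comment> \<open>2 K bounds each quantity by \<open>I1\<close>, the 2 because |f 0| powr p and
      \<open>I4\<close> are each at most K times \<open>I1\<close>; the other K leads from
      \<open>I1\<close> back to an arbitrary one.\<close>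
    show "2 * K * K > 0" using K by simp
  next
    fix f :: "complex^'n \<Rightarrow> complex" assume f: "holo_on f (ball 0 1)"
    from cmp[OF f] have c: "I2 p q \<alpha> f \<le> I3 p q \<alpha> f" "I3 p q \<alpha> f \<le> I4 p q \<alpha> f" "I4 p q \<alpha> f \<le> ennreal K * I1 p \<alpha> f"
      "ennreal (cmod (f 0) powr p) \<le> ennreal K * I1 p \<alpha> f"
      "I1 p \<alpha> f \<le> ennreal K * (ennreal (cmod (f 0) powr p) + I2 p q \<alpha> f)"
      by - (elim conjE, assumption)+
    let ?f0 = "ennreal (cmod (f 0) powr p)"
    define Q where "Q = (\<lambda>i::nat. if i = 1 then I1 p \<alpha> f
                          else if i = 2 then ?f0 + I2 p q \<alpha> f
                          else if i = 3 then ?f0 + I3 p q \<alpha> f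
                          else ?f0 + I4 p q \<alpha> f)"
    have q: "Q 1 = I1 p \<alpha> f" "Q 2 = ?f0 + I2 p q \<alpha> f" "Q 3 = ?f0 + I3 p q \<alpha> f" "Q 4 = ?f0 + I4 p q \<alpha> f"
      by (simp_all add: Q_def)
    have 12: "Q 1 \<le> ennreal K * Q 2" unfolding q by (rule c(5))
    have 23: "Q 2 \<le> Q 3" unfolding q by (rule add_left_mono[OF c(1)])
    have 34: "Q 3 \<le> Q 4" unfolding q by (rule add_left_mono[OF c(2)])
    have 41: "Q 4 \<le> ennreal (2 * K) * Q 1"
    proof -
      have "Q 4 \<le> ennreal K * I1 p \<alpha> f + ennreal K * I1 p \<alpha> f" unfolding q by (rule add_mono[OF c(4) c(3)])
      also have "\<dots> = (ennreal K + ennreal K) * I1 p \<alpha> f" by (simp only: distrib_right)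
      also have "ennreal K + ennreal K = ennreal (K + K)" by (rule ennreal_plus[symmetric]) (use K in auto)
      finally show ?thesis unfolding q mult_2 .
    qed
    have le1: "Q i \<le> ennreal (2 * K) * Q 1" if "i \<in> {1..4}" for i
    proof -
      have "Q 1 = ennreal 1 * Q 1" by simp
      also have "\<dots> \<le> ennreal (2 * K) * Q 1" using K by (intro mult_right_mono ennreal_leI) auto
      finally have 11: "Q 1 \<le> ennreal (2 * K) * Q 1" .
      have "i = 1 \<or> i = 2 \<or> i = 3 \<or> i = 4" using that by auto
      then show ?thesis using 11 order_trans[OF order_trans[OF 23 34] 41] order_trans[OF 34 41] 41 by (elim disjE) (simp_all only:)
    qed
    have ge1: "Q 1 \<le> ennreal K * Q j" if "j \<in> {1..4}" for j
    proof -
      have "Q 1 = ennreal 1 * Q 1" by simp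
      also have "\<dots> \<le> ennreal K * Q 1" using K by (intro mult_right_mono ennreal_leI) auto
      finally have 11: "Q 1 \<le> ennreal K * Q 1" .
      have 24: "Q 2 \<le> Q 4" using 23 34 by (rule order_trans)
      have m: "ennreal K * Q 2 \<le> ennreal K * Q i" if "Q 2 \<le> Q i" for i using that by (rule mult_left_mono) simp
      have "j = 1 \<or> j = 2 \<or> j = 3 \<or> j = 4" using that by auto
      then show ?thesis using 11 12 order_trans[OF 12 m[OF 23]] order_trans[OF 12 m[OF 24]] by (elim disjE) (simp_all only:)
    qed
    have "Q i \<le> ennreal (2 * K * K) * Q j" if ij: "i \<in> {1..4}" "j \<in> {1..4}" for i j
    proof -
      have "Q i \<le> ennreal (2 * K) * (ennreal K * Q j)"
        by (rule order_trans[OF le1[OF ij(1)] mult_left_mono[OF ge1[OF ij(2)]]]) simp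
      also have "\<dots> = ennreal (2 * K * K) * Q j"
      proof -
        have "ennreal (2 * K * K) = ennreal (2 * K) * ennreal K" by (rule ennreal_mult) (use K in auto)
        then show ?thesis by (simp only: mult.assoc)
      qed
      finally show ?thesis .
    qed
    then have "\<forall>i\<in>{1..4}. \<forall>j\<in>{1..4}. Q i \<le> ennreal (2 * K * K) * Q j" by (intro ballI)
    then show "let Q = (\<lambda>i::nat. if i = 1 then I1 p \<alpha> f
                          else if i = 2 then ?f0 + I2 p q \<alpha> f
                          else if i = 3 then ?f0 + I3 p q \<alpha> f
                          else ?f0 + I4 p q \<alpha> f)
               in \<forall>i\<in>{1..4}. \<forall>j\<in>{1..4}. Q i \<le> ennreal (2 * K * K) * Q j"
      unfolding Let_def Q_def .
  qed
qed

end
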